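(* (Dimension 4 / $\mathbb P^3$.) (i) Every complex Jordan algebra of rank $3$ and dimension $4$ is isomorphic to exactly one of the following seven algebras (products are commutative, products of basis elements not listed are zero): $\mathcal J^4_1=\mathbb C\times\mathcal J^3_{q,2}$; $\mathcal J^4_2=\mathbb C\times\mathcal J^3_{q,1}$; $\mathcal J^4_3=\mathbb C\times\mathcal J^3_{q,0}$; $\mathcal J^4_4$, with basis $(e_1,b,a,e_2)$ and $e_1^2=e_1$, $e_2^2=e_2$, $e_1b=b$, $e_1a=e_2a=\tfrac12a$, $a^2=b$; $\mathcal J^4_5$, with basis $(e_1,b,a,e_2)$ and $e_1^2=e_1$, $e_2^2=e_2$, $e_1b=b$, $e_1a=e_2a=\tfrac12a$; $\mathcal J^4_6$, with basis $(e,v_1,v_2,v_3)$, $e$ the unity, and $v_1^2=v_2^2=v_3$; $\mathcal J^4_7$, with basis $(e,v_1,v_2,v_3)$, $e$ the unity, and $v_1^2=v_3$. (ii) Every quadro-quadric Cremona transformation of $\mathbb P^3$ over $\mathbb C$ is linearly equivalent to the projectivization of exactly one of the following seven quadratic maps of $\mathbb C^4$ (in coordinates $(x,y,z,t)$), corresponding in this order to the adjoints of $\mathcal J^4_1,\dots,\mathcal J^4_7$: $(y^2+z^2+t^2,xy,-xz,-xt)$; $(yz,xz,xy,xt)$; $(y^2,xy,xz,xt)$; $(xy,x^2,t^2-yz,xt)$; $(xy,x^2,yz,xt)$; $(x^2,-xy,-xz,2yz-xt)$; $(x^2,-xy,-xz,y^2-xt)$.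
   Context: A Jordan algebra is a finite-dimensional commutative complex algebra with unity satisfying $x^2(xy)=x(x^2y)$. Its rank is the dimension of the subalgebra generated by the unity and a general element. For $0\le r\le m-1$, $\mathcal J^m_{q,r}$ is the $m$-dimensional algebra $\mathbb C\oplus\mathbb C^{m-1}$ with product $(\lambda,w)\cdot(\lambda',w')=(\lambda\lambda'-q(w,w'),\lambda w'+\lambda'w)$, where $q(w,w')=\sum_{i=1}^r w_iw_i'$. For a rank $3$ Jordan algebra with unity $e$, whose elements satisfy $x^3-T(x)x^2+S(x)x-N(x)e=0$ generically ($T,S,N$ forms of degrees $1,2,3$), the adjoint is $x^\#=x^2-T(x)x+S(x)e$. In (ii) the correspondence between the listed maps and the adjoints of the algebras is up to linear equivalence. A quadro-quadric Cremona transformation of $\mathbb P^n$ is a birational map given by quadratic forms without common factor whose inverse is also given by quadratic forms without common factor. Two Cremona transformations $f,\tilde f$ of $\mathbb P^n$ are linearly equivalent if $\tilde f=\ell_1\circ f\circ\ell_2$ with $\ell_1,\ell_2\in\mathrm{Aut}(\mathbb P^n)$. *)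

theory Defs
  imports "HOL-Analysis.Analysis"
begin

section \<open>Complex algebras\<close>

text \<open>The underlying vector space is the whole type \<open>'a\<close> with scalar multiplication \<open>scl\<close>.\<close>

record 'a calg =
  scl :: "complex \<Rightarrow> 'a \<Rightarrow> 'a"
  prd :: "'a \<Rightarrow> 'a \<Rightarrow> 'a"
  unt :: 'a

definition jordan_algebra :: "'a::ab_group_add calg \<Rightarrow> bool" where
  "jordan_algebra A \<longleftrightarrow>
     (\<exists>B. finite_dimensional_vector_space (scl A) B) \<and>
     (\<forall>x. Vector_Spaces.linear (scl A) (scl A) (\<lambda>y. prd A x y)) \<and>
     (\<forall>y. Vector_Spaces.linear (scl A) (scl A) (\<lambda>x. prd A x y)) \<and>
     (\<forall>x y. prd A x y = prd A y x) \<and>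
     (\<forall>x. prd A (unt A) x = x) \<and>
     (\<forall>x y. prd A (prd A x x) (prd A x y) = prd A x (prd A (prd A x x) y))"

definition alg_dim :: "'a::ab_group_add calg \<Rightarrow> nat" where
  "alg_dim A = vector_space.dim (scl A) UNIV"

definition isomorphic :: "'a::ab_group_add calg \<Rightarrow> 'b::ab_group_add calg \<Rightarrow> bool" where
  "isomorphic A B \<longleftrightarrow>
     (\<exists>f. Vector_Spaces.linear (scl A) (scl B) f \<and> bij f \<and>
          (\<forall>x y. f (prd A x y) = prd B (f x) (f y)))"

section \<open>Polynomial functions and forms\<close>

text \<open>Since \<open>\<complex>\<close> is infinite, polynomials are identified with the functions they define.
  The definition does not depend on a basis: on \<open>(\<complex>^'n, *s)\<close> these are the polynomials in the
  coordinates.\<close>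

inductive poly_fun :: "(complex \<Rightarrow> 'a::ab_group_add \<Rightarrow> 'a) \<Rightarrow> ('a \<Rightarrow> complex) \<Rightarrow> bool"
  for s where
  const: "poly_fun s (\<lambda>x. c)"
| linear: "Vector_Spaces.linear s (*) l \<Longrightarrow> poly_fun s l"
| add: "poly_fun s p \<Longrightarrow> poly_fun s q \<Longrightarrow> poly_fun s (\<lambda>x. p x + q x)"
| mult: "poly_fun s p \<Longrightarrow> poly_fun s q \<Longrightarrow> poly_fun s (\<lambda>x. p x * q x)"

definition form :: "(complex \<Rightarrow> 'a::ab_group_add \<Rightarrow> 'a) \<Rightarrow> nat \<Rightarrow> ('a \<Rightarrow> complex) \<Rightarrow> bool" where
  "form s d p \<longleftrightarrow> poly_fun s p \<and> (\<forall>c x. p (s c x) = c ^ d * p x)"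

text \<open>\<open>P\<close> holds for a general element, i.e. on a nonempty Zariski-open set; the
  nonvanishing loci of single polynomials form a basis of the Zariski topology.\<close>

definition generically :: "(complex \<Rightarrow> 'a::ab_group_add \<Rightarrow> 'a) \<Rightarrow> ('a \<Rightarrow> bool) \<Rightarrow> bool" where
  "generically s P \<longleftrightarrow> (\<exists>p. poly_fun s p \<and> (\<exists>x. p x \<noteq> 0) \<and> (\<forall>x. p x \<noteq> 0 \<longrightarrow> P x))"

section \<open>Rank and adjoint\<close>

definition generated_subalgebra :: "'a::ab_group_add calg \<Rightarrow> 'a set \<Rightarrow> 'a set" where
  "generated_subalgebra A X =
     \<Inter>{V. module.subspace (scl A) V \<and> X \<subseteq> V \<and> (\<forall>x\<in>V. \<forall>y\<in>V. prd A x y \<in> V)}"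

definition has_rank :: "'a::ab_group_add calg \<Rightarrow> nat \<Rightarrow> bool" where
  "has_rank A r \<longleftrightarrow>
     generically (scl A)
       (\<lambda>x. vector_space.dim (scl A) (generated_subalgebra A {unt A, x}) = r)"

definition is_adjoint :: "'a::ab_group_add calg \<Rightarrow> ('a \<Rightarrow> 'a) \<Rightarrow> bool" where
  "is_adjoint A adj \<longleftrightarrow>
     (\<exists>T S N. form (scl A) 1 T \<and> form (scl A) 2 S \<and> form (scl A) 3 N \<and>
        generically (scl A)
          (\<lambda>x. prd A x (prd A x x) - scl A (T x) (prd A x x) + scl A (S x) x
               - scl A (N x) (unt A) = 0) \<and>
        (\<forall>x. adj x = prd A x x - scl A (T x) x + scl A (S x) (unt A)))"

section \<open>Rational maps of projective space\<close>

text \<open>A rational map of \<open>\<P>\<^sup>n\<close>, with \<open>CARD('n) = n + 1\<close>, is represented by a tuple of forms of the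
  same degree, not all zero. Two such tuples represent the same rational map iff all their
  \<open>2\<times>2\<close> minors vanish.\<close>

definition same_ratmap ::
    "(complex^'n \<Rightarrow> complex^'n) \<Rightarrow> (complex^'n \<Rightarrow> complex^'n) \<Rightarrow> bool" where
  "same_ratmap F G \<longleftrightarrow> (\<forall>x i j. F x $ i * G x $ j = F x $ j * G x $ i)"

text \<open>The non-vanishing conditions say that the compositions are defined as rational maps.\<close>

definition inverse_ratmaps ::
    "(complex^'n \<Rightarrow> complex^'n) \<Rightarrow> (complex^'n \<Rightarrow> complex^'n) \<Rightarrow> bool" where
  "inverse_ratmaps F G \<longleftrightarrow>
     (\<exists>x. G (F x) \<noteq> 0) \<and> same_ratmap (G \<circ> F) id \<and>
     (\<exists>x. F (G x) \<noteq> 0) \<and> same_ratmap (F \<circ> G) id"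

text \<open>The second conjunct also excludes \<open>F = 0\<close>.\<close>

definition coprime_quadratic_forms :: "(complex^'n \<Rightarrow> complex^'n) \<Rightarrow> bool" where
  "coprime_quadratic_forms F \<longleftrightarrow>
     (\<forall>i. form (*s) 2 (\<lambda>x. F x $ i)) \<and>
     \<not> (\<exists>p. poly_fun (*s) p \<and> (\<nexists>c. \<forall>x. p x = c) \<and>
          (\<forall>i. \<exists>q. poly_fun (*s) q \<and> (\<forall>x. F x $ i = p x * q x)))"

text \<open>\<open>F\<close> stands for its projectivization.\<close>

definition quadro_quadric_cremona :: "(complex^'n \<Rightarrow> complex^'n) \<Rightarrow> bool" where
  "quadro_quadric_cremona F \<longleftrightarrow>
     coprime_quadratic_forms F \<and> (\<exists>G. coprime_quadratic_forms G \<and> inverse_ratmaps F G)"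

text \<open>Automorphisms of \<open>\<P>\<^sup>n\<close> are represented by linear automorphisms of \<open>\<complex>\<^sup>n\<^sup>+\<^sup>1\<close>.\<close>

definition linearly_equivalent ::
    "(complex^'n \<Rightarrow> complex^'n) \<Rightarrow> (complex^'n \<Rightarrow> complex^'n) \<Rightarrow> bool" where
  "linearly_equivalent F G \<longleftrightarrow>
     (\<exists>L1 L2. Vector_Spaces.linear (*s) (*s) L1 \<and> bij L1 \<and>
              Vector_Spaces.linear (*s) (*s) L2 \<and> bij L2 \<and>
              same_ratmap G (L1 \<circ> F \<circ> L2))"

text \<open>The adjoint of an algebra, read in linear coordinates \<open>\<phi>\<close>, is linearly equivalent to \<open>F\<close>.\<close>

definition adjoint_equivalent ::
    "'a::ab_group_add calg \<Rightarrow> (complex^'n \<Rightarrow> complex^'n) \<Rightarrow> bool" where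
  "adjoint_equivalent A F \<longleftrightarrow>
     (\<exists>adj \<phi>. is_adjoint A adj \<and> Vector_Spaces.linear (scl A) (*s) \<phi> \<and> bij \<phi> \<and>
              linearly_equivalent (\<phi> \<circ> adj \<circ> inv \<phi>) F)"

section \<open>The seven algebras\<close>

definition complex_alg :: "complex calg" where
  "complex_alg = \<lparr>scl = (*), prd = (*), unt = 1\<rparr>"

definition prod_alg :: "'a calg \<Rightarrow> 'b calg \<Rightarrow> ('a \<times> 'b) calg" where
  "prod_alg A B =
     \<lparr>scl = (\<lambda>c (x, y). (scl A c x, scl B c y)),
      prd = (\<lambda>(x, y) (x', y'). (prd A x x', prd B y y')),
      unt = (unt A, unt B)\<rparr>"

text \<open>\<open>\<J>\<^sup>m\<^sub>q\<^sub>,\<^sub>r\<close> for \<open>CARD('n) = m - 1\<close> and \<open>r \<le> m - 1\<close>. The index type is meant to be a numeral type,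
  whose elements are enumerated by \<open>of_nat 1, \<dots>, of_nat CARD('n)\<close>.\<close>

definition spin_alg :: "nat \<Rightarrow> (complex \<times> (complex^'n::{finite,comm_ring_1})) calg" where
  "spin_alg r =
     \<lparr>scl = (\<lambda>c (l, w). (c * l, c *s w)),
      prd = (\<lambda>(l, w) (l', w').
               (l * l' - (\<Sum>i=1..r. w $ of_nat i * w' $ of_nat i), l *s w' + l' *s w)),
      unt = (1, 0)\<rparr>"

text \<open>The commutative algebra with the given products of standard basis vectors; for each unordered
  pair only one of the two products is listed, and products not listed are zero.\<close>

definition table_product ::
    "(('n \<times> 'n) \<times> (complex^'n)) list \<Rightarrow> 'n \<Rightarrow> 'n \<Rightarrow> complex^'n" where
  "table_product t i j =
     (case map_of t (i, j) of Some v \<Rightarrow> v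
      | None \<Rightarrow> (case map_of t (j, i) of Some v \<Rightarrow> v | None \<Rightarrow> 0))"

definition table_alg ::
    "(('n::finite \<times> 'n) \<times> (complex^'n)) list \<Rightarrow> complex^'n \<Rightarrow> (complex^'n) calg" where
  "table_alg t u =
     \<lparr>scl = (*s),
      prd = (\<lambda>x y. \<Sum>i\<in>UNIV. \<Sum>j\<in>UNIV. (x $ i * y $ j) *s table_product t i j),
      unt = u\<rparr>"

abbreviation bas :: "'n \<Rightarrow> complex^'n" where
  "bas i \<equiv> axis i 1"

definition J4_1 :: "(complex \<times> complex \<times> (complex^2)) calg" where
  "J4_1 = prod_alg complex_alg (spin_alg 2)"

definition J4_2 :: "(complex \<times> complex \<times> (complex^2)) calg" where
  "J4_2 = prod_alg complex_alg (spin_alg 1)"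

definition J4_3 :: "(complex \<times> complex \<times> (complex^2)) calg" where
  "J4_3 = prod_alg complex_alg (spin_alg 0)"

text \<open>Basis \<open>(e\<^sub>1, b, a, e\<^sub>2)\<close>, indexed by \<open>1, 2, 3, 4\<close>.\<close>

definition J4_4 :: "(complex^4) calg" where
  "J4_4 = table_alg
     [((1, 1), bas 1), ((4, 4), bas 4), ((1, 2), bas 2),
      ((1, 3), (1/2) *s bas 3), ((4, 3), (1/2) *s bas 3), ((3, 3), bas 2)]
     (bas 1 + bas 4)"

definition J4_5 :: "(complex^4) calg" where
  "J4_5 = table_alg
     [((1, 1), bas 1), ((4, 4), bas 4), ((1, 2), bas 2),
      ((1, 3), (1/2) *s bas 3), ((4, 3), (1/2) *s bas 3)]
     (bas 1 + bas 4)"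

text \<open>Basis \<open>(e, v\<^sub>1, v\<^sub>2, v\<^sub>3)\<close>, indexed by \<open>1, 2, 3, 4\<close>.\<close>

definition J4_6 :: "(complex^4) calg" where
  "J4_6 = table_alg
     [((1, 1), bas 1), ((1, 2), bas 2), ((1, 3), bas 3), ((1, 4), bas 4),
      ((2, 2), bas 4), ((3, 3), bas 4)]
     (bas 1)"

definition J4_7 :: "(complex^4) calg" where
  "J4_7 = table_alg
     [((1, 1), bas 1), ((1, 2), bas 2), ((1, 3), bas 3), ((1, 4), bas 4),
      ((2, 2), bas 4)]
     (bas 1)"

section \<open>The seven quadratic maps\<close>

definition in_coords :: "(complex \<Rightarrow> complex \<Rightarrow> complex \<Rightarrow> complex \<Rightarrow> complex list) \<Rightarrow>
    complex^4 \<Rightarrow> complex^4" where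
  "in_coords f v = vector (f (v $ 1) (v $ 2) (v $ 3) (v $ 4))"

definition "Q1 = in_coords (\<lambda>x y z t. [y\<^sup>2 + z\<^sup>2 + t\<^sup>2, x*y, - (x*z), - (x*t)])"
definition "Q2 = in_coords (\<lambda>x y z t. [y*z, x*z, x*y, x*t])"
definition "Q3 = in_coords (\<lambda>x y z t. [y\<^sup>2, x*y, x*z, x*t])"
definition "Q4 = in_coords (\<lambda>x y z t. [x*y, x\<^sup>2, t\<^sup>2 - y*z, x*t])"
definition "Q5 = in_coords (\<lambda>x y z t. [x*y, x\<^sup>2, y*z, x*t])"
definition "Q6 = in_coords (\<lambda>x y z t. [x\<^sup>2, - (x*y), - (x*z), 2*y*z - x*t])"
definition "Q7 = in_coords (\<lambda>x y z t. [x\<^sup>2, - (x*y), - (x*z), y\<^sup>2 - x*t])"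

end

theory Submission
  imports Defs "HOL-Computational_Algebra.Fundamental_Theorem_Algebra"
begin

text \<open>An element generating a three-dimensional subalgebra of a rank 3 Jordan algebra has a cubic minimal
  polynomial. If the polynomial has a simple root for some such element, the corresponding primitive
  idempotent has a Peirce decomposition in which the fourth dimension is homogeneous. If it lies in
  the 0-component, the algebra is \<open>\<complex>\<close> times a quadratic algebra; if it lies in the 1/2-component,
  the algebra is the fourth or the fifth one or another idempotent leads back to the first case.
  If all the cubics have a triple root, the algebra is \<open>\<complex>e\<close> plus a nilpotent ideal.

  Let \<open>F\<close> be quadro-quadric with inverse \<open>G\<close>. After a linear change, \<open>F(e + tv) = e - tv + t\<^sup>2F(v)\<close>
  for \<open>v\<close> in a complement \<open>V\<close> of \<open>\<complex>e\<close>, and the same holds for \<open>G\<close>. Comparing the coefficients of \<open>t\<close> in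
  \<open>G(F(e + tv)) \<sim> e + tv\<close> shows \<open>F = G\<close>, and \<open>F(v) = v \<diamondop> v - a(v)e\<close> with \<open>v \<diamondop> (v \<diamondop> v) = a(v)v\<close> and
  \<open>a(v \<diamondop> v) = a(v)\<^sup>2\<close>. These identities make \<open>\<complex>e \<oplus> V\<close> a Jordan algebra of rank 3 with adjoint \<open>F\<close>, so
  the classification of the maps follows from that of the algebras. That no two of the seven maps
  are equivalent is seen on their base loci, and that no two of the algebras are isomorphic follows
  because the adjoint is unique.\<close>

section \<open>Polynomial functions\<close>

text \<open>The identities for \<open>v \<diamondop> v\<close> do not visibly contain the Jordan
  identity: besides their polarisations it needs
  \<open>a (v \<diamondop> v) w = a v (v \<diamondop> w)\<close>, which is obtained at general
  \<open>v\<close> from a commutator and extended by density. The normalisation copies the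
  differential of an adjoint at the unity, \<open>T v *s e - v\<close> with \<open>T e = 3\<close>;
  \<open>V\<close> is the kernel of \<open>T\<close>. That the resulting algebra has rank 3 and not
  less is where the absence of a common factor enters: if \<open>v\<close> and
  \<open>v \<diamondop> v\<close> were always dependent, \<open>F\<close> would be a linear form
  times a linear map. Linear equivalence concerns rational maps, whereas base loci and differentials
  belong to the tuples of forms. The bridge is that a quadratic tuple defining the same rational map
  as one of the seven is a constant multiple of it.\<close>

lemma vector_space_mult: "vector_space ((*) :: complex \<Rightarrow> complex \<Rightarrow> complex)"
  by unfold_locales

lemma poly_fun_cmult: "poly_fun s p \<Longrightarrow> poly_fun s (\<lambda>x. c * p x)"
  using poly_fun.mult[OF poly_fun.const] by blast

lemma poly_fun_minus: "poly_fun s p \<Longrightarrow> poly_fun s (\<lambda>x. - p x)"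
  using poly_fun_cmult[of s p "-1"] by simp

lemma poly_fun_diff: "poly_fun s p \<Longrightarrow> poly_fun s q \<Longrightarrow> poly_fun s (\<lambda>x. p x - q x)"
  using poly_fun.add[OF _ poly_fun_minus, of s p q] by simp

lemma poly_fun_power: "poly_fun s p \<Longrightarrow> poly_fun s (\<lambda>x. p x ^ n)"
  by (induction n) (auto intro: poly_fun.intros)

lemma poly_fun_sum: "(\<And>i. i \<in> I \<Longrightarrow> poly_fun s (p i)) \<Longrightarrow> poly_fun s (\<lambda>x. \<Sum>i\<in>I. p i x)"
  by (induction I rule: infinite_finite_induct) (auto intro: poly_fun.intros)

lemmas poly_fun_intros = poly_fun.intros poly_fun_cmult poly_fun_minus poly_fun_diff
  poly_fun_power poly_fun_sum

text \<open>Restriction to lines is how facts on univariate polynomials, such as the finiteness of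
  roots and the fundamental theorem of algebra, reach the coordinate-free
  \<open>poly_fun\<close>.\<close>

lemma poly_fun_line:
  assumes "poly_fun s p"
  shows "\<exists>P. \<forall>t. p (x + s t y) = poly P t"
  using assms
proof induction
  case (const c)
  then show ?case by (intro exI[of _ "[:c:]"]) simp
next
  case (linear l)
  then interpret l: Vector_Spaces.linear s "(*)" l .
  show ?case
    by (intro exI[of _ "[:l x, l y:]"]) (simp add: l.add l.scale)
next
  case (add p q)
  then show ?case by (metis poly_add)
next
  case (mult p q)
  then show ?case by (metis poly_mult)
qed

lemma poly_fun_line_through:
  assumes "vector_space s" "poly_fun s p"
  shows "\<exists>P. \<forall>t. p (s (1 - t) x + s t y) = poly P t"
proof -
  interpret vector_space s by fact
  have "s (1 - t) x + s t y = x + s t (y - x)" for t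
    by (simp add: algebra_simps)
  then show ?thesis
    using poly_fun_line[OF assms(2), of x "y - x"] by simp
qed

text \<open>\<open>\<complex>\<close> is infinite, so the ring of polynomial functions is a domain.\<close>

lemma poly_fun_both_nonzero:
  assumes "vector_space s" "poly_fun s p" "poly_fun s q" "p x \<noteq> 0" "q y \<noteq> 0"
  shows "\<exists>z. p z \<noteq> 0 \<and> q z \<noteq> 0"
proof -
  interpret vector_space s by fact
  obtain P Q where P: "\<And>t. p (s (1 - t) x + s t y) = poly P t"
    and Q: "\<And>t. q (s (1 - t) x + s t y) = poly Q t"
    using poly_fun_line_through[OF assms(1)] assms(2,3) by metis
  have "P \<noteq> 0" "Q \<noteq> 0"
    using P[of 0] Q[of 1] assms(4,5) by auto
  then have "finite ({t. poly P t = 0} \<union> {t. poly Q t = 0})"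
    by (simp add: poly_roots_finite)
  from ex_new_if_finite[OF infinite_UNIV_char_0 this] obtain t where "poly P t \<noteq> 0" "poly Q t \<noteq> 0"
    by auto
  then show ?thesis
    using P Q by metis
qed

lemma generically_conj:
  assumes "vector_space s" "generically s P" "generically s Q"
  shows "generically s (\<lambda>x. P x \<and> Q x)"
proof -
  obtain p q x y where "poly_fun s p" "p x \<noteq> 0" "\<And>x. p x \<noteq> 0 \<Longrightarrow> P x"
    "poly_fun s q" "q y \<noteq> 0" "\<And>x. q x \<noteq> 0 \<Longrightarrow> Q x"
    using assms(2,3) unfolding generically_def by blast
  moreover from this obtain z where "p z \<noteq> 0" "q z \<noteq> 0"
    using poly_fun_both_nonzero[OF assms(1)] by blast
  ultimately show ?thesis
    unfolding generically_def by (intro exI[of _ "\<lambda>x. p x * q x"]) (auto intro: poly_fun.intros)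
qed

lemma generically_mono: "generically s P \<Longrightarrow> (\<And>x. P x \<Longrightarrow> Q x) \<Longrightarrow> generically s Q"
  unfolding generically_def by blast

lemma generically_ex: "generically s P \<Longrightarrow> \<exists>x. P x"
  unfolding generically_def by blast

lemma poly_fun_eq_if_generically_eq:
  assumes "vector_space s" "poly_fun s p" "poly_fun s q" "generically s (\<lambda>x. p x = q x)"
  shows "p x = q x"
proof (rule ccontr)
  assume "p x \<noteq> q x"
  then have "generically s (\<lambda>x. p x \<noteq> q x)"
    unfolding generically_def using poly_fun_diff[OF assms(2,3)]
    by (intro exI[of _ "\<lambda>x. p x - q x"]) auto
  from generically_ex[OF generically_conj[OF assms(1) assms(4) this]] show False
    by blast
qed

lemma poly_fun_cancel:
  assumes "vector_space s" "poly_fun s p" "poly_fun s q" "poly_fun s r" "p y \<noteq> 0"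
    and "\<And>x. p x * q x = p x * r x"
  shows "q x = r x"
  using assms(5,6)
  by (intro poly_fun_eq_if_generically_eq[OF assms(1,3,4)]) (auto simp: generically_def intro!: exI[of _ p] assms(2))

subsection \<open>Quadratic forms\<close>

text \<open>The Taylor expansion of order two at 0. The remainder is controlled only along lines
  through 0, where it is divisible by \<open>t ^ 3\<close>. This suffices to compare coefficients
  and is stable under products, so the expansion can be built along the rules of
  \<open>poly_fun\<close> without a basis. \<open>\<beta>\<close> need not be symmetric yet.\<close>

definition order_2_expansion where
  "order_2_expansion s p c l \<beta> r \<longleftrightarrow> Vector_Spaces.linear s (*) l \<and>
    (\<forall>x. Vector_Spaces.linear s (*) (\<beta> x)) \<and> (\<forall>y. Vector_Spaces.linear s (*) (\<lambda>x. \<beta> x y)) \<and>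
    (\<forall>x. \<exists>P. \<forall>t. r (s t x) = t ^ 3 * poly P t) \<and>
    (\<forall>x. p x = (c::complex) + l x + \<beta> x x + r x)"

lemma order_2_expansionD:
  assumes "order_2_expansion s p c l \<beta> r"
  shows "Vector_Spaces.linear s (*) l"
    "\<And>x. Vector_Spaces.linear s (*) (\<beta> x)" "\<And>y. Vector_Spaces.linear s (*) (\<lambda>x. \<beta> x y)"
    "\<And>x. \<exists>P. \<forall>t. r (s t x) = t ^ 3 * poly P t" "\<And>x. p x = c + l x + \<beta> x x + r x"
  using assms unfolding order_2_expansion_def by simp_all

lemma order_2_expansionI:
  assumes "Vector_Spaces.linear s (*) l"
    "\<And>x. Vector_Spaces.linear s (*) (\<beta> x)" "\<And>y. Vector_Spaces.linear s (*) (\<lambda>x. \<beta> x y)"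
    "\<And>x. \<exists>P. \<forall>t. r (s t x) = t ^ 3 * poly P t" "\<And>x. p x = c + l x + \<beta> x x + r x"
  shows "order_2_expansion s p c l \<beta> r"
  using assms unfolding order_2_expansion_def by simp

lemma poly_fun_order_2_expansion:
  assumes "vector_space s" "poly_fun s p"
  shows "\<exists>c l \<beta> r. order_2_expansion s p c l \<beta> r"
  using assms(2)
proof induction
  case (const c)
  have "order_2_expansion s (\<lambda>x. c) c (\<lambda>x. 0) (\<lambda>x y. 0) (\<lambda>x. 0)"
    using assms(1) vector_space_mult
    by (intro order_2_expansionI) (auto simp: Vector_Spaces.linear_iff intro: exI[of _ 0])
  then show ?case by blast
next
  case (linear l)
  have "order_2_expansion s l 0 l (\<lambda>x y. 0) (\<lambda>x. 0)"
    using linear by (intro order_2_expansionI) (auto simp: Vector_Spaces.linear_iff intro: exI[of _ 0])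
  then show ?case by blast
next
  case (add p q)
  from add.IH obtain c l \<beta> r c' l' \<beta>' r' where "order_2_expansion s p c l \<beta> r"
    "order_2_expansion s q c' l' \<beta>' r'" by blast
  note 1 = order_2_expansionD[OF this(1)] and 2 = order_2_expansionD[OF this(2)]
  have tail: "\<exists>P. \<forall>t. r (s t x) + r' (s t x) = t ^ 3 * poly P t" for x
  proof -
    obtain P Q where "\<forall>t. r (s t x) = t ^ 3 * poly P t" "\<forall>t. r' (s t x) = t ^ 3 * poly Q t"
      using 1(4)[of x] 2(4)[of x] by blast
    then show ?thesis
      by (intro exI[of _ "P + Q"]) (simp add: algebra_simps)
  qed
  have "order_2_expansion s (\<lambda>x. p x + q x) (c + c') (\<lambda>x. l x + l' x)
    (\<lambda>x y. \<beta> x y + \<beta>' x y) (\<lambda>x. r x + r' x)"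
  proof (rule order_2_expansionI)
    show "Vector_Spaces.linear s (*) (\<lambda>x. l x + l' x)"
      using 1(1) 2(1) by (simp add: Vector_Spaces.linear_iff distrib_left)
    show "Vector_Spaces.linear s (*) (\<lambda>y. \<beta> x y + \<beta>' x y)" for x
      using 1(2)[of x] 2(2)[of x] by (simp add: Vector_Spaces.linear_iff distrib_left)
    show "Vector_Spaces.linear s (*) (\<lambda>x. \<beta> x y + \<beta>' x y)" for y
      using 1(3)[of y] 2(3)[of y] by (simp add: Vector_Spaces.linear_iff distrib_left)
    show "\<exists>P. \<forall>t. r (s t x) + r' (s t x) = t ^ 3 * poly P t" for x by (rule tail)
    show "p x + q x = c + c' + (l x + l' x) + (\<beta> x x + \<beta>' x x) + (r x + r' x)" for x
      by (simp only: 1(5) 2(5) ac_simps)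
  qed
  then show ?case by blast
next
  case (mult p q)
  from mult.IH obtain c l \<beta> r c' l' \<beta>' r' where "order_2_expansion s p c l \<beta> r"
    "order_2_expansion s q c' l' \<beta>' r'" by blast
  note 1 = order_2_expansionD[OF this(1)] and 2 = order_2_expansionD[OF this(2)]
  \<comment> \<open>What the product has beyond order two; the identity for \<open>R y\<close> below
    sorts it into terms each of which is divisible by \<open>t ^ 3\<close> along lines.\<close>
  define R where "R x = p x * q x - (c * c' + (c * l' x + c' * l x) +
    (c * \<beta>' x x + l x * l' x + c' * \<beta> x x))" for x
  have tail: "\<exists>P. \<forall>t. R (s t x) = t ^ 3 * poly P t" for x
  proof -
    obtain P Q where *: "\<forall>t. r (s t x) = t ^ 3 * poly P t" "\<forall>t. r' (s t x) = t ^ 3 * poly Q t"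
      using 1(4)[of x] 2(4)[of x] by blast
    have **: "l (s t x) = t * l x" "l' (s t x) = t * l' x" "\<beta> (s t x) (s t x) = t\<^sup>2 * \<beta> x x"
      "\<beta>' (s t x) (s t x) = t\<^sup>2 * \<beta>' x x" for t
      using 1(1) 2(1) 1(2,3)[of x] 1(3)[of "s t x"] 2(2,3)[of x] 2(3)[of "s t x"]
      by (simp_all add: Vector_Spaces.linear_iff power2_eq_square)
    have R: "R y = l y * \<beta>' y y + \<beta> y y * l' y + \<beta> y y * \<beta>' y y
        + r y * (c' + l' y + \<beta>' y y + r' y) + (c + l y + \<beta> y y) * r' y" for y
      unfolding R_def 1(5) 2(5) by algebra
    have "R (s t x) = t ^ 3 * (l x * \<beta>' x x + \<beta> x x * l' x + t * (\<beta> x x * \<beta>' x x)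
        + poly P t * (c' + t * l' x + t\<^sup>2 * \<beta>' x x + t ^ 3 * poly Q t)
        + (c + t * l x + t\<^sup>2 * \<beta> x x) * poly Q t)" for t
      unfolding R ** *[rule_format] by algebra
    then have "R (s t x) = t ^ 3 * poly ([:l x * \<beta>' x x + \<beta> x x * l' x, \<beta> x x * \<beta>' x x:]
        + P * ([:c', l' x, \<beta>' x x:] + [:0, 0, 0, 1:] * Q) + [:c, l x, \<beta> x x:] * Q) t" for t
      by (simp add: power2_eq_square power3_eq_cube distrib_left distrib_right mult.assoc)
    then show ?thesis by blast
  qed
  have L1: "Vector_Spaces.linear s (*) (\<lambda>x. c * l' x + c' * l x)"
    using 1(1) 2(1) by (simp add: Vector_Spaces.linear_iff distrib_left mult.left_commute)
  have L2: "Vector_Spaces.linear s (*) (\<lambda>y. c * \<beta>' x y + l x * l' y + c' * \<beta> x y)" for x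
    using 1(2)[of x] 2(1) 2(2)[of x] by (simp add: Vector_Spaces.linear_iff algebra_simps)
  have L3: "Vector_Spaces.linear s (*) (\<lambda>x. c * \<beta>' x y + l x * l' y + c' * \<beta> x y)" for y
    using 1(1) 1(3)[of y] 2(3)[of y] by (simp add: Vector_Spaces.linear_iff algebra_simps)
  have sum: "p x * q x = c * c' + (c * l' x + c' * l x) +
      (c * \<beta>' x x + l x * l' x + c' * \<beta> x x) + R x" for x
    unfolding R_def by algebra
  have "order_2_expansion s (\<lambda>x. p x * q x) (c * c') (\<lambda>x. c * l' x + c' * l x)
    (\<lambda>x y. c * \<beta>' x y + l x * l' y + c' * \<beta> x y) R"
    by (rule order_2_expansionI[OF L1 L2 L3 tail sum])
  then show ?case by blast
qed

text \<open>By homogeneity \<open>p\<close> is a multiple of \<open>t\<^sup>2\<close> along each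
  line through 0, so only the quadratic term of the expansion survives; averaging over the two
  arguments makes it symmetric.\<close>

lemma form_2_bilinear:
  assumes "vector_space s" "form s 2 p"
  shows "\<exists>\<beta>. (\<forall>x. Vector_Spaces.linear s (*) (\<beta> x)) \<and> (\<forall>x y. \<beta> x y = \<beta> y x) \<and>
    (\<forall>x. p x = \<beta> x x)"
proof -
  interpret vector_space s by fact
  from poly_fun_order_2_expansion[OF assms(1)] assms(2) obtain c l \<beta> r
    where "order_2_expansion s p c l \<beta> r"
    unfolding form_def by blast
  note 1 = order_2_expansionD[OF this]
  have "p x = \<beta> x x" for x
  proof -
    obtain P where P: "\<And>t. r (s t x) = t ^ 3 * poly P t"
      using 1(4) by blast
    have "poly [:0, 0, p x:] t = poly ([:c, l x, \<beta> x x:] + [:0, 0, 0, 1:] * P) t" for t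
    proof -
      have "p (s t x) = t\<^sup>2 * p x"
        using assms(2) unfolding form_def by blast
      moreover have "l (s t x) = t * l x" "\<beta> (s t x) (s t x) = t\<^sup>2 * \<beta> x x"
        using 1(1) 1(2)[of x] 1(3)[of "s t x"] by (simp_all add: Vector_Spaces.linear_iff power2_eq_square)
      ultimately show ?thesis
        using 1(5)[of "s t x"] P[of t]
        by (simp add: algebra_simps power2_eq_square power3_eq_cube)
    qed
    then have "[:0, 0, p x:] = [:c, l x, \<beta> x x:] + [:0, 0, 0, 1:] * P"
      using poly_eq_poly_eq_iff by blast
    then have "coeff [:0, 0, p x:] 2 = coeff ([:c, l x, \<beta> x x:] + [:0, 0, 0, 1:] * P) 2"
      by simp
    then show ?thesis
      by (simp add: numeral_2_eq_2)
  qed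
  moreover have "Vector_Spaces.linear s (*) (\<lambda>y. (\<beta> x y + \<beta> y x) / 2)" for x
    using 1(2)[of x] 1(3)[of x]
    by (simp add: Vector_Spaces.linear_iff distrib_left add_divide_distrib)
  ultimately show ?thesis
    by (intro exI[of _ "\<lambda>x y. (\<beta> x y + \<beta> y x) / 2"] conjI allI) (simp_all add: add.commute)
qed

section \<open>Jordan algebras\<close>

text \<open>Independence of a list rather than of a set: repeated vectors count as dependent, and
  coefficients can be compared directly.\<close>

definition ind3 :: "(complex \<Rightarrow> 'a::ab_group_add \<Rightarrow> 'a) \<Rightarrow> 'a \<Rightarrow> 'a \<Rightarrow> 'a \<Rightarrow> bool" where
  "ind3 s u v w \<longleftrightarrow> (\<forall>a b c. s a u + s b v + s c w = 0 \<longrightarrow> a = 0 \<and> b = 0 \<and> c = 0)"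

definition ind4 :: "(complex \<Rightarrow> 'a::ab_group_add \<Rightarrow> 'a) \<Rightarrow> 'a \<Rightarrow> 'a \<Rightarrow> 'a \<Rightarrow> 'a \<Rightarrow> bool" where
  "ind4 s u v w x \<longleftrightarrow> (\<forall>a b c d. s a u + s b v + s c w + s d x = 0 \<longrightarrow>
     a = 0 \<and> b = 0 \<and> c = 0 \<and> d = 0)"

section \<open>Independence, bases and coordinates in dimension four\<close>

locale complex_vector_space = vector_space scale
  for scale :: "complex \<Rightarrow> 'a::ab_group_add \<Rightarrow> 'a"
begin

lemma ind4_ind3: "ind4 scale u v w x \<Longrightarrow> ind3 scale u v w"
  unfolding ind3_def ind4_def
proof (intro allI impI)
  fix a b c
  assume *: "\<forall>a b c d. scale a u + scale b v + scale c w + scale d x = 0 \<longrightarrow> a = 0 \<and> b = 0 \<and> c = 0 \<and> d = 0"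
    and "scale a u + scale b v + scale c w = 0"
  then show "a = 0 \<and> b = 0 \<and> c = 0"
    using *[rule_format, of a b c 0] by simp
qed

lemma ind3_ex_ind4:
  assumes "ind3 scale u v w" "y \<notin> span {u, v, w}"
  shows "ind4 scale u v w y"
  unfolding ind4_def
proof (intro allI impI)
  fix a b c d
  assume eq: "scale a u + scale b v + scale c w + scale d y = 0"
  have "d = 0"
  proof (rule ccontr)
    assume "d \<noteq> 0"
    have "scale d y = - (scale a u + scale b v + scale c w)"
      using eq by (metis add.commute eq_neg_iff_add_eq_0)
    then have "scale (inverse d) (scale d y) = scale (inverse d) (- (scale a u + scale b v + scale c w))"
      by simp
    then have "y = scale (inverse d) (- (scale a u + scale b v + scale c w))"
      using \<open>d \<noteq> 0\<close> by simp
    moreover have "scale (inverse d) (- (scale a u + scale b v + scale c w)) \<in> span {u, v, w}"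
      by (intro span_scale span_neg span_add) (auto intro: span_base)
    ultimately show False using assms(2) by simp
  qed
  moreover from this eq assms(1) have "a = 0 \<and> b = 0 \<and> c = 0"
    unfolding ind3_def by simp
  ultimately show "a = 0 \<and> b = 0 \<and> c = 0 \<and> d = 0" by simp
qed

lemma ind4_independent:
  assumes "ind4 scale u v w x"
  shows "independent {u, v, w, x}" "card {u, v, w, x} = 4"
proof -
  have ne: "u \<noteq> v" "u \<noteq> w" "u \<noteq> x" "v \<noteq> w" "v \<noteq> x" "w \<noteq> x"
    using assms[unfolded ind4_def, rule_format, of 1 "-1" 0 0]
      assms[unfolded ind4_def, rule_format, of 1 0 "-1" 0]
      assms[unfolded ind4_def, rule_format, of 1 0 0 "-1"]
      assms[unfolded ind4_def, rule_format, of 0 1 "-1" 0]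
      assms[unfolded ind4_def, rule_format, of 0 1 0 "-1"]
      assms[unfolded ind4_def, rule_format, of 0 0 1 "-1"]
    by auto
  then show "card {u, v, w, x} = 4" by simp
  show "independent {u, v, w, x}"
    unfolding dependent_finite[OF finite.intros(2)[OF finite.intros(2)[OF finite.intros(2)[OF
      finite.intros(2)[OF finite.emptyI]]]]]
    using ne assms by (auto simp: ind4_def add.assoc)
qed

end

locale fin4 = complex_vector_space scale for scale :: "complex \<Rightarrow> 'a::ab_group_add \<Rightarrow> 'a" +
  fixes Bas
  assumes fd: "finite_dimensional_vector_space scale Bas"
    and dim4: "vector_space.dim scale UNIV = 4"
begin

sublocale finite_dimensional_vector_space scale Bas by (rule fd)

lemma ind4_spans:
  assumes "ind4 scale u v w x"
  shows "\<exists>a b c d. y = scale a u + scale b v + scale c w + scale d x"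
proof -
  have "UNIV \<subseteq> span {u, v, w, x}"
    using ind4_independent[OF assms] dim4 by (intro card_ge_dim_independent) auto
  then have "y \<in> span {u, v, w, x}" by auto
  then show ?thesis
    unfolding span_insert span_empty
    by (auto simp: eq_diff_eq algebra_simps)
qed

lemma ind3_extend:
  assumes "ind3 scale u v w"
  shows "\<exists>y. ind4 scale u v w y"
proof -
  have "span {u, v, w} \<noteq> UNIV"
  proof
    assume "span {u, v, w} = UNIV"
    then have "dim UNIV \<le> card {u, v, w}"
      by (intro dim_le_card) auto
    also have "\<dots> \<le> 3"
      by (simp add: card_insert_if)
    finally show False using dim4 by simp
  qed
  then show ?thesis
    using ind3_ex_ind4[OF assms] by blast
qed

lemma ind4_coordinates:
  assumes "ind4 scale u v w x"
  shows "\<exists>k l m n. Vector_Spaces.linear scale (*) k \<and> Vector_Spaces.linear scale (*) l \<and>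
    Vector_Spaces.linear scale (*) m \<and> Vector_Spaces.linear scale (*) n \<and>
    (\<forall>y. y = scale (k y) u + scale (l y) v + scale (m y) w + scale (n y) x) \<and>
    (\<forall>a b c d y. y = scale a u + scale b v + scale c w + scale d x \<longrightarrow>
       k y = a \<and> l y = b \<and> m y = c \<and> n y = d)"
proof -
  obtain k l m n where e: "\<And>y. y = scale (k y) u + scale (l y) v + scale (m y) w + scale (n y) x"
    using ind4_spans[OF assms] by metis
  have uniq: "k y = a \<and> l y = b \<and> m y = c \<and> n y = d"
    if "y = scale a u + scale b v + scale c w + scale d x" for a b c d y
  proof -
    have "scale (k y - a) u + scale (l y - b) v + scale (m y - c) w + scale (n y - d) x
      = (scale (k y) u + scale (l y) v + scale (m y) w + scale (n y) x)
       - (scale a u + scale b v + scale c w + scale d x)"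
      by (simp add: algebra_simps)
    also have "\<dots> = 0"
      using that e[of y] by simp
    finally show ?thesis
      using assms unfolding ind4_def by (metis eq_iff_diff_eq_0)
  qed
  have add: "k (y + z) = k y + k z \<and> l (y + z) = l y + l z \<and> m (y + z) = m y + m z \<and> n (y + z) = n y + n z" for y z
  proof (rule uniq)
    have "y + z = (scale (k y) u + scale (l y) v + scale (m y) w + scale (n y) x)
      + (scale (k z) u + scale (l z) v + scale (m z) w + scale (n z) x)"
      using e[of y] e[of z] by simp
    then show "y + z = scale (k y + k z) u + scale (l y + l z) v + scale (m y + m z) w + scale (n y + n z) x"
      by (simp add: algebra_simps)
  qed
  have mul: "k (scale t y) = t * k y \<and> l (scale t y) = t * l y \<and> m (scale t y) = t * m y \<and> n (scale t y) = t * n y" for y t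
  proof (rule uniq)
    have "scale t y = scale t (scale (k y) u + scale (l y) v + scale (m y) w + scale (n y) x)"
      using e[of y] by simp
    then show "scale t y = scale (t * k y) u + scale (t * l y) v + scale (t * m y) w + scale (t * n y) x"
      by (simp add: algebra_simps)
  qed
  show ?thesis
    using e uniq add mul vector_space_axioms vector_space_mult
    by (intro exI[of _ k] exI[of _ l] exI[of _ m] exI[of _ n]) (auto simp: Vector_Spaces.linear_iff)
qed

end

lemma ind4_linear_bij:
  assumes "fin4 s B" "fin4 s' B'" "ind4 s b1 b2 b3 b4" "ind4 s' c1 c2 c3 c4"
  shows "\<exists>f. Vector_Spaces.linear s s' f \<and> bij f \<and> f b1 = c1 \<and> f b2 = c2 \<and> f b3 = c3 \<and> f b4 = c4"
proof -
  interpret V: fin4 s B by fact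
  interpret W: fin4 s' B' by fact
  from V.ind4_coordinates[OF assms(3)] obtain k l m n where V:
    "Vector_Spaces.linear s (*) k" "Vector_Spaces.linear s (*) l"
    "Vector_Spaces.linear s (*) m" "Vector_Spaces.linear s (*) n"
    "\<And>y. y = s (k y) b1 + s (l y) b2 + s (m y) b3 + s (n y) b4"
    "\<And>a b c d y. y = s a b1 + s b b2 + s c b3 + s d b4 \<Longrightarrow> k y = a \<and> l y = b \<and> m y = c \<and> n y = d"
    by metis
  from W.ind4_coordinates[OF assms(4)] obtain k' l' m' n' where W:
    "\<And>y. y = s' (k' y) c1 + s' (l' y) c2 + s' (m' y) c3 + s' (n' y) c4"
    "\<And>a b c d y. y = s' a c1 + s' b c2 + s' c c3 + s' d c4 \<Longrightarrow> k' y = a \<and> l' y = b \<and> m' y = c \<and> n' y = d"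
    by metis
  define f where "f y = s' (k y) c1 + s' (l y) c2 + s' (m y) c3 + s' (n y) c4" for y
  define g where "g y = s (k' y) b1 + s (l' y) b2 + s (m' y) b3 + s (n' y) b4" for y
  have "g (f y) = y" for y
  proof -
    have "k' (f y) = k y \<and> l' (f y) = l y \<and> m' (f y) = m y \<and> n' (f y) = n y"
      by (rule W(2)) (simp add: f_def)
    then show ?thesis using V(5)[of y] unfolding g_def by simp
  qed
  moreover have "f (g y) = y" for y
  proof -
    have "k (g y) = k' y \<and> l (g y) = l' y \<and> m (g y) = m' y \<and> n (g y) = n' y"
      by (rule V(6)) (simp add: g_def)
    then show ?thesis using W(1)[of y] unfolding f_def by simp
  qed
  ultimately have "bij f"
    by (metis bijI')
  moreover have "Vector_Spaces.linear s s' f"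
    using V(1-4) V.vector_space_axioms W.vector_space_axioms
    by (simp add: f_def Vector_Spaces.linear_iff W.scale_right_distrib W.scale_left_distrib ac_simps)
  moreover have "k b1 = 1 \<and> l b1 = 0 \<and> m b1 = 0 \<and> n b1 = 0" by (rule V(6)) simp
  moreover have "k b2 = 0 \<and> l b2 = 1 \<and> m b2 = 0 \<and> n b2 = 0" by (rule V(6)) simp
  moreover have "k b3 = 0 \<and> l b3 = 0 \<and> m b3 = 1 \<and> n b3 = 0" by (rule V(6)) simp
  moreover have "k b4 = 0 \<and> l b4 = 0 \<and> m b4 = 0 \<and> n b4 = 1" by (rule V(6)) simp
  ultimately show ?thesis
    by (intro exI[of _ f]) (simp add: f_def)
qed

section \<open>The linearised Jordan identity\<close>

locale jordan =
  fixes A :: "'a::ab_group_add calg"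
  assumes jordan: "jordan_algebra A"
begin

abbreviation sc (infixr "\<star>" 75) where "sc \<equiv> scl A"
abbreviation mu (infixl "\<odot>" 70) where "mu \<equiv> prd A"
abbreviation one ("e") where "e \<equiv> unt A"

sublocale complex_vector_space "scl A"
  using jordan unfolding jordan_algebra_def finite_dimensional_vector_space_def complex_vector_space_def
  by blast

lemma linear_right: "Vector_Spaces.linear sc sc (\<lambda>y. x \<odot> y)"
  using jordan unfolding jordan_algebra_def by blast

lemma comm: "x \<odot> y = y \<odot> x"
  using jordan unfolding jordan_algebra_def by blast

lemma one_left [simp]: "e \<odot> x = x"
  using jordan unfolding jordan_algebra_def by blast

lemma one_right [simp]: "x \<odot> e = x"
  using comm[of x e] by simp

lemma jordan_identity: "(x \<odot> x) \<odot> (x \<odot> y) = x \<odot> ((x \<odot> x) \<odot> y)"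
  using jordan unfolding jordan_algebra_def by blast

lemma add_right: "x \<odot> (y + z) = x \<odot> y + x \<odot> z"
  and scale_right: "x \<odot> (c \<star> y) = c \<star> (x \<odot> y)"
  using linear_right[of x] by (simp_all add: Vector_Spaces.linear_iff)

lemma add_left: "(y + z) \<odot> x = y \<odot> x + z \<odot> x"
  and scale_left: "(c \<star> y) \<odot> x = c \<star> (y \<odot> x)"
  using comm add_right scale_right by metis+

lemma zero_right [simp]: "x \<odot> 0 = 0" and zero_left [simp]: "0 \<odot> x = 0"
  using scale_right[of x 0 0] scale_left[of 0 0 x] by simp_all

lemma minus_right: "x \<odot> (- y) = - (x \<odot> y)" and minus_left: "(- y) \<odot> x = - (y \<odot> x)"
  using scale_right[of x "-1" y] scale_left[of "-1" y x] by simp_all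

lemma diff_right: "x \<odot> (y - z) = x \<odot> y - x \<odot> z" and diff_left: "(y - z) \<odot> x = y \<odot> x - z \<odot> x"
  using add_right[of x y "-z"] add_left[of y "-z" x] by (simp_all add: minus_right minus_left)

lemmas mul_simps = add_right add_left scale_right scale_left minus_right minus_left diff_right diff_left

text \<open>The part of degree 1 in \<open>z\<close> of the Jordan identity for \<open>x + z\<close>.\<close>

lemma jordan_linear:
  "2 \<star> ((x \<odot> z) \<odot> (x \<odot> y)) + (x \<odot> x) \<odot> (z \<odot> y) = 2 \<star> (x \<odot> ((x \<odot> z) \<odot> y)) + z \<odot> ((x \<odot> x) \<odot> y)"
proof -
  define a where "a = 2 \<star> ((x \<odot> z) \<odot> (x \<odot> y)) + (x \<odot> x) \<odot> (z \<odot> y)"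
  define b where "b = 2 \<star> (x \<odot> ((x \<odot> z) \<odot> y)) + z \<odot> ((x \<odot> x) \<odot> y)"
  define c where "c = 2 \<star> ((x \<odot> z) \<odot> (z \<odot> y)) + (z \<odot> z) \<odot> (x \<odot> y)"
  define d where "d = 2 \<star> (z \<odot> ((x \<odot> z) \<odot> y)) + x \<odot> ((z \<odot> z) \<odot> y)"
  have two: "2 \<star> u = u + u" for u
    using scale_left_distrib[of 1 1 u] by simp
  \<comment> \<open>Sorted by degree in \<open>z\<close>, the parts of degree 1 are \<open>a\<close>
    and \<open>b\<close>, those of degree 2 are \<open>c\<close> and \<open>d\<close>, and those of
    degrees 0 and 3 are instances of the identity itself. Replacing \<open>z\<close> by
    \<open>- z\<close> changes the sign of the odd parts, so the difference isolates
    \<open>a\<close> and \<open>b\<close>.\<close>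
  have 1: "((x + z) \<odot> (x + z)) \<odot> ((x + z) \<odot> y) =
      (x \<odot> x) \<odot> (x \<odot> y) + a + c + (z \<odot> z) \<odot> (z \<odot> y)"
    unfolding a_def c_def two using comm[of z x] by (simp add: mul_simps algebra_simps)
  have 2: "(x + z) \<odot> (((x + z) \<odot> (x + z)) \<odot> y) =
      x \<odot> ((x \<odot> x) \<odot> y) + b + d + z \<odot> ((z \<odot> z) \<odot> y)"
    unfolding b_def d_def two using comm[of z x] by (simp add: mul_simps algebra_simps)
  have 3: "((x - z) \<odot> (x - z)) \<odot> ((x - z) \<odot> y) =
      (x \<odot> x) \<odot> (x \<odot> y) - a + c - (z \<odot> z) \<odot> (z \<odot> y)"
    unfolding a_def c_def two using comm[of z x] by (simp add: mul_simps algebra_simps)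
  have 4: "(x - z) \<odot> (((x - z) \<odot> (x - z)) \<odot> y) =
      x \<odot> ((x \<odot> x) \<odot> y) - b + d - z \<odot> ((z \<odot> z) \<odot> y)"
    unfolding b_def d_def two using comm[of z x] by (simp add: mul_simps algebra_simps)
  have "a + c = b + d"
    using jordan_identity[of "x + z" y] jordan_identity[of x y] jordan_identity[of z y]
    unfolding 1 2 by (simp add: algebra_simps)
  moreover have "c - a = d - b"
    using jordan_identity[of "x - z" y] jordan_identity[of x y] jordan_identity[of z y]
    unfolding 3 4 by (simp add: algebra_simps)
  ultimately have "a + a = b + b"
    by (metis add_diff_cancel_left' add_diff_eq diff_add_cancel diff_diff_eq2)
  then have "2 \<star> a = 2 \<star> b" by (simp add: two)
  then show ?thesis unfolding a_def[symmetric] b_def[symmetric] by simp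
qed

lemma square_square: "(x \<odot> x) \<odot> (x \<odot> x) = x \<odot> (x \<odot> (x \<odot> x))"
  using jordan_identity[of x x] comm by simp

text \<open>The subalgebra generated by \<open>x\<close> has dimension at least three; in rank 3
  these are the general elements, whose cubic equation is minimal.\<close>

definition cyclic where "cyclic x \<longleftrightarrow> ind3 sc e x (x \<odot> x)"

end

section \<open>General elements, rank and adjoint in dimension four\<close>

locale jordan4 = jordan +
  assumes alg_dim4: "alg_dim A = 4"
begin

lemma ex_basis: "\<exists>B. fin4 sc B"
proof -
  obtain B where "finite_dimensional_vector_space sc B"
    using jordan unfolding jordan_algebra_def by blast
  then show ?thesis
    using alg_dim4 complex_vector_space_axioms unfolding alg_dim_def fin4_def fin4_axioms_def by blast
qed

sublocale fin4 sc "SOME B. fin4 sc B"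
  using someI_ex[OF ex_basis] .

definition poly_map where
  "poly_map u \<longleftrightarrow> (\<forall>l. Vector_Spaces.linear sc (*) l \<longrightarrow> poly_fun sc (\<lambda>x. l (u x)))"

lemma poly_map_id: "poly_map (\<lambda>x. x)"
  unfolding poly_map_def by (auto intro: poly_fun.linear)

lemma poly_map_const: "poly_map (\<lambda>x. c)"
  unfolding poly_map_def by (auto intro: poly_fun.const)

lemma poly_map_mult:
  assumes "poly_map u" "poly_map w" "ind4 sc b1 b2 b3 b4"
  shows "poly_map (\<lambda>x. u x \<odot> w x)"
  unfolding poly_map_def
proof (intro allI impI)
  fix \<phi> assume \<phi>: "Vector_Spaces.linear sc (*) \<phi>"
  then interpret \<phi>: Vector_Spaces.linear sc "(*)" \<phi> .
  from ind4_coordinates[OF assms(3)] obtain k l m n where V: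
    "Vector_Spaces.linear sc (*) k" "Vector_Spaces.linear sc (*) l"
    "Vector_Spaces.linear sc (*) m" "Vector_Spaces.linear sc (*) n"
    "\<And>y. y = k y \<star> b1 + l y \<star> b2 + m y \<star> b3 + n y \<star> b4"
    by metis
  have 1: "\<phi> (u x \<odot> y) = k (u x) * \<phi> (b1 \<odot> y) + l (u x) * \<phi> (b2 \<odot> y)
      + m (u x) * \<phi> (b3 \<odot> y) + n (u x) * \<phi> (b4 \<odot> y)" for x y
    by (subst V(5)[of "u x"]) (simp add: mul_simps \<phi>.add \<phi>.scale)
  have 2: "\<phi> (b \<odot> w x) = k (w x) * \<phi> (b \<odot> b1) + l (w x) * \<phi> (b \<odot> b2)
      + m (w x) * \<phi> (b \<odot> b3) + n (w x) * \<phi> (b \<odot> b4)" for b x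
    by (subst V(5)[of "w x"]) (simp add: mul_simps \<phi>.add \<phi>.scale)
  have "poly_fun sc (\<lambda>x. f (u x))" "poly_fun sc (\<lambda>x. f (w x))" if "f \<in> {k, l, m, n}" for f
    using that V(1-4) assms(1,2) unfolding poly_map_def by blast+
  then show "poly_fun sc (\<lambda>x. \<phi> (u x \<odot> w x))"
    unfolding 1 2 by (intro poly_fun.add poly_fun.mult poly_fun.const) simp_all
qed

text \<open>\<open>p\<close> is the determinant of the three vectors in coordinates modulo
  \<open>e\<close>. It is 1 at \<open>y\<close>, and where it does not vanish Cramer's rule gives
  independence; so independence at one point spreads to a Zariski-open set.\<close>

lemma ind4_generically:
  assumes "ind4 sc e (u y) (v y) (w y)" "poly_map u" "poly_map v" "poly_map w"
  shows "generically sc (\<lambda>x. ind4 sc e (u x) (v x) (w x))"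
proof -
  from ind4_coordinates[OF assms(1)] obtain k l m n where V:
    "Vector_Spaces.linear sc (*) k" "Vector_Spaces.linear sc (*) l"
    "Vector_Spaces.linear sc (*) m" "Vector_Spaces.linear sc (*) n"
    "\<And>a b c d z. z = a \<star> e + b \<star> u y + c \<star> v y + d \<star> w y \<Longrightarrow> k z = a \<and> l z = b \<and> m z = c \<and> n z = d"
    by metis
  interpret l: Vector_Spaces.linear sc "(*)" l by fact
  interpret m: Vector_Spaces.linear sc "(*)" m by fact
  interpret n: Vector_Spaces.linear sc "(*)" n by fact
  have e: "k e = 1 \<and> l e = 0 \<and> m e = 0 \<and> n e = 0" by (rule V(5)) simp
  have 1: "k (u y) = 0 \<and> l (u y) = 1 \<and> m (u y) = 0 \<and> n (u y) = 0" by (rule V(5)) simp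
  have 2: "k (v y) = 0 \<and> l (v y) = 0 \<and> m (v y) = 1 \<and> n (v y) = 0" by (rule V(5)) simp
  have 3: "k (w y) = 0 \<and> l (w y) = 0 \<and> m (w y) = 0 \<and> n (w y) = 1" by (rule V(5)) simp
  define p where "p x = l (u x) * (m (v x) * n (w x) - n (v x) * m (w x))
    - m (u x) * (l (v x) * n (w x) - n (v x) * l (w x))
    + n (u x) * (l (v x) * m (w x) - m (v x) * l (w x))" for x
  have "poly_fun sc (\<lambda>x. f (h x))" if "f \<in> {l, m, n}" "h \<in> {u, v, w}" for f h
    using that V(1-4) assms(2-4) unfolding poly_map_def by blast
  then have "poly_fun sc p"
    unfolding p_def by (intro poly_fun.add poly_fun.mult poly_fun_diff) simp_all
  moreover have "p y = 1"
    unfolding p_def using 1 2 3 by simp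
  moreover have "ind4 sc e (u x) (v x) (w x)" if "p x \<noteq> 0" for x
    unfolding ind4_def
  proof (intro allI impI)
    fix a b c d
    assume eq: "a \<star> e + b \<star> u x + c \<star> v x + d \<star> w x = 0"
    have l: "b * l (u x) + c * l (v x) + d * l (w x) = 0"
      using arg_cong[OF eq, of l] e by (simp add: l.add l.scale l.zero)
    have m: "b * m (u x) + c * m (v x) + d * m (w x) = 0"
      using arg_cong[OF eq, of m] e by (simp add: m.add m.scale m.zero)
    have n: "b * n (u x) + c * n (v x) + d * n (w x) = 0"
      using arg_cong[OF eq, of n] e by (simp add: n.add n.scale n.zero)
    have "b * p x = 0" "c * p x = 0" "d * p x = 0"
      unfolding p_def using l m n by algebra+
    then have bcd: "b = 0" "c = 0" "d = 0" using that by simp_all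
    moreover have "a = 0"
    proof (rule ccontr)
      assume "a \<noteq> 0"
      then have "e = 0" using eq bcd by simp
      then show False using e l.zero V(1) by (metis Vector_Spaces.linear_iff mult_zero_left scale_zero_left zero_neq_one)
    qed
    ultimately show "a = 0 \<and> b = 0 \<and> c = 0 \<and> d = 0" by simp
  qed
  ultimately show ?thesis
    unfolding generically_def by (intro exI[of _ p]) (auto intro: exI[of _ y])
qed

lemma cyclic_generically:
  assumes "cyclic y"
  shows "generically sc cyclic"
proof -
  obtain w where w: "ind4 sc e y (y \<odot> y) w"
    using assms ind3_extend unfolding cyclic_def by blast
  have "generically sc (\<lambda>x. ind4 sc e x (x \<odot> x) w)"
    using w by (intro ind4_generically[where y = y and u = "\<lambda>x. x"] poly_map_id poly_map_const poly_map_mult[OF _ _ w])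
  then show ?thesis
    by (rule generically_mono) (auto simp: cyclic_def intro: ind4_ind3)
qed

lemma subset_generated:
  shows "e \<in> generated_subalgebra A {e, x}" "x \<in> generated_subalgebra A {e, x}"
    "y \<in> generated_subalgebra A {e, x} \<Longrightarrow> z \<in> generated_subalgebra A {e, x} \<Longrightarrow>
       y \<odot> z \<in> generated_subalgebra A {e, x}"
  unfolding generated_subalgebra_def by auto

lemma generated_subset:
  assumes "module.subspace sc V" "{e, x} \<subseteq> V" "\<And>y z. y \<in> V \<Longrightarrow> z \<in> V \<Longrightarrow> y \<odot> z \<in> V"
  shows "generated_subalgebra A {e, x} \<subseteq> V"
  unfolding generated_subalgebra_def using assms by blast

lemma closed_span3:
  assumes "a \<odot> a \<in> span {a, b, c}" "a \<odot> b \<in> span {a, b, c}" "a \<odot> c \<in> span {a, b, c}"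
    "b \<odot> b \<in> span {a, b, c}" "b \<odot> c \<in> span {a, b, c}" "c \<odot> c \<in> span {a, b, c}"
    and "y \<in> span {a, b, c}" "z \<in> span {a, b, c}"
  shows "y \<odot> z \<in> span {a, b, c}"
proof -
  have exp: "\<exists>p q r. w = p \<star> a + q \<star> b + r \<star> c" if "w \<in> span {a, b, c}" for w
    using that unfolding span_insert span_empty by (auto simp: eq_diff_eq algebra_simps)
  obtain p q r where y: "y = p \<star> a + q \<star> b + r \<star> c" using exp assms(7) by blast
  obtain p' q' r' where z: "z = p' \<star> a + q' \<star> b + r' \<star> c" using exp assms(8) by blast
  show ?thesis
    unfolding y z mul_simps using assms(1-6) comm[of b a] comm[of c a] comm[of c b]
    by (intro span_add span_scale) simp_all
qed

lemma not_cyclic_dim_generated: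
  assumes "\<not> cyclic x"
  shows "dim (generated_subalgebra A {e, x}) \<le> 2"
proof -
  have sq: "x \<odot> x \<in> span {e, x}"
  proof -
    obtain a b c where eq: "a \<star> e + b \<star> x + c \<star> (x \<odot> x) = 0" and ne: "a \<noteq> 0 \<or> b \<noteq> 0 \<or> c \<noteq> 0"
      using assms unfolding cyclic_def ind3_def by blast
    have ins: "p \<star> e + q \<star> x \<in> span {e, x}" for p q
      by (intro span_add span_scale) (simp_all add: span_base)
    consider "c \<noteq> 0" | "c = 0" "b \<noteq> 0" | "c = 0" "b = 0" "a \<noteq> 0" using ne by blast
    then show ?thesis
    proof cases
      case 1
      have "c \<star> (x \<odot> x) = (- a) \<star> e + (- b) \<star> x"
        using eq by (simp add: algebra_simps eq_neg_iff_add_eq_0)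
      then have "inverse c \<star> (c \<star> (x \<odot> x)) \<in> span {e, x}"
        using ins by (metis span_scale)
      then show ?thesis using 1 by simp
    next
      case 2
      have "b \<star> x = (- a) \<star> e"
        using eq 2 by (simp add: algebra_simps eq_neg_iff_add_eq_0)
      then have "inverse b \<star> (b \<star> x) = inverse b \<star> ((- a) \<star> e)" by simp
      then have "x = (inverse b * - a) \<star> e" using 2 by simp
      then have "x \<odot> x = (inverse b * - a) \<star> x" by (metis one_left scale_left)
      then show ?thesis using ins[of 0 "inverse b * - a"] by simp
    next
      case 3
      then have "e = 0" using eq by simp
      then have "x \<odot> x = 0" using one_left zero_left by metis
      then show ?thesis using span_zero by simp
    qed
  qed
  \<comment> \<open>\<open>e\<close> is listed twice to fit the closure lemma for three
    generators.\<close>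
  have "generated_subalgebra A {e, x} \<subseteq> span {e, e, x}"
  proof (rule generated_subset)
    show "{e, x} \<subseteq> span {e, e, x}" using span_superset[of "{e, e, x}"] by simp
    show "y \<odot> z \<in> span {e, e, x}" if "y \<in> span {e, e, x}" "z \<in> span {e, e, x}" for y z
      by (rule closed_span3[of e e x]) (use that sq in \<open>simp_all add: span_base\<close>)
  qed simp
  then have "dim (generated_subalgebra A {e, x}) \<le> card {e, x}"
    by (intro dim_le_card) auto
  also have "\<dots> \<le> 2" by (simp add: card_insert_if)
  finally show ?thesis .
qed

text \<open>The cubic relation closes the span of \<open>e\<close>, \<open>x\<close> and
  \<open>x \<odot> x\<close> under multiplication; the square of \<open>x \<odot> x\<close> is
  covered by power associativity, \<open>square_square\<close>.\<close>

lemma dim_generated_cyclic: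
  assumes "cyclic x" "x \<odot> (x \<odot> x) = a \<star> (x \<odot> x) + b \<star> x + c \<star> e"
  shows "dim (generated_subalgebra A {e, x}) = 3"
proof -
  have mem: "x \<odot> (x \<odot> x) \<in> span {e, x, x \<odot> x}"
    unfolding assms(2) by (intro span_add span_scale) (simp_all add: span_base)
  have "(x \<odot> x) \<odot> (x \<odot> x) = a \<star> (x \<odot> (x \<odot> x)) + b \<star> (x \<odot> x) + c \<star> x"
    unfolding square_square by (subst assms(2)) (simp add: mul_simps)
  then have mem2: "(x \<odot> x) \<odot> (x \<odot> x) \<in> span {e, x, x \<odot> x}"
    by (auto intro!: span_add span_scale mem simp: span_base)
  have "generated_subalgebra A {e, x} = span {e, x, x \<odot> x}"
  proof
    show "generated_subalgebra A {e, x} \<subseteq> span {e, x, x \<odot> x}"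
    proof (rule generated_subset)
      show "{e, x} \<subseteq> span {e, x, x \<odot> x}" using span_superset[of "{e, x, x \<odot> x}"] by simp
      show "y \<odot> z \<in> span {e, x, x \<odot> x}" if "y \<in> span {e, x, x \<odot> x}" "z \<in> span {e, x, x \<odot> x}" for y z
        by (rule closed_span3[of e x "x \<odot> x"]) (use that mem mem2 in \<open>simp_all add: span_base\<close>)
    qed simp
    have "subspace (generated_subalgebra A {e, x})"
      unfolding generated_subalgebra_def by (intro subspace_Inter) auto
    then show "span {e, x, x \<odot> x} \<subseteq> generated_subalgebra A {e, x}"
      using subset_generated by (intro span_minimal) auto
  qed
  moreover obtain w where w: "ind4 sc e x (x \<odot> x) w"
    using assms(1) ind3_extend unfolding cyclic_def by blast
  have "independent {e, x, x \<odot> x}"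
    using ind4_independent(1)[OF w] by (rule independent_mono) auto
  moreover have "card {e, x, x \<odot> x} = 3"
    using ind4_independent(2)[OF w] by (auto simp: card_insert_if split: if_splits)
  ultimately show ?thesis
    by (simp add: dim_eq_card_independent)
qed

lemma rank3I:
  assumes "cyclic y" "\<And>x. \<exists>a b c. x \<odot> (x \<odot> x) = a \<star> (x \<odot> x) + b \<star> x + c \<star> e"
  shows "has_rank A 3"
  unfolding has_rank_def
  using cyclic_generically[OF assms(1)] assms(2) dim_generated_cyclic
  by (auto elim!: generically_mono) metis

lemma rank3_cyclic_generically:
  assumes "has_rank A 3"
  shows "generically sc cyclic"
  using assms unfolding has_rank_def
  by (rule generically_mono) (use not_cyclic_dim_generated in force)

text \<open>Rank speaks of general elements only, yet this holds for every \<open>y\<close>: four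
  independent powers at one point would spread to an open set, which meets the one where the
  generated subalgebra has dimension three.\<close>

lemma rank3_cubic:
  assumes "has_rank A 3"
  shows "\<not> ind4 sc e y (y \<odot> y) (y \<odot> (y \<odot> y))"
proof
  assume w: "ind4 sc e y (y \<odot> y) (y \<odot> (y \<odot> y))"
  have "generically sc (\<lambda>x. ind4 sc e x (x \<odot> x) (x \<odot> (x \<odot> x)))"
    using w by (intro ind4_generically[where y = y and u = "\<lambda>x. x"] poly_map_id poly_map_const poly_map_mult[OF _ _ w])
  from generically_ex[OF generically_conj[OF vector_space_axioms this assms[unfolded has_rank_def]]]
  obtain x where x: "ind4 sc e x (x \<odot> x) (x \<odot> (x \<odot> x))"
    and dim: "dim (generated_subalgebra A {e, x}) = 3" by blast
  have "card {e, x, x \<odot> x, x \<odot> (x \<odot> x)} \<le> dim (generated_subalgebra A {e, x})"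
    using ind4_independent(1)[OF x] subset_generated by (intro independent_card_le_dim) auto
  then show False
    using dim ind4_independent(2)[OF x] by simp
qed

text \<open>At a cyclic element the coefficients of the cubic equation are determined, and
  polynomial functions that agree generically agree everywhere.\<close>

lemma adjoint_unique:
  assumes "has_rank A 3" "is_adjoint A adj" "is_adjoint A adj'"
  shows "adj = adj'"
proof
  fix y
  obtain T S N where 1: "form sc 1 T" "form sc 2 S"
    "generically sc (\<lambda>x. x \<odot> (x \<odot> x) - T x \<star> (x \<odot> x) + S x \<star> x - N x \<star> e = 0)"
    "\<And>x. adj x = x \<odot> x - T x \<star> x + S x \<star> e"
    using assms(2) unfolding is_adjoint_def by blast
  obtain T' S' N' where 2: "form sc 1 T'" "form sc 2 S'"
    "generically sc (\<lambda>x. x \<odot> (x \<odot> x) - T' x \<star> (x \<odot> x) + S' x \<star> x - N' x \<star> e = 0)"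
    "\<And>x. adj' x = x \<odot> x - T' x \<star> x + S' x \<star> e"
    using assms(3) unfolding is_adjoint_def by blast
  have gen: "generically sc (\<lambda>x. T x = T' x \<and> S x = S' x)"
  proof (rule generically_mono[OF generically_conj[OF vector_space_axioms
        rank3_cyclic_generically[OF assms(1)] generically_conj[OF vector_space_axioms 1(3) 2(3)]]])
    fix x
    assume x: "cyclic x \<and> x \<odot> (x \<odot> x) - T x \<star> (x \<odot> x) + S x \<star> x - N x \<star> e = 0 \<and>
      x \<odot> (x \<odot> x) - T' x \<star> (x \<odot> x) + S' x \<star> x - N' x \<star> e = 0"
    have "(N' x - N x) \<star> e + (S x - S' x) \<star> x + (T' x - T x) \<star> (x \<odot> x)
      = (x \<odot> (x \<odot> x) - T x \<star> (x \<odot> x) + S x \<star> x - N x \<star> e)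
       - (x \<odot> (x \<odot> x) - T' x \<star> (x \<odot> x) + S' x \<star> x - N' x \<star> e)"
      by (simp add: algebra_simps)
    also have "\<dots> = 0" using x by simp
    finally show "T x = T' x \<and> S x = S' x"
      using x unfolding cyclic_def ind3_def by (metis eq_iff_diff_eq_0)
  qed
  have "T y = T' y"
    using 1(1) 2(1) gen unfolding form_def
    by (intro poly_fun_eq_if_generically_eq[OF vector_space_axioms]) (auto elim: generically_mono)
  moreover have "S y = S' y"
    using 1(2) 2(2) gen unfolding form_def
    by (intro poly_fun_eq_if_generically_eq[OF vector_space_axioms]) (auto elim: generically_mono)
  ultimately show "adj y = adj' y"
    unfolding 1(4) 2(4) by simp
qed

end

section \<open>The seven algebras\<close>

lemma fin4I:
  assumes "vector_space s" "ind4 s u v w x" "\<And>y. \<exists>a b c d. y = s a u + s b v + s c w + s d x"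
  shows "finite_dimensional_vector_space s {u, v, w, x}" "vector_space.dim s UNIV = 4"
proof -
  interpret complex_vector_space s using assms(1) by (simp add: complex_vector_space_def)
  have "y \<in> span {u, v, w, x}" for y
  proof -
    obtain a b c d where y: "y = s a u + s b v + s c w + s d x" using assms(3) by blast
    show ?thesis unfolding y by (intro span_add span_scale) (simp_all add: span_base)
  qed
  then have span: "span {u, v, w, x} = UNIV" by auto
  show "finite_dimensional_vector_space s {u, v, w, x}"
    using ind4_independent[OF assms(2)] span by unfold_locales auto
  show "dim UNIV = 4"
    using ind4_independent[OF assms(2)] span by (metis dim_eq_card dim_span)
qed

lemma jordan4I:
  assumes "vector_space (scl A)" "ind4 (scl A) u v w x"
    and "\<And>y. \<exists>a b c d. y = scl A a u + scl A b v + scl A c w + scl A d x"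
    and "\<And>x y z. prd A x (y + z) = prd A x y + prd A x z" "\<And>c x y. prd A x (scl A c y) = scl A c (prd A x y)"
    and "\<And>x y. prd A x y = prd A y x" "\<And>x. prd A (unt A) x = x"
    and "\<And>x y. prd A (prd A x x) (prd A x y) = prd A x (prd A (prd A x x) y)"
  shows "jordan4 A"
proof -
  have 1: "Vector_Spaces.linear (scl A) (scl A) (\<lambda>y. prd A x y)" for x
    using assms(1,4,5) by (simp add: Vector_Spaces.linear_iff)
  have "(\<lambda>x. prd A x y) = (\<lambda>x. prd A y x)" for y
    using assms(6) by blast
  then have 2: "Vector_Spaces.linear (scl A) (scl A) (\<lambda>x. prd A x y)" for y
    using 1 by simp
  show ?thesis
    using fin4I[OF assms(1-3)] 1 2 assms(6-8)
    by unfold_locales (auto simp: jordan_algebra_def alg_dim_def)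
qed

lemma prd_J4_1: "prd J4_1 (m, l, w) (m', l', w') =
    (m * m', l * l' - (w $ 1 * w' $ 1 + w $ 2 * w' $ 2), l *s w' + l' *s w)"
  and prd_J4_2: "prd J4_2 (m, l, w) (m', l', w') = (m * m', l * l' - w $ 1 * w' $ 1, l *s w' + l' *s w)"
  and prd_J4_3: "prd J4_3 (m, l, w) (m', l', w') = (m * m', l * l', l *s w' + l' *s w)"
  and scl_J4_123: "scl J4_1 c (m, l, w) = (c * m, c * l, c *s w)"
    "scl J4_2 c (m, l, w) = (c * m, c * l, c *s w)" "scl J4_3 c (m, l, w) = (c * m, c * l, c *s w)"
  and unt_J4_123: "unt J4_1 = (1, 1, 0)" "unt J4_2 = (1, 1, 0)" "unt J4_3 = (1, 1, 0)"
  by (simp_all add: J4_1_def J4_2_def J4_3_def prod_alg_def complex_alg_def spin_alg_def numeral_2_eq_2)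

lemma vector_4 [simp]:
  "(vector [x, y, z, w] :: 'a::zero ^ 4) $ 1 = x" "(vector [x, y, z, w] :: 'a ^ 4) $ 2 = y"
  "(vector [x, y, z, w] :: 'a ^ 4) $ 3 = z" "(vector [x, y, z, w] :: 'a ^ 4) $ 4 = w"
  unfolding vector_def by simp_all

lemmas table_simps = table_alg_def table_product_def sum_4 vec_eq_iff forall_4 axis_def vector_4

lemma scl_J4_4567: "scl J4_4 = (*s)" "scl J4_5 = (*s)" "scl J4_6 = (*s)" "scl J4_7 = (*s)"
  and unt_J4_4567: "unt J4_4 = vector [1, 0, 0, 1]" "unt J4_5 = vector [1, 0, 0, 1]"
    "unt J4_6 = vector [1, 0, 0, 0]" "unt J4_7 = vector [1, 0, 0, 0]"
  by (simp_all add: J4_4_def J4_5_def J4_6_def J4_7_def table_simps)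

lemma prd_J4_4: "prd J4_4 x y = vector [x $ 1 * y $ 1, x $ 1 * y $ 2 + x $ 2 * y $ 1 + x $ 3 * y $ 3,
    ((x $ 1 + x $ 4) * y $ 3 + x $ 3 * (y $ 1 + y $ 4)) / 2, x $ 4 * y $ 4]"
  by (simp add: J4_4_def table_simps algebra_simps)

lemma prd_J4_5: "prd J4_5 x y = vector [x $ 1 * y $ 1, x $ 1 * y $ 2 + x $ 2 * y $ 1,
    ((x $ 1 + x $ 4) * y $ 3 + x $ 3 * (y $ 1 + y $ 4)) / 2, x $ 4 * y $ 4]"
  by (simp add: J4_5_def table_simps algebra_simps)

lemma prd_J4_6: "prd J4_6 x y = vector [x $ 1 * y $ 1, x $ 1 * y $ 2 + x $ 2 * y $ 1,
    x $ 1 * y $ 3 + x $ 3 * y $ 1, x $ 1 * y $ 4 + x $ 4 * y $ 1 + x $ 2 * y $ 2 + x $ 3 * y $ 3]"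
  by (simp add: J4_6_def table_simps algebra_simps)

lemma prd_J4_7: "prd J4_7 x y = vector [x $ 1 * y $ 1, x $ 1 * y $ 2 + x $ 2 * y $ 1,
    x $ 1 * y $ 3 + x $ 3 * y $ 1, x $ 1 * y $ 4 + x $ 4 * y $ 1 + x $ 2 * y $ 2]"
  by (simp add: J4_7_def table_simps algebra_simps)

lemmas prd_J4_123 = prd_J4_1 prd_J4_2 prd_J4_3
lemmas prd_J4_4567 = prd_J4_4 prd_J4_5 prd_J4_6 prd_J4_7
lemmas coordinate_simps = vec_eq_iff forall_4 forall_2 axis_def vector_4

lemma vector_space_J4_123:
  assumes "J \<in> {J4_1, J4_2, J4_3}"
  shows "vector_space (scl J)"
  using assms by unfold_locales (auto simp: scl_J4_123 algebra_simps vec_eq_iff)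

lemma vector_space_vec: "vector_space ((*s) :: complex \<Rightarrow> complex ^ 'n \<Rightarrow> complex ^ 'n)"
  by unfold_locales

lemma ind4_bas: "ind4 (*s) (bas 1 :: complex ^ 4) (bas 2) (bas 3) (bas 4)"
  by (simp add: ind4_def coordinate_simps)

lemma bas_spans: "\<exists>a b c d. y = a *s (bas 1 :: complex ^ 4) + b *s bas 2 + c *s bas 3 + d *s bas 4"
  by (intro exI[of _ "y $ 1"] exI[of _ "y $ 2"] exI[of _ "y $ 3"] exI[of _ "y $ 4"])
    (simp add: coordinate_simps)

lemma ind4_J4_123:
  assumes "J \<in> {J4_1, J4_2, J4_3}"
  shows "ind4 (scl J) (1, 0, 0) (0, 1, 0) (0, 0, bas 1) (0, 0, bas 2)"
  using assms by (auto simp: ind4_def scl_J4_123 zero_prod_def coordinate_simps)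

lemma spans_J4_123:
  assumes "J \<in> {J4_1, J4_2, J4_3}"
  shows "\<exists>a b c d. y = scl J a (1, 0, 0) + scl J b (0, 1, 0) + scl J c (0, 0, bas 1) + scl J d (0, 0, bas 2)"
proof (cases y)
  case (fields m l w)
  show ?thesis
    using assms unfolding fields
    by (intro exI[of _ m] exI[of _ l] exI[of _ "w $ 1"] exI[of _ "w $ 2"])
      (auto simp: scl_J4_123 coordinate_simps)
qed

lemma jordan4_J4_123:
  assumes "J \<in> {J4_1, J4_2, J4_3}"
  shows "jordan4 J"
proof (rule jordan4I[OF vector_space_J4_123[OF assms] ind4_J4_123[OF assms] spans_J4_123[OF assms]])
  show "prd J x (y + z) = prd J x y + prd J x z" for x y z
    using assms by (cases x; cases y; cases z) (auto simp: prd_J4_123 coordinate_simps algebra_simps)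
  show "prd J x (scl J c y) = scl J c (prd J x y)" for c x y
    using assms by (cases x; cases y) (auto simp: prd_J4_123 scl_J4_123 coordinate_simps algebra_simps)
  show "prd J x y = prd J y x" for x y
    using assms by (cases x; cases y) (auto simp: prd_J4_123 coordinate_simps algebra_simps)
  show "prd J (unt J) x = x" for x
    using assms by (cases x) (auto simp: prd_J4_123 unt_J4_123 coordinate_simps algebra_simps)
  show "prd J (prd J x x) (prd J x y) = prd J x (prd J (prd J x x) y)" for x y
    using assms by (cases x; cases y) (auto simp: prd_J4_123 coordinate_simps algebra_simps)
qed

lemma jordan4_J4_4567:
  assumes "J \<in> {J4_4, J4_5, J4_6, J4_7}"
  shows "jordan4 J"
proof (rule jordan4I)
  have s: "scl J = (*s)" using assms by (auto simp: scl_J4_4567)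
  show "vector_space (scl J)" "ind4 (scl J) (bas 1) (bas 2) (bas 3) (bas 4)"
    "\<exists>a b c d. y = scl J a (bas 1) + scl J b (bas 2) + scl J c (bas 3) + scl J d (bas 4)" for y
    unfolding s by (rule vector_space_vec ind4_bas bas_spans)+
  show "prd J x (y + z) = prd J x y + prd J x z" for x y z
    using assms by (auto simp: prd_J4_4567 coordinate_simps algebra_simps add_divide_distrib)
  show "prd J x (scl J c y) = scl J c (prd J x y)" for c x y
    using assms by (auto simp: prd_J4_4567 s coordinate_simps algebra_simps)
  show "prd J x y = prd J y x" for x y
    using assms by (auto simp: prd_J4_4567 coordinate_simps algebra_simps)
  show "prd J (unt J) x = x" for x
    using assms by (auto simp: prd_J4_4567 unt_J4_4567 coordinate_simps algebra_simps)
  show "prd J (prd J x x) (prd J x y) = prd J x (prd J (prd J x x) y)" for x y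
    using assms by (auto simp: prd_J4_4567 coordinate_simps field_simps)
qed

section \<open>The adjoints of the seven algebras\<close>

lemma is_adjointI:
  assumes "form (scl A) 1 T" "form (scl A) 2 S" "form (scl A) 3 N"
    and "\<And>x. prd A x (prd A x x) - scl A (T x) (prd A x x) + scl A (S x) x - scl A (N x) (unt A) = 0"
    and "\<And>x. adj x = prd A x x - scl A (T x) x + scl A (S x) (unt A)"
  shows "is_adjoint A adj"
proof -
  have "generically (scl A)
      (\<lambda>x. prd A x (prd A x x) - scl A (T x) (prd A x x) + scl A (S x) x - scl A (N x) (unt A) = 0)"
    unfolding generically_def using assms(4) by (auto intro!: exI[of _ "\<lambda>x. 1"] poly_fun.const)
  then show ?thesis
    unfolding is_adjoint_def using assms by blast
qed

text \<open>An equality of quadratic maps, whereas \<open>adjoint_equivalent\<close> compares rational maps only.\<close>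

definition adjoint_is :: "'a::ab_group_add calg \<Rightarrow> (complex^4 \<Rightarrow> complex^4) \<Rightarrow> bool" where
  "adjoint_is A Q \<longleftrightarrow> (\<exists>adj \<psi> L. is_adjoint A adj \<and>
     Vector_Spaces.linear (*s) (scl A) \<psi> \<and> bij \<psi> \<and> Vector_Spaces.linear (*s) (*s) L \<and> bij L \<and>
     (\<forall>v. adj (\<psi> v) = \<psi> (L (Q v))))"

lemma linear_vec_nth: "Vector_Spaces.linear (*s) (*) (\<lambda>x::complex^'n. x $ i)"
  using vector_space_vec vector_space_mult by (auto simp: Vector_Spaces.linear_iff)

lemma poly_fun_nth: "poly_fun (*s) (\<lambda>x::complex^'n. x $ i)"
  by (rule poly_fun.linear[OF linear_vec_nth])

lemma poly_fun_J4_123: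
  assumes "J \<in> {J4_1, J4_2, J4_3}"
  shows "poly_fun (scl J) (\<lambda>x. fst x)" "poly_fun (scl J) (\<lambda>x. fst (snd x))"
    "poly_fun (scl J) (\<lambda>x. snd (snd x) $ i)"
  using assms vector_space_J4_123[OF assms] vector_space_mult
  by (auto intro!: poly_fun.linear simp: Vector_Spaces.linear_iff scl_J4_123)

definition diag4 :: "complex \<Rightarrow> complex \<Rightarrow> complex \<Rightarrow> complex \<Rightarrow> complex^4 \<Rightarrow> complex^4" where
  "diag4 a b c d x = vector [a * x $ 1, b * x $ 2, c * x $ 3, d * x $ 4]"

lemma linear_diag4: "Vector_Spaces.linear (*s) (*s) (diag4 a b c d)"
  using vector_space_vec by (auto simp: Vector_Spaces.linear_iff diag4_def coordinate_simps algebra_simps)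

lemma bij_diag4: "a\<^sup>2 = 1 \<Longrightarrow> b\<^sup>2 = 1 \<Longrightarrow> c\<^sup>2 = 1 \<Longrightarrow> d\<^sup>2 = 1 \<Longrightarrow> bij (diag4 a b c d)"
  by (rule o_bij[of "diag4 a b c d"])
    (auto simp: diag4_def coordinate_simps fun_eq_iff power2_eq_square mult.assoc[symmetric])

lemmas Q_defs = Q1_def Q2_def Q3_def Q4_def Q5_def Q6_def Q7_def in_coords_def

text \<open>\<open>T\<close>, \<open>S\<close> and \<open>N\<close> come from
  \<open>(X - m) * (X\<^sup>2 - 2 * l * X + l\<^sup>2 + q)\<close>, where the second factor is the
  quadratic equation of \<open>(l, w)\<close> in the spin factor and \<open>q\<close> the value of
  its form at \<open>w\<close>. The next two algebras follow the same pattern.\<close>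

lemma adjoint_J4_1: "adjoint_is J4_1 Q1"
proof -
  let ?q = "\<lambda>x. (snd (snd x) $ 1)\<^sup>2 + (snd (snd x) $ 2)\<^sup>2 :: complex"
  let ?adj = "\<lambda>(m, l, w). (l\<^sup>2 + ((w $ 1)\<^sup>2 + (w $ 2)\<^sup>2), m * l, - m *s w) :: complex \<times> complex \<times> (complex ^ 2)"
  note pf = poly_fun_J4_123[of J4_1, simplified]
  have "is_adjoint J4_1 ?adj"
  proof (rule is_adjointI)
    show "form (scl J4_1) 1 (\<lambda>x. fst x + 2 * fst (snd x))"
      by (auto simp: form_def scl_J4_123 algebra_simps intro!: poly_fun_intros(3-) pf)
    show "form (scl J4_1) 2 (\<lambda>x. 2 * (fst x * fst (snd x)) + (fst (snd x))\<^sup>2 + ?q x)"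
      by (auto simp: form_def scl_J4_123 power2_eq_square algebra_simps intro!: poly_fun_intros(3-) pf)
    show "form (scl J4_1) 3 (\<lambda>x. fst x * ((fst (snd x))\<^sup>2 + ?q x))"
      by (auto simp: form_def scl_J4_123 power2_eq_square power3_eq_cube algebra_simps intro!: poly_fun_intros(3-) pf)
  qed (auto simp: scl_J4_123 unt_J4_123 prd_J4_1 coordinate_simps zero_prod_def power2_eq_square algebra_simps)
  moreover have "Vector_Spaces.linear (*s) (scl J4_1) (\<lambda>x. (x $ 1, x $ 2, vector [x $ 3, x $ 4]))"
    using vector_space_vec vector_space_J4_123[of J4_1]
    by (auto simp: Vector_Spaces.linear_iff scl_J4_123 coordinate_simps)
  moreover have "bij (\<lambda>x::complex^4. (x $ 1, x $ 2, vector [x $ 3, x $ 4] :: complex ^ 2))"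
    by (rule o_bij[of "\<lambda>(m, l, w). vector [m, l, w $ 1, w $ 2]"]) (auto simp: coordinate_simps fun_eq_iff)
  ultimately show ?thesis
    unfolding adjoint_is_def
    by (intro exI[of _ ?adj] exI[of _ "\<lambda>x. (x $ 1, x $ 2, vector [x $ 3, x $ 4])"] exI[of _ "diag4 1 1 1 1"])
      (auto simp: linear_diag4 bij_diag4, auto simp: diag4_def Q_defs coordinate_simps)
qed

lemma adjoint_J4_2: "adjoint_is J4_2 Q2"
proof -
  let ?q = "\<lambda>x. (snd (snd x) $ 1)\<^sup>2 :: complex"
  let ?adj = "\<lambda>(m, l, w). (l\<^sup>2 + (w $ 1)\<^sup>2, m * l, - m *s w) :: complex \<times> complex \<times> (complex ^ 2)"
  \<comment> \<open>In the coordinates \<open>l + \<i> * w $ 1\<close> and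
    \<open>l - \<i> * w $ 1\<close> the quadratic form of the first entry becomes a product. The
    adjoint, which negates \<open>w\<close>, exchanges them up to the factor
    \<open>m\<close>.\<close>
  let ?\<psi> = "\<lambda>x::complex^4. (x $ 1, (x $ 2 + x $ 3) / 2, vector [(x $ 2 - x $ 3) / (2 * \<i>), x $ 4] :: complex ^ 2)"
  note pf = poly_fun_J4_123[of J4_2, simplified]
  have "is_adjoint J4_2 ?adj"
  proof (rule is_adjointI)
    show "form (scl J4_2) 1 (\<lambda>x. fst x + 2 * fst (snd x))"
      by (auto simp: form_def scl_J4_123 algebra_simps intro!: poly_fun_intros(3-) pf)
    show "form (scl J4_2) 2 (\<lambda>x. 2 * (fst x * fst (snd x)) + (fst (snd x))\<^sup>2 + ?q x)"
      by (auto simp: form_def scl_J4_123 power2_eq_square algebra_simps intro!: poly_fun_intros(3-) pf)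
    show "form (scl J4_2) 3 (\<lambda>x. fst x * ((fst (snd x))\<^sup>2 + ?q x))"
      by (auto simp: form_def scl_J4_123 power2_eq_square power3_eq_cube algebra_simps intro!: poly_fun_intros(3-) pf)
  qed (auto simp: scl_J4_123 unt_J4_123 prd_J4_2 coordinate_simps zero_prod_def power2_eq_square algebra_simps)
  moreover have "Vector_Spaces.linear (*s) (scl J4_2) ?\<psi>"
    using vector_space_vec vector_space_J4_123[of J4_2]
    by (auto simp: Vector_Spaces.linear_iff scl_J4_123 coordinate_simps add_divide_distrib diff_divide_distrib algebra_simps)
  moreover have "bij ?\<psi>"
    by (rule o_bij[of "\<lambda>(m, l, w). vector [m, l + \<i> * w $ 1, l - \<i> * w $ 1, w $ 2]"])
      (auto simp: coordinate_simps fun_eq_iff field_simps)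
  ultimately show ?thesis
    unfolding adjoint_is_def
    by (intro exI[of _ ?adj] exI[of _ ?\<psi>] exI[of _ "diag4 1 1 1 (-1)"])
      (auto simp: linear_diag4 bij_diag4, auto simp: diag4_def Q_defs coordinate_simps field_simps power2_eq_square)
qed

lemma adjoint_J4_3: "adjoint_is J4_3 Q3"
proof -
  let ?adj = "\<lambda>(m, l, w). (l\<^sup>2, m * l, - m *s w) :: complex \<times> complex \<times> (complex ^ 2)"
  note pf = poly_fun_J4_123[of J4_3, simplified]
  have "is_adjoint J4_3 ?adj"
  proof (rule is_adjointI)
    show "form (scl J4_3) 1 (\<lambda>x. fst x + 2 * fst (snd x))"
      by (auto simp: form_def scl_J4_123 algebra_simps intro!: poly_fun_intros(3-) pf)
    show "form (scl J4_3) 2 (\<lambda>x. 2 * (fst x * fst (snd x)) + (fst (snd x))\<^sup>2)"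
      by (auto simp: form_def scl_J4_123 power2_eq_square algebra_simps intro!: poly_fun_intros(3-) pf)
    show "form (scl J4_3) 3 (\<lambda>x. fst x * (fst (snd x))\<^sup>2)"
      by (auto simp: form_def scl_J4_123 power2_eq_square power3_eq_cube algebra_simps intro!: poly_fun_intros(3-) pf)
  qed (auto simp: scl_J4_123 unt_J4_123 prd_J4_3 coordinate_simps zero_prod_def power2_eq_square algebra_simps)
  moreover have "Vector_Spaces.linear (*s) (scl J4_3) (\<lambda>x. (x $ 1, x $ 2, vector [x $ 3, x $ 4]))"
    using vector_space_vec vector_space_J4_123[of J4_3]
    by (auto simp: Vector_Spaces.linear_iff scl_J4_123 coordinate_simps)
  moreover have "bij (\<lambda>x::complex^4. (x $ 1, x $ 2, vector [x $ 3, x $ 4] :: complex ^ 2))"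
    by (rule o_bij[of "\<lambda>(m, l, w). vector [m, l, w $ 1, w $ 2]"]) (auto simp: coordinate_simps fun_eq_iff)
  ultimately show ?thesis
    unfolding adjoint_is_def
    by (intro exI[of _ ?adj] exI[of _ "\<lambda>x. (x $ 1, x $ 2, vector [x $ 3, x $ 4])"] exI[of _ "diag4 1 1 (-1) (-1)"])
      (auto simp: linear_diag4 bij_diag4, auto simp: diag4_def Q_defs coordinate_simps)
qed

text \<open>Here the cubic is \<open>(X - x $ 1)\<^sup>2 * (X - x $ 4)\<close>. That the two
  algebras differ is what makes \<open>r\<close> vanish for \<open>J4_5\<close>.\<close>

lemma adjoint_J4_45:
  assumes "J \<in> {J4_4, J4_5}" "r = (if J = J4_4 then 1 else 0)" "J4_4 \<noteq> J4_5"
  shows "is_adjoint J (\<lambda>x. vector [x $ 1 * x $ 4, r * (x $ 3)\<^sup>2 - x $ 2 * x $ 4, - (x $ 1 * x $ 3), (x $ 1)\<^sup>2])"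
proof (rule is_adjointI)
  have s: "scl J = (*s)" using assms by (auto simp: scl_J4_4567)
  show "form (scl J) 1 (\<lambda>x. 2 * x $ 1 + x $ 4)"
    by (auto simp: form_def s algebra_simps intro!: poly_fun_intros(3-) poly_fun_nth poly_fun.const)
  show "form (scl J) 2 (\<lambda>x. (x $ 1)\<^sup>2 + 2 * (x $ 1 * x $ 4))"
    by (auto simp: form_def s power2_eq_square algebra_simps intro!: poly_fun_intros(3-) poly_fun_nth poly_fun.const)
  show "form (scl J) 3 (\<lambda>x. (x $ 1)\<^sup>2 * x $ 4)"
    by (auto simp: form_def s power2_eq_square power3_eq_cube algebra_simps intro!: poly_fun_intros(3-) poly_fun_nth poly_fun.const)
qed (use assms in \<open>auto simp: scl_J4_4567 unt_J4_4567 prd_J4_4 prd_J4_5 coordinate_simps power2_eq_square field_simps\<close>)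

lemma J4_4_neq_J4_5: "J4_4 \<noteq> J4_5"
proof
  assume "J4_4 = J4_5"
  then have "prd J4_4 (bas 3) (bas 3) $ 2 = prd J4_5 (bas 3) (bas 3) $ 2" by simp
  then show False by (simp add: prd_J4_4567 coordinate_simps)
qed

lemma linear_bij_perm:
  "Vector_Spaces.linear (*s) (*s) (\<lambda>x::complex^4. vector [x $ 1, x $ 3, x $ 4, x $ 2] :: complex^4)"
  "bij (\<lambda>x::complex^4. vector [x $ 1, x $ 3, x $ 4, x $ 2] :: complex^4)"
proof -
  show "Vector_Spaces.linear (*s) (*s) (\<lambda>x::complex^4. vector [x $ 1, x $ 3, x $ 4, x $ 2] :: complex^4)"
    using vector_space_vec by (auto simp: Vector_Spaces.linear_iff coordinate_simps)
  show "bij (\<lambda>x::complex^4. vector [x $ 1, x $ 3, x $ 4, x $ 2] :: complex^4)"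
    by (rule o_bij[of "\<lambda>x::complex^4. vector [x $ 1, x $ 4, x $ 2, x $ 3] :: complex^4"])
      (auto simp: coordinate_simps fun_eq_iff)
qed

lemma adjoint_J4_4: "adjoint_is J4_4 Q4"
  unfolding adjoint_is_def
  using adjoint_J4_45[of J4_4 1] J4_4_neq_J4_5 linear_bij_perm
  by (intro exI[of _ "\<lambda>x. vector [x $ 1 * x $ 4, 1 * (x $ 3)\<^sup>2 - x $ 2 * x $ 4, - (x $ 1 * x $ 3), (x $ 1)\<^sup>2]"]
      exI[of _ "\<lambda>x. vector [x $ 1, x $ 3, x $ 4, x $ 2]"] exI[of _ "diag4 1 1 1 (-1)"])
    (auto simp: linear_diag4 bij_diag4 scl_J4_4567, auto simp: diag4_def Q_defs coordinate_simps)

lemma adjoint_J4_5: "adjoint_is J4_5 Q5"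
  unfolding adjoint_is_def
  using adjoint_J4_45[of J4_5 0] J4_4_neq_J4_5 linear_bij_perm
  by (intro exI[of _ "\<lambda>x. vector [x $ 1 * x $ 4, 0 * (x $ 3)\<^sup>2 - x $ 2 * x $ 4, - (x $ 1 * x $ 3), (x $ 1)\<^sup>2]"]
      exI[of _ "\<lambda>x. vector [x $ 1, x $ 3, x $ 4, x $ 2]"] exI[of _ "diag4 1 1 (-1) (-1)"])
    (auto simp: linear_diag4 bij_diag4 scl_J4_4567, auto simp: diag4_def Q_defs coordinate_simps)

text \<open>For both algebras the cubic is \<open>(X - x $ 1) ^ 3\<close>.\<close>

lemma forms_J4_67:
  assumes "J \<in> {J4_6, J4_7}"
  shows "form (scl J) 1 (\<lambda>x. 3 * x $ 1)" "form (scl J) 2 (\<lambda>x. 3 * (x $ 1)\<^sup>2)" "form (scl J) 3 (\<lambda>x. (x $ 1) ^ 3)"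
  using assms by (auto simp: form_def scl_J4_4567 power_mult_distrib algebra_simps intro!: poly_fun_intros(3-) poly_fun_nth poly_fun.const)

lemma adjoint_J4_6: "adjoint_is J4_6 Q6"
proof -
  let ?adj = "\<lambda>x::complex^4. vector [(x $ 1)\<^sup>2, - (x $ 1 * x $ 2), - (x $ 1 * x $ 3),
    (x $ 2)\<^sup>2 + (x $ 3)\<^sup>2 - x $ 1 * x $ 4] :: complex^4"
  \<comment> \<open>The sum of the two squares factors over \<open>\<complex>\<close> and becomes
    \<open>y * z\<close>; halving the last coordinate supplies the factor 2 in
    \<open>Q6\<close>.\<close>
  let ?\<psi> = "\<lambda>x::complex^4. vector [x $ 1, (x $ 2 + x $ 3) / 2, (x $ 2 - x $ 3) / (2 * \<i>), x $ 4 / 2] :: complex^4"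
  have "is_adjoint J4_6 ?adj"
    by (rule is_adjointI[OF forms_J4_67])
      (auto simp: scl_J4_4567 unt_J4_4567 prd_J4_6 coordinate_simps power2_eq_square power3_eq_cube field_simps)
  moreover have "Vector_Spaces.linear (*s) (scl J4_6) ?\<psi>"
    using vector_space_vec
    by (auto simp: Vector_Spaces.linear_iff scl_J4_4567 coordinate_simps add_divide_distrib diff_divide_distrib algebra_simps)
  moreover have "bij ?\<psi>"
    by (rule o_bij[of "\<lambda>x::complex^4. vector [x $ 1, x $ 2 + \<i> * x $ 3, x $ 2 - \<i> * x $ 3, 2 * x $ 4] :: complex^4"])
      (auto simp: coordinate_simps fun_eq_iff field_simps)
  ultimately show ?thesis
    unfolding adjoint_is_def
    by (intro exI[of _ ?adj] exI[of _ ?\<psi>] exI[of _ "diag4 1 1 1 1"])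
      (auto simp: linear_diag4 bij_diag4, auto simp: diag4_def Q_defs coordinate_simps field_simps power2_eq_square)
qed

lemma adjoint_J4_7: "adjoint_is J4_7 Q7"
proof -
  let ?adj = "\<lambda>x::complex^4. vector [(x $ 1)\<^sup>2, - (x $ 1 * x $ 2), - (x $ 1 * x $ 3),
    (x $ 2)\<^sup>2 - x $ 1 * x $ 4] :: complex^4"
  have "is_adjoint J4_7 ?adj"
    by (rule is_adjointI[OF forms_J4_67])
      (auto simp: scl_J4_4567 unt_J4_4567 prd_J4_7 coordinate_simps power2_eq_square power3_eq_cube field_simps)
  then show ?thesis
    unfolding adjoint_is_def
    by (intro exI[of _ ?adj] exI[of _ "\<lambda>x. x"] exI[of _ "diag4 1 1 1 1"])
      (auto simp: linear_diag4 bij_diag4 scl_J4_4567 vec.linear_ident, auto simp: diag4_def Q_defs coordinate_simps)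
qed

section \<open>The rank of the seven algebras\<close>

lemma has_rank_J4_123:
  assumes "J \<in> {J4_1, J4_2, J4_3}"
  shows "has_rank J 3"
proof -
  interpret jordan4 J by (rule jordan4_J4_123[OF assms])
  show ?thesis
  proof (rule rank3I)
    show "cyclic (1, 0, bas 1)"
      using assms by (auto simp: cyclic_def ind3_def prd_J4_123 scl_J4_123 unt_J4_123 zero_prod_def coordinate_simps)
  next
    fix x :: "complex \<times> complex \<times> (complex ^ 2)"
    obtain m l w where x: "x = (m, l, w)" by (cases x)
    define q where "q = (if J = J4_1 then (w $ 1)\<^sup>2 + (w $ 2)\<^sup>2 else if J = J4_2 then (w $ 1)\<^sup>2 else 0)"
    have "J4_1 \<noteq> J4_2" "J4_1 \<noteq> J4_3" "J4_2 \<noteq> J4_3"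
      using prd_J4_123[of 0 0 "bas 2" 0 0 "bas 2"] prd_J4_123[of 0 0 "bas 1" 0 0 "bas 1"]
      by (auto simp: axis_def)
    then have "prd J x (prd J x x) = scl J (m + 2 * l) (prd J x x) + scl J (- (2 * m * l + l\<^sup>2 + q)) x
        + scl J (m * (l\<^sup>2 + q)) (unt J)"
      using assms unfolding x q_def
      by (auto simp: prd_J4_123 scl_J4_123 unt_J4_123 coordinate_simps power2_eq_square algebra_simps)
    then show "\<exists>a b c. prd J x (prd J x x) = scl J a (prd J x x) + scl J b x + scl J c (unt J)"
      by blast
  qed
qed

lemma has_rank_J4_45:
  assumes "J \<in> {J4_4, J4_5}"
  shows "has_rank J 3"
proof -
  interpret jordan4 J using assms jordan4_J4_4567 by auto
  show ?thesis
  proof (rule rank3I)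
    show "cyclic (bas 2 + bas 4)"
      using assms by (auto simp: cyclic_def ind3_def prd_J4_4567 scl_J4_4567 unt_J4_4567 coordinate_simps)
  next
    fix x
    have "prd J x (prd J x x) = scl J (2 * x $ 1 + x $ 4) (prd J x x) + scl J (- ((x $ 1)\<^sup>2 + 2 * x $ 1 * x $ 4)) x
        + scl J ((x $ 1)\<^sup>2 * x $ 4) (unt J)"
      using assms
      by (auto simp: prd_J4_4 prd_J4_5 scl_J4_4567 unt_J4_4567 coordinate_simps power2_eq_square field_simps)
    then show "\<exists>a b c. prd J x (prd J x x) = scl J a (prd J x x) + scl J b x + scl J c (unt J)"
      by blast
  qed
qed

lemma has_rank_J4_67:
  assumes "J \<in> {J4_6, J4_7}"
  shows "has_rank J 3"
proof -
  interpret jordan4 J using assms jordan4_J4_4567 by auto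
  show ?thesis
  proof (rule rank3I)
    show "cyclic (bas 2)"
      using assms by (auto simp: cyclic_def ind3_def prd_J4_4567 scl_J4_4567 unt_J4_4567 coordinate_simps)
  next
    fix x
    have "prd J x (prd J x x) = scl J (3 * x $ 1) (prd J x x) + scl J (- (3 * (x $ 1)\<^sup>2)) x
        + scl J ((x $ 1) ^ 3) (unt J)"
      using assms
      by (auto simp: prd_J4_6 prd_J4_7 scl_J4_4567 unt_J4_4567 coordinate_simps power2_eq_square power3_eq_cube algebra_simps)
    then show "\<exists>a b c. prd J x (prd J x x) = scl J a (prd J x x) + scl J b x + scl J c (unt J)"
      by blast
  qed
qed

lemmas has_rank_J4_4567 = has_rank_J4_45 has_rank_J4_67

section \<open>Isomorphisms\<close>

text \<open>Commutativity leaves ten products of basis vectors. \<open>hom\<close> is given an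
  arbitrary linear map matching the bases, so that a product can be expanded in \<open>A\<close>
  before it is mapped.\<close>

lemma isomorphic_by_basis:
  assumes "jordan4 A" "jordan4 B" "ind4 (scl A) b1 b2 b3 b4" "ind4 (scl B) c1 c2 c3 c4"
    and hom: "\<And>f. Vector_Spaces.linear (scl A) (scl B) f \<Longrightarrow> f b1 = c1 \<Longrightarrow> f b2 = c2 \<Longrightarrow>
      f b3 = c3 \<Longrightarrow> f b4 = c4 \<Longrightarrow>
      f (prd A b1 b1) = prd B c1 c1 \<and> f (prd A b1 b2) = prd B c1 c2 \<and> f (prd A b1 b3) = prd B c1 c3 \<and>
      f (prd A b1 b4) = prd B c1 c4 \<and> f (prd A b2 b2) = prd B c2 c2 \<and> f (prd A b2 b3) = prd B c2 c3 \<and>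
      f (prd A b2 b4) = prd B c2 c4 \<and> f (prd A b3 b3) = prd B c3 c3 \<and> f (prd A b3 b4) = prd B c3 c4 \<and>
      f (prd A b4 b4) = prd B c4 c4"
  shows "isomorphic A B"
proof -
  interpret A: jordan4 A by fact
  interpret B: jordan4 B by fact
  obtain f where f: "Vector_Spaces.linear (scl A) (scl B) f" "bij f" "f b1 = c1" "f b2 = c2" "f b3 = c3" "f b4 = c4"
    using ind4_linear_bij[OF A.fin4_axioms B.fin4_axioms assms(3,4)] by blast
  interpret f: Vector_Spaces.linear "scl A" "scl B" f by fact
  note h = hom[OF f(1,3-6)]
  have h': "f (prd A b2 b1) = prd B c2 c1" "f (prd A b3 b1) = prd B c3 c1" "f (prd A b4 b1) = prd B c4 c1"
    "f (prd A b3 b2) = prd B c3 c2" "f (prd A b4 b2) = prd B c4 c2" "f (prd A b4 b3) = prd B c4 c3"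
    using h A.comm B.comm by metis+
  have "f (prd A x y) = prd B (f x) (f y)" for x y
  proof -
    obtain a b c d where x: "x = scl A a b1 + scl A b b2 + scl A c b3 + scl A d b4"
      using A.ind4_spans[OF assms(3)] by blast
    obtain a' b' c' d' where y: "y = scl A a' b1 + scl A b' b2 + scl A c' b3 + scl A d' b4"
      using A.ind4_spans[OF assms(3)] by blast
    show ?thesis
      unfolding x y by (simp add: A.mul_simps B.mul_simps f.add f.scale f(3-6) h h')
  qed
  then show ?thesis
    unfolding isomorphic_def using f by blast
qed

section \<open>Classification of the algebras\<close>

context jordan4
begin

lemma collect_scale:
  "a \<star> x + a \<star> x = (a * 2) \<star> x" "a \<star> x + (a \<star> x + y) = (a * 2) \<star> x + y"
  "a \<star> x + (a * 2) \<star> x = (a * 3) \<star> x" "a \<star> x + ((a * 2) \<star> x + y) = (a * 3) \<star> x + y"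
proof -
  have 1: "a + a = a * 2" "a + a * 2 = a * 3" by algebra+
  show "a \<star> x + a \<star> x = (a * 2) \<star> x" "a \<star> x + (a \<star> x + y) = (a * 2) \<star> x + y"
    "a \<star> x + (a * 2) \<star> x = (a * 3) \<star> x" "a \<star> x + ((a * 2) \<star> x + y) = (a * 3) \<star> x + y"
    unfolding add.assoc[symmetric] scale_left_distrib[symmetric] 1 by simp_all
qed

lemma ind4_eq:
  assumes "ind4 sc u v w x"
  shows "a \<star> u + b \<star> v + c \<star> w + d \<star> x = a' \<star> u + b' \<star> v + c' \<star> w + d' \<star> x \<longleftrightarrow>
    a = a' \<and> b = b' \<and> c = c' \<and> d = d'"
proof
  assume eq: "a \<star> u + b \<star> v + c \<star> w + d \<star> x = a' \<star> u + b' \<star> v + c' \<star> w + d' \<star> x"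
  have "(a - a') \<star> u + (b - b') \<star> v + (c - c') \<star> w + (d - d') \<star> x =
     (a \<star> u + b \<star> v + c \<star> w + d \<star> x) - (a' \<star> u + b' \<star> v + c' \<star> w + d' \<star> x)"
    by (simp add: algebra_simps)
  also have "\<dots> = 0" using eq by simp
  finally show "a = a' \<and> b = b' \<and> c = c' \<and> d = d'"
    using assms unfolding ind4_def by (metis eq_iff_diff_eq_0)
qed simp

lemma ind4_combine:
  assumes "ind4 sc u v w x" "d \<noteq> 0" "t \<noteq> 0"
  shows "ind4 sc u v (a \<star> u + b \<star> v + t \<star> w) (a' \<star> u + b' \<star> v + c' \<star> w + d \<star> x)"
  unfolding ind4_def
proof (intro allI impI)
  fix p q r s
  assume "p \<star> u + q \<star> v + r \<star> (a \<star> u + b \<star> v + t \<star> w) + s \<star> (a' \<star> u + b' \<star> v + c' \<star> w + d \<star> x) = 0"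
  then have "(p + r * a + s * a') \<star> u + (q + r * b + s * b') \<star> v + (r * t + s * c') \<star> w + (s * d) \<star> x = 0"
    by (simp add: algebra_simps)
  then have "p + r * a + s * a' = 0" "q + r * b + s * b' = 0" "r * t + s * c' = 0" "s * d = 0"
    using assms(1) unfolding ind4_def by blast+
  then show "p = 0 \<and> q = 0 \<and> r = 0 \<and> s = 0" using assms(2,3) by simp
qed

lemma ind4_swap: "ind4 sc u v w x \<Longrightarrow> ind4 sc u v x w"
  unfolding ind4_def
proof (intro allI impI)
  fix a b c d
  assume *: "\<forall>a b c d. a \<star> u + b \<star> v + c \<star> w + d \<star> x = 0 \<longrightarrow> a = 0 \<and> b = 0 \<and> c = 0 \<and> d = 0"
    and "a \<star> u + b \<star> v + c \<star> x + d \<star> w = 0"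
  then show "a = 0 \<and> b = 0 \<and> c = 0 \<and> d = 0"
    using *[rule_format, of a b d c] by (simp add: algebra_simps)
qed

text \<open>By \<open>rank3_cubic\<close>, a consequence of rank 3. It is all that the
  classification uses of it besides the existence of a cyclic element.\<close>

definition cubic_algebra where
  "cubic_algebra \<longleftrightarrow> (\<forall>y. \<not> ind4 sc e y (y \<odot> y) (y \<odot> (y \<odot> y)))"

subsection \<open>Products with a one-dimensional ideal\<close>

text \<open>An idempotent whose Peirce 0-component is three-dimensional, with unity
  \<open>e - c\<close>. The algebra is then \<open>\<complex>\<close> times that component.\<close>

definition split_basis where
  "split_basis c n w \<longleftrightarrow> c \<odot> c = c \<and> ind4 sc c (e - c) n w \<and> c \<odot> n = 0 \<and> c \<odot> w = 0"

lemma split_basis_products: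
  assumes "split_basis c n w"
  shows "c \<odot> (e - c) = 0" "(e - c) \<odot> (e - c) = e - c" "(e - c) \<odot> n = n" "(e - c) \<odot> w = w"
  using assms unfolding split_basis_def by (simp_all add: mul_simps)

text \<open>The values -1 reflect the minus sign before the form in \<open>spin_alg\<close>.\<close>

lemma split_basis_isomorphic:
  assumes "split_basis c n w" "n \<odot> w = 0"
    and "n \<odot> n = p \<star> (e - c)" "w \<odot> w = q \<star> (e - c)"
    and "(p, q) = (-1, -1) \<and> J = J4_1 \<or> (p, q) = (-1, 0) \<and> J = J4_2 \<or> (p, q) = (0, 0) \<and> J = J4_3"
  shows "isomorphic A J"
proof -
  have J: "J \<in> {J4_1, J4_2, J4_3}" using assms(5) by blast
  note s = split_basis_products[OF assms(1)]
  show ?thesis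
  proof (rule isomorphic_by_basis[OF jordan4_axioms jordan4_J4_123[OF J] _ ind4_J4_123[OF J]])
    show "ind4 sc c (e - c) n w" using assms(1) by (simp add: split_basis_def)
    fix f
    assume f: "Vector_Spaces.linear sc (scl J) f" "f c = (1, 0, 0)" "f (e - c) = (0, 1, 0)"
      "f n = (0, 0, bas 1)" "f w = (0, 0, bas 2)"
    interpret f: Vector_Spaces.linear sc "scl J" f by fact
    have c: "c \<odot> c = c" "c \<odot> n = 0" "c \<odot> w = 0" using assms(1) by (simp_all add: split_basis_def)
    have "f (n \<odot> n) = scl J p (0, 1, 0)" "f (w \<odot> w) = scl J q (0, 1, 0)" "f (n \<odot> w) = 0"
      "f (c \<odot> (e - c)) = 0"
      using assms(2-4) s(1) f by (simp_all only: f.scale f.zero)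
    then show "f (c \<odot> c) = prd J (1, 0, 0) (1, 0, 0) \<and> f (c \<odot> (e - c)) = prd J (1, 0, 0) (0, 1, 0) \<and>
      f (c \<odot> n) = prd J (1, 0, 0) (0, 0, bas 1) \<and> f (c \<odot> w) = prd J (1, 0, 0) (0, 0, bas 2) \<and>
      f ((e - c) \<odot> (e - c)) = prd J (0, 1, 0) (0, 1, 0) \<and> f ((e - c) \<odot> n) = prd J (0, 1, 0) (0, 0, bas 1) \<and>
      f ((e - c) \<odot> w) = prd J (0, 1, 0) (0, 0, bas 2) \<and> f (n \<odot> n) = prd J (0, 0, bas 1) (0, 0, bas 1) \<and>
      f (n \<odot> w) = prd J (0, 0, bas 1) (0, 0, bas 2) \<and> f (w \<odot> w) = prd J (0, 0, bas 2) (0, 0, bas 2)"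
      unfolding c s(2-4) f f.zero
      using assms(5) by (auto simp: prd_J4_123 scl_J4_123 zero_prod_def coordinate_simps)
  qed
qed

lemma split_basis_orthogonal:
  assumes "split_basis c n w" "n \<odot> w = 0" "n \<odot> n = -1 \<star> (e - c)" "w \<odot> w = q \<star> (e - c)"
  shows "isomorphic A J4_1 \<or> isomorphic A J4_2"
proof (cases "q = 0")
  case True
  then show ?thesis using split_basis_isomorphic[of c n w "-1" q J4_2] assms by simp
next
  case False
  define k where "k = csqrt (- 1 / q)"
  have k: "k * k * q = -1"
    using False power2_csqrt[of "- 1 / q"] by (simp add: k_def power2_eq_square)
  then have "k \<noteq> 0" by auto
  then have "ind4 sc c (e - c) n (k \<star> w)"
    using ind4_combine[of c "e - c" n w k 1 0 0 0 0 0] assms(1) by (simp add: split_basis_def)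
  then have "split_basis c n (k \<star> w)"
    using assms(1) by (simp add: split_basis_def mul_simps)
  moreover have "(k \<star> w) \<odot> (k \<star> w) = -1 \<star> (e - c)"
    by (simp only: scale_left scale_right assms(4) scale_scale k mult.assoc[symmetric])
  ultimately show ?thesis
    using split_basis_isomorphic[of c n "k \<star> w" "-1" "-1" J4_1] assms(2,3) by (simp add: mul_simps)
qed

text \<open>One Gram-Schmidt step: \<open>n\<close> is scaled to have square
  \<open>- (e - c)\<close>, and \<open>w\<close> is made orthogonal to it.\<close>

lemma split_basis_anisotropic:
  assumes "split_basis c n w" "n \<odot> w = r \<star> (e - c)" "n \<odot> n = p \<star> (e - c)" "w \<odot> w = q \<star> (e - c)" "p \<noteq> 0"
  shows "isomorphic A J4_1 \<or> isomorphic A J4_2"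
proof -
  define k where "k = csqrt (- 1 / p)"
  have k: "k * k * p = -1"
    using assms(5) power2_csqrt[of "- 1 / p"] by (simp add: k_def power2_eq_square)
  then have k0: "k \<noteq> 0" by auto
  have "ind4 sc c (e - c) (k \<star> n) ((- r / p) \<star> n + w)"
    using ind4_combine[of c "e - c" n w 1 k 0 0 0 0 "- r / p"] assms(1) k0 by (simp add: split_basis_def)
  then have 1: "split_basis c (k \<star> n) ((- r / p) \<star> n + w)"
    using assms(1) by (simp add: split_basis_def mul_simps)
  have 2: "(k \<star> n) \<odot> ((- r / p) \<star> n + w) = 0"
    using assms(2,3,5) by (simp add: mul_simps)
  have 3: "(k \<star> n) \<odot> (k \<star> n) = -1 \<star> (e - c)"
    by (simp only: scale_left scale_right assms(3) scale_scale k mult.assoc[symmetric])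
  have 4: "((- r / p) \<star> n + w) \<odot> ((- r / p) \<star> n + w) = (q - r * r / p) \<star> (e - c)"
    using assms(2-5) comm[of w n] by (simp only: mul_simps) (simp add: algebra_simps)
  show ?thesis
    by (rule split_basis_orthogonal[OF 1 2 3 4])
qed

lemma split_basis_normal_form:
  assumes s: "split_basis c n w" and r: "n \<odot> w = r \<star> (e - c)" and p: "n \<odot> n = p \<star> (e - c)"
    and q: "w \<odot> w = q \<star> (e - c)"
  shows "isomorphic A J4_1 \<or> isomorphic A J4_2 \<or> isomorphic A J4_3"
proof -
  consider "p \<noteq> 0" | "q \<noteq> 0" | "p = 0" "q = 0" "r \<noteq> 0" | "p = 0" "q = 0" "r = 0" by blast
  then show ?thesis
  proof cases
    case 1
    then show ?thesis using split_basis_anisotropic[OF s r p q] by blast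
  next
    case 2
    have "split_basis c w n" using s ind4_swap by (simp add: split_basis_def)
    then show ?thesis using split_basis_anisotropic[of c w n r q p] 2 p q r comm[of w n] by auto
  next
    case 3
    \<comment> \<open>A hyperbolic plane: \<open>n\<close> and \<open>w\<close> are isotropic, but
      their sum has square \<open>(2 * r) \<star> (e - c)\<close>.\<close>
    have "ind4 sc c (e - c) w (n + w)"
      using ind4_combine[of c "e - c" w n 1 1 0 0 0 0 1] s ind4_swap
      by (simp add: split_basis_def add.commute)
    then have "split_basis c (n + w) w"
      using s ind4_swap by (simp add: split_basis_def mul_simps)
    moreover have "(n + w) \<odot> (n + w) = (2 * r) \<star> (e - c)"
      using r p q 3 comm[of w n] scale_left_distrib[of r r "e - c"] by (simp add: mul_simps)
    moreover have "(n + w) \<odot> w = r \<star> (e - c)"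
      using r q 3 by (simp add: mul_simps)
    ultimately show ?thesis
      using split_basis_anisotropic[of c "n + w" w r "2 * r" q] q 3 by auto
  next
    case 4
    then show ?thesis using split_basis_isomorphic[of c n w 0 0 J4_3] s p q r by simp
  qed
qed

end

section \<open>Peirce multiplication and the case of a direct factor\<close>

context jordan4
begin

text \<open>The linearised identity at \<open>c\<close> collapses to \<open>(1 - 2 * i) \<star> (c
  \<odot> (z \<odot> y) - j \<star> (z \<odot> y)) = 0\<close>. Hence multiplying by an element of
  the 0- or 1-component preserves every eigenspace of \<open>c\<close>.\<close>

lemma peirce_product:
  assumes "c \<odot> c = c" "c \<odot> z = i \<star> z" "c \<odot> y = j \<star> y" "i \<noteq> 1 / 2"
  shows "c \<odot> (z \<odot> y) = j \<star> (z \<odot> y)"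
proof -
  define p where "p = z \<odot> y"
  have "(2 * i * j) \<star> p + c \<odot> p = (2 * i) \<star> (c \<odot> p) + j \<star> p"
    using jordan_linear[of c z y] unfolding assms(1-3) by (simp add: mul_simps p_def ac_simps)
  then have "(1 - 2 * i) \<star> (c \<odot> p - j \<star> p) = 0"
    by (simp add: algebra_simps)
  moreover have "1 - 2 * i \<noteq> 0"
    using assms(4) by (metis eq_divide_eq_numeral1(1) mult.commute right_minus_eq zero_neq_numeral)
  ultimately show ?thesis by (simp add: p_def)
qed

text \<open>Otherwise \<open>e - c\<close>, \<open>n\<close> and \<open>n \<odot> n\<close> span the
  0-component, in which \<open>n\<close> satisfies a cubic. For \<open>k\<close> not among its
  roots, \<open>k \<star> c + n\<close> has four independent powers, against rank 3.\<close>

lemma split_basis_square: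
  assumes cubic: cubic_algebra and s: "split_basis c n w"
  shows "\<exists>p q. n \<odot> n = p \<star> (e - c) + q \<star> n"
proof -
  let ?f = "e - c"
  have c: "c \<odot> c = c" "c \<odot> n = 0" "c \<odot> w = 0" and i: "ind4 sc c ?f n w"
    using s by (simp_all add: split_basis_def)
  note f = split_basis_products[OF s]
  have c0: "c \<noteq> 0" using i unfolding ind4_def by (metis scale_zero_right add.right_neutral zero_neq_one scale_zero_left)
  have p0: "c \<odot> (z \<odot> y) = 0" if "c \<odot> z = 0" "c \<odot> y = 0" for z y
    using peirce_product[of c z 0 y 0] c that by simp
  obtain a b p q where n2: "n \<odot> n = a \<star> c + b \<star> ?f + p \<star> n + q \<star> w"
    using ind4_spans[OF i] by blast
  have "c \<odot> (n \<odot> n) = a \<star> c" unfolding n2 by (simp add: add_right scale_right c f)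
  then have "a = 0" using p0[of n n] c c0 by simp
  show ?thesis
  proof (cases "q = 0")
    case True
    then show ?thesis using n2 \<open>a = 0\<close> by auto
  next
    case False
    then have i': "ind4 sc c ?f n (n \<odot> n)"
      using ind4_combine[OF i False, of 1 0 0 a b p] n2 by simp
    obtain t x y z where n3: "n \<odot> (n \<odot> n) = t \<star> c + x \<star> ?f + y \<star> n + z \<star> (n \<odot> n)"
      using ind4_spans[OF i'] by blast
    have cnn: "c \<odot> (n \<odot> n) = 0" using p0 c by simp
    have "c \<odot> (n \<odot> (n \<odot> n)) = t \<star> c" unfolding n3 by (simp add: add_right scale_right c f cnn)
    then have "t = 0" using p0[of n "n \<odot> n"] c c0 cnn by simp
    have "[:-x, -y, -z, 1:] \<noteq> 0" by simp
    then have "finite {k. poly [:-x, -y, -z, 1:] k = 0}" by (rule poly_roots_finite)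
    then obtain k where "k \<notin> {k. poly [:-x, -y, -z, 1:] k = 0}"
      using ex_new_if_finite[OF infinite_UNIV_char_0] by metis
    then have k: "k ^ 3 - z * k\<^sup>2 - y * k - x \<noteq> 0"
      by (simp add: algebra_simps power2_eq_square power3_eq_cube)
    define u where "u = k \<star> c + n"
    have u2: "u \<odot> u = (k\<^sup>2) \<star> c + n \<odot> n"
      unfolding u_def using c comm[of n c] by (simp add: mul_simps power2_eq_square)
    have u3: "u \<odot> (u \<odot> u) = (k ^ 3) \<star> c + n \<odot> (n \<odot> n)"
      unfolding u2 unfolding u_def using c cnn comm[of n c] by (simp add: mul_simps power2_eq_square power3_eq_cube)
    have "ind4 sc e u (u \<odot> u) (u \<odot> (u \<odot> u))"
      unfolding ind4_def
    proof (intro allI impI)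
      fix \<alpha> \<beta> \<gamma> \<delta>
      assume "\<alpha> \<star> e + \<beta> \<star> u + \<gamma> \<star> (u \<odot> u) + \<delta> \<star> (u \<odot> (u \<odot> u)) = 0"
      then have "(\<alpha> + \<beta> * k + \<gamma> * k\<^sup>2 + \<delta> * k ^ 3) \<star> c + (\<alpha> + \<delta> * x) \<star> ?f + (\<beta> + \<delta> * y) \<star> n + (\<gamma> + \<delta> * z) \<star> (n \<odot> n) = 0"
        unfolding u3 unfolding u2 unfolding n3 \<open>t = 0\<close> u_def by (simp add: algebra_simps)
      then have eq: "\<alpha> + \<beta> * k + \<gamma> * k\<^sup>2 + \<delta> * k ^ 3 = 0" "\<alpha> + \<delta> * x = 0" "\<beta> + \<delta> * y = 0" "\<gamma> + \<delta> * z = 0"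
        using i' unfolding ind4_def by blast+
      then have "\<delta> * (k ^ 3 - z * k\<^sup>2 - y * k - x) = 0" by algebra
      then have "\<delta> = 0" using k by simp
      then show "\<alpha> = 0 \<and> \<beta> = 0 \<and> \<gamma> = 0 \<and> \<delta> = 0" using eq by simp
    qed
    then show ?thesis using cubic unfolding cubic_algebra_def by blast
  qed
qed

text \<open>Completing the square in the quadratic equations of \<open>n\<close> and
  \<open>w\<close>.\<close>

lemma split_basis_traceless:
  assumes "cubic_algebra" "split_basis c n w"
  obtains n' w' p q where "split_basis c n' w'" "n' \<odot> n' = p \<star> (e - c)" "w' \<odot> w' = q \<star> (e - c)"
proof -
  let ?f = "e - c"
  have sh: "\<exists>t p. (n - t \<star> ?f) \<odot> (n - t \<star> ?f) = p \<star> ?f" if s: "split_basis c n w" for n w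
  proof -
    note f = split_basis_products[OF s]
    obtain p q where n2: "n \<odot> n = p \<star> ?f + q \<star> n"
      using split_basis_square[OF assms(1) s] by blast
    have "(n - (q / 2) \<star> ?f) \<odot> (n - (q / 2) \<star> ?f) = n \<odot> n - (q / 2) \<star> n - (q / 2) \<star> n + (q / 2 * (q / 2)) \<star> ?f"
      using f comm[of n ?f] by (simp only: mul_simps) (simp add: algebra_simps)
    also have "\<dots> = (p + q / 2 * (q / 2)) \<star> ?f + (q - q / 2 - q / 2) \<star> n"
      unfolding n2 scale_left_diff_distrib scale_left_distrib by simp
    finally show ?thesis by auto
  qed
  obtain t p where t: "(n - t \<star> ?f) \<odot> (n - t \<star> ?f) = p \<star> ?f" using sh assms(2) by blast
  have "split_basis c w n" using assms(2) ind4_swap by (simp add: split_basis_def)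
  then obtain t' q where t': "(w - t' \<star> ?f) \<odot> (w - t' \<star> ?f) = q \<star> ?f" using sh by blast
  have "ind4 sc c ?f (n - t \<star> ?f) (w - t' \<star> ?f)"
    using ind4_combine[of c ?f n w 1 1 0 "- t" 0 "- t'" 0] assms(2)
    by (simp add: split_basis_def algebra_simps)
  then have "split_basis c (n - t \<star> ?f) (w - t' \<star> ?f)"
    using assms(2) split_basis_products(1)[OF assms(2)]
    by (simp add: split_basis_def add_right diff_right scale_right)
  then show thesis using that t t' by blast
qed

text \<open>Polarisation: the squares of \<open>n + w\<close> and \<open>n - w\<close> both
  determine twice \<open>n \<odot> w\<close>, and comparing their coefficients at \<open>n\<close>
  and \<open>w\<close> leaves only a multiple of \<open>e - c\<close>. The 0-component is thus
  described by a quadratic form.\<close>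

lemma split_basis_classification:
  assumes cubic: cubic_algebra and "split_basis c n w"
  shows "isomorphic A J4_1 \<or> isomorphic A J4_2 \<or> isomorphic A J4_3"
proof -
  let ?f = "e - c"
  obtain n w p q where s: "split_basis c n w" and p: "n \<odot> n = p \<star> ?f" and q: "w \<odot> w = q \<star> ?f"
    using split_basis_traceless[OF assms] by metis
  have i: "ind4 sc c ?f n w" and c: "c \<odot> n = 0" "c \<odot> w = 0" "c \<odot> c = c"
    using s by (simp_all add: split_basis_def)
  have "ind4 sc c ?f (n + w) w"
    using ind4_swap[OF ind4_combine[OF ind4_swap[OF i], of 1 1 0 0 0 0 1]] by (simp add: add.commute)
  then have "split_basis c (n + w) w"
    using c by (simp add: split_basis_def add_right)
  then obtain x y where xy: "(n + w) \<odot> (n + w) = x \<star> ?f + y \<star> (n + w)"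
    using split_basis_square[OF cubic] by blast
  have "ind4 sc c ?f (n - w) w"
    using ind4_swap[OF ind4_combine[OF ind4_swap[OF i], of 1 1 0 0 0 0 "-1"]] by (simp add: algebra_simps)
  then have "split_basis c (n - w) w"
    using c by (simp add: split_basis_def diff_right)
  then obtain x' y' where xy': "(n - w) \<odot> (n - w) = x' \<star> ?f + y' \<star> (n - w)"
    using split_basis_square[OF cubic] by blast
  define m where "m = n \<odot> w"
  have 1: "m + m = (x - p - q) \<star> ?f + y \<star> n + y \<star> w"
    using xy p q comm[of w n] unfolding m_def by (simp add: mul_simps algebra_simps)
  have 2: "m + m = (p + q - x') \<star> ?f - y' \<star> n + y' \<star> w"
    using xy' p q comm[of w n] unfolding m_def by (simp add: mul_simps algebra_simps)
  have "0 \<star> c + (x - p - q) \<star> ?f + y \<star> n + y \<star> w = 0 \<star> c + (p + q - x') \<star> ?f + (- y') \<star> n + y' \<star> w"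
    using 1 2 by (simp add: algebra_simps)
  then have "y = - y'" "y = y'"
    unfolding ind4_eq[OF i] by blast+
  then have "y = 0" by (simp add: eq_neg_iff_add_eq_0)
  have "m + m = 2 \<star> m" using scale_left_distrib[of 1 1 m] by simp
  then have "2 \<star> m = (x - p - q) \<star> ?f" using 1 \<open>y = 0\<close> by simp
  then have "(1/2) \<star> (2 \<star> m) = (1/2) \<star> ((x - p - q) \<star> ?f)" by simp
  then have "n \<odot> w = ((x - p - q) / 2) \<star> ?f" unfolding m_def by simp
  then show ?thesis using split_basis_normal_form[OF s _ p q] by blast
qed

end

context jordan4
begin

subsection \<open>An element whose cubic has a simple root\<close>

text \<open>The Peirce rule that squares from the 1/2-component lie in the sum of the 0- and
  1-components: \<open>c\<close> acts on them as a projection.\<close>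

lemma peirce_half_square:
  assumes "c \<odot> c = c" "c \<odot> w = (1/2) \<star> w"
  shows "c \<odot> (c \<odot> (w \<odot> w)) = c \<odot> (w \<odot> w)"
proof -
  define p where "p = w \<odot> w"
  have "(1/2) \<star> p + c \<odot> p = (1/2) \<star> p + c \<odot> (c \<odot> p)"
    using jordan_linear[of w c c] assms comm[of w c] comm[of "w \<odot> w" c]
    by (simp add: mul_simps p_def[symmetric])
  then show ?thesis by (simp add: p_def)
qed

text \<open>\<open>c\<close> takes the place of \<open>e\<^sub>2\<close>, \<open>e - c\<close> that
  of \<open>e\<^sub>1\<close>, \<open>w\<close> that of \<open>a\<close> and a multiple of
  \<open>n\<close> that of \<open>b\<close>. What has to be shown is that \<open>w \<odot> w\<close>
  is a multiple of \<open>n\<close>; whether it vanishes separates the two algebras.\<close>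

lemma simple_root_nilpotent:
  assumes "c \<odot> c = c" "ind4 sc c (e - c) n w" "c \<odot> n = 0" "c \<odot> w = (1/2) \<star> w"
    and "n \<odot> n = 0" "n \<odot> w = 0" "w \<odot> w = \<alpha> \<star> c + \<beta> \<star> (e - c) + \<gamma> \<star> n"
  shows "isomorphic A J4_4 \<or> isomorphic A J4_5"
proof -
  define f where "f = e - c"
  note i = assms(2)[folded f_def] and c = assms(1,3,4) and w2 = assms(7)[folded f_def]
  have f: "c \<odot> f = 0" "f \<odot> f = f" "f \<odot> n = n" "f \<odot> w = (1/2) \<star> w" "n \<odot> f = n" "f \<odot> c = 0"
    using c comm[of n c] scale_left_distrib[of "1/2" "1/2" w] unfolding f_def
    by (simp_all add: mul_simps algebra_simps)
  have w3: "w \<odot> (w \<odot> w) = ((\<alpha> + \<beta>) / 2) \<star> w"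
    unfolding w2 using c f(4) assms(6) comm[of w c] comm[of w f] comm[of w n]
    by (simp add: mul_simps add_divide_distrib scale_left_distrib)
  have "(w \<odot> w) \<odot> (w \<odot> w) = (\<alpha> * \<alpha>) \<star> c + (\<beta> * \<beta>) \<star> f + (2 * \<beta> * \<gamma>) \<star> n"
    unfolding w2 using c f(1-3,5,6) assms(5) comm[of n c] scale_left_distrib[of "\<beta> * \<gamma>" "\<beta> * \<gamma>" n]
    by (simp add: mul_simps algebra_simps)
  moreover have "w \<odot> (w \<odot> (w \<odot> w)) = ((\<alpha> + \<beta>) / 2 * \<alpha>) \<star> c + ((\<alpha> + \<beta>) / 2 * \<beta>) \<star> f + ((\<alpha> + \<beta>) / 2 * \<gamma>) \<star> n"
    unfolding w3 unfolding scale_right w2 by (simp only: scale_right_distrib scale_scale)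
  \<comment> \<open>The fourth power of \<open>w\<close> in two ways; the coefficients give
    \<open>\<alpha> = \<beta>\<close>.\<close>
  ultimately have "(\<alpha> * \<alpha>) \<star> c + (\<beta> * \<beta>) \<star> f + (2 * \<beta> * \<gamma>) \<star> n + 0 \<star> w
    = ((\<alpha> + \<beta>) / 2 * \<alpha>) \<star> c + ((\<alpha> + \<beta>) / 2 * \<beta>) \<star> f + ((\<alpha> + \<beta>) / 2 * \<gamma>) \<star> n + 0 \<star> w"
    using square_square[of w] by simp
  then have eq: "\<alpha> * \<alpha> = (\<alpha> + \<beta>) / 2 * \<alpha>" "\<beta> * \<beta> = (\<alpha> + \<beta>) / 2 * \<beta>"
    unfolding ind4_eq[OF i] by blast+
  have "(\<alpha> - \<beta>) * (\<alpha> - \<beta>) = 0"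
    using eq by algebra
  then have ab: "\<alpha> = \<beta>" by simp
  have sq: "(c + w) \<odot> (c + w) = c + w + w \<odot> w"
    using c comm[of w c] scale_left_distrib[of "1/2" "1/2" w] by (simp add: mul_simps algebra_simps)
  have w2w: "(w \<odot> w) \<odot> w = \<beta> \<star> w"
    using w3 comm[of w "w \<odot> w"] ab by simp
  have nw2: "n \<odot> (w \<odot> w) = \<beta> \<star> n"
    unfolding w2 using assms(5) c f comm[of n c] by (simp add: mul_simps)
  \<comment> \<open>Since \<open>n\<close> annihilates both \<open>c + w\<close> and
    \<open>w\<close>, the linearised identity makes this product vanish, while computed directly it
    is \<open>\<beta> \<star> n\<close>.\<close>
  have "n \<odot> (((c + w) \<odot> (c + w)) \<odot> w) = \<beta> \<star> n"
    unfolding sq using c w2w nw2 assms(6) by (simp add: mul_simps)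
  moreover have "n \<odot> (((c + w) \<odot> (c + w)) \<odot> w) = 0"
    using jordan_linear[of "c + w" n w] assms(6) c comm[of w n] by (simp add: mul_simps)
  ultimately have "\<beta> = 0"
    using i unfolding ind4_def by (metis add.right_neutral scale_eq_0_iff scale_zero_right zero_neq_one scale_zero_left)
  then have w2: "w \<odot> w = \<gamma> \<star> n" using w2 ab by simp
  show ?thesis
  proof (cases "\<gamma> = 0")
    case True
    have j: "jordan4 J4_5" "ind4 (scl J4_5) (bas 4) (bas 1) (bas 2) (bas 3)"
      using jordan4_J4_4567 by (auto simp: ind4_def scl_J4_4567 coordinate_simps)
    have "isomorphic A J4_5"
    proof (rule isomorphic_by_basis[OF jordan4_axioms j(1) i j(2)])
      fix g assume g: "Vector_Spaces.linear sc (scl J4_5) g" "g c = bas 4" "g f = bas 1" "g n = bas 2" "g w = bas 3"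
      interpret g: Vector_Spaces.linear sc "scl J4_5" g by fact
      show "g (c \<odot> c) = prd J4_5 (bas 4) (bas 4) \<and> g (c \<odot> f) = prd J4_5 (bas 4) (bas 1) \<and>
        g (c \<odot> n) = prd J4_5 (bas 4) (bas 2) \<and> g (c \<odot> w) = prd J4_5 (bas 4) (bas 3) \<and>
        g (f \<odot> f) = prd J4_5 (bas 1) (bas 1) \<and> g (f \<odot> n) = prd J4_5 (bas 1) (bas 2) \<and>
        g (f \<odot> w) = prd J4_5 (bas 1) (bas 3) \<and> g (n \<odot> n) = prd J4_5 (bas 2) (bas 2) \<and>
        g (n \<odot> w) = prd J4_5 (bas 2) (bas 3) \<and> g (w \<odot> w) = prd J4_5 (bas 3) (bas 3)"
        unfolding c f(1-4) assms(5,6) w2 True g.zero g.scale g(2-5)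
        by (simp add: prd_J4_5 scl_J4_4567 coordinate_simps)
    qed
    then show ?thesis ..
  next
    case False
    have i': "ind4 sc c f (\<gamma> \<star> n) w"
      using ind4_combine[OF i, of 1 \<gamma> 0 0 0 0 0] False by simp
    have j: "jordan4 J4_4" "ind4 (scl J4_4) (bas 4) (bas 1) (bas 2) (bas 3)"
      using jordan4_J4_4567 by (auto simp: ind4_def scl_J4_4567 coordinate_simps)
    have "isomorphic A J4_4"
    proof (rule isomorphic_by_basis[OF jordan4_axioms j(1) i' j(2)])
      fix g assume g: "Vector_Spaces.linear sc (scl J4_4) g" "g c = bas 4" "g f = bas 1"
        "g (\<gamma> \<star> n) = bas 2" "g w = bas 3"
      interpret g: Vector_Spaces.linear sc "scl J4_4" g by fact
      show "g (c \<odot> c) = prd J4_4 (bas 4) (bas 4) \<and> g (c \<odot> f) = prd J4_4 (bas 4) (bas 1) \<and>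
        g (c \<odot> (\<gamma> \<star> n)) = prd J4_4 (bas 4) (bas 2) \<and> g (c \<odot> w) = prd J4_4 (bas 4) (bas 3) \<and>
        g (f \<odot> f) = prd J4_4 (bas 1) (bas 1) \<and> g (f \<odot> (\<gamma> \<star> n)) = prd J4_4 (bas 1) (bas 2) \<and>
        g (f \<odot> w) = prd J4_4 (bas 1) (bas 3) \<and> g ((\<gamma> \<star> n) \<odot> (\<gamma> \<star> n)) = prd J4_4 (bas 2) (bas 2) \<and>
        g ((\<gamma> \<star> n) \<odot> w) = prd J4_4 (bas 2) (bas 3) \<and> g (w \<odot> w) = prd J4_4 (bas 3) (bas 3)"
        unfolding scale_left scale_right[of _ \<gamma>] c f(1-4) assms(5,6) w2 scale_zero_right g.zero g(2-4) g.scale[of "1/2"] g(5)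
        by (simp add: prd_J4_4 scl_J4_4567 coordinate_simps)
    qed
    then show ?thesis ..
  qed
qed

lemma simple_root_half:
  assumes cubic: cubic_algebra and cc: "c \<odot> c = c" and i: "ind4 sc c (e - c) n w"
    and cn: "c \<odot> n = 0" and cw: "c \<odot> w = (1/2) \<star> w" and n2: "n \<odot> n = p \<star> (e - c)"
  shows "isomorphic A J4_1 \<or> isomorphic A J4_2 \<or> isomorphic A J4_3 \<or> isomorphic A J4_4 \<or> isomorphic A J4_5"
proof -
  define f where "f = e - c"
  note i = i[folded f_def] and n2 = n2[folded f_def]
  have e_eq: "e = c + f" by (simp add: f_def)
  have f: "c \<odot> f = 0" "f \<odot> f = f" "f \<odot> n = n" "f \<odot> w = (1/2) \<star> w" "n \<odot> f = n" "f \<odot> c = 0"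
    using cc cn cw comm[of n c] scale_left_distrib[of "1/2" "1/2" w] unfolding f_def
    by (simp_all add: mul_simps algebra_simps)
  obtain a b d \<mu> where nw: "n \<odot> w = a \<star> c + b \<star> f + d \<star> n + \<mu> \<star> w"
    using ind4_spans[OF i] by blast
  have "c \<odot> (n \<odot> w) = (1/2) \<star> (n \<odot> w)"
    using peirce_product[of c n 0 w "1/2"] cc cn cw by simp
  then have "a \<star> c + 0 \<star> f + 0 \<star> n + (\<mu> / 2) \<star> w = (a / 2) \<star> c + (b / 2) \<star> f + (d / 2) \<star> n + (\<mu> / 2) \<star> w"
    unfolding nw by (simp only: add_right scale_right cc cn cw f) (simp add: scale_right_distrib)
  then have "a = a / 2" "0 = b / 2" "0 = d / 2"
    unfolding ind4_eq[OF i] by blast+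
  then have nw: "n \<odot> w = \<mu> \<star> w" using nw by simp
  obtain \<alpha> \<beta> \<gamma> \<delta> where w2: "w \<odot> w = \<alpha> \<star> c + \<beta> \<star> f + \<gamma> \<star> n + \<delta> \<star> w"
    using ind4_spans[OF i] by blast
  have cw2: "c \<odot> (w \<odot> w) = \<alpha> \<star> c + (\<delta> / 2) \<star> w"
    unfolding w2 by (simp only: add_right scale_right cc cn cw f) simp
  have "c \<odot> (c \<odot> (w \<odot> w)) = c \<odot> (w \<odot> w)"
    by (rule peirce_half_square[OF cc cw])
  then have "\<alpha> \<star> c + 0 \<star> f + 0 \<star> n + (\<delta> / 2 / 2) \<star> w = \<alpha> \<star> c + 0 \<star> f + 0 \<star> n + (\<delta> / 2) \<star> w"
    unfolding cw2 by (simp only: add_right scale_right cc cw) simp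
  then have "\<delta> / 2 / 2 = \<delta> / 2"
    unfolding ind4_eq[OF i] by blast
  then have w2: "w \<odot> w = \<alpha> \<star> c + \<beta> \<star> f + \<gamma> \<star> n"
    using w2 by simp
  have w0: "w \<noteq> 0"
    using i unfolding ind4_def by (metis add.right_neutral scale_zero_right zero_neq_one scale_zero_left)
  \<comment> \<open>Both sides are multiples of \<open>w\<close>, which ties the square of
    \<open>n\<close> to its eigenvalue \<open>\<mu>\<close> on \<open>w\<close>.\<close>
  have "2 \<star> ((n \<odot> w) \<odot> (n \<odot> f)) + (n \<odot> n) \<odot> (w \<odot> f) = 2 \<star> (n \<odot> ((n \<odot> w) \<odot> f)) + w \<odot> ((n \<odot> n) \<odot> f)"
    by (rule jordan_linear)
  then have "(2 * \<mu> * \<mu> + p / 4) \<star> w = (\<mu> * \<mu> + p / 2) \<star> w"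
    using comm[of w f] comm[of w n] f nw unfolding n2
    by (simp add: mul_simps scale_left_distrib ac_simps)
  then have p: "p = 4 * \<mu> * \<mu>"
    using w0 by (simp add: field_simps)
  show ?thesis
  proof (cases "p = 0")
    case True
    then have "\<mu> = 0" using p by simp
    then have "isomorphic A J4_4 \<or> isomorphic A J4_5"
      using simple_root_nilpotent[OF cc i[unfolded f_def] cn cw _ _ w2[unfolded f_def]] n2 nw True by simp
    then show ?thesis by blast
  next
    case False
    then have \<mu>: "\<mu> \<noteq> 0" using p by simp
    \<comment> \<open>Since \<open>(1 / (2 * \<mu>)) \<star> n\<close> squares to \<open>f\<close>,
      the idempotent \<open>f\<close> is a sum of two idempotents. This is the one annihilating
      \<open>w\<close>; it also annihilates \<open>c\<close>, so both lie in its
      0-component.\<close>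
    define g where "g = (1/2) \<star> f - (1 / (4 * \<mu>)) \<star> n"
    have gg: "g \<odot> g = g"
    proof -
      have "g \<odot> g = (1/4 + 1 / (4 * \<mu>) * (1 / (4 * \<mu>)) * p) \<star> f - (1 / (8 * \<mu>) + 1 / (8 * \<mu>)) \<star> n"
        unfolding g_def using f n2 by (simp add: mul_simps algebra_simps collect_scale)
      also have "1/4 + 1 / (4 * \<mu>) * (1 / (4 * \<mu>)) * p = 1/2"
        using \<mu> unfolding p by (simp add: field_simps)
      also have "1 / (8 * \<mu>) + 1 / (8 * \<mu>) = 1 / (4 * \<mu>)"
        by simp
      finally show ?thesis unfolding g_def .
    qed
    have gc: "g \<odot> c = 0" and gw: "g \<odot> w = 0"
      unfolding g_def using f nw \<mu> cn comm[of n c] by (simp_all only: mul_simps) simp_all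
    have eg: "e - g = c + (1/2) \<star> f + (1 / (4 * \<mu>)) \<star> n"
      using scale_left_distrib[of "1/2" "1/2" f] unfolding g_def e_eq by (simp add: algebra_simps)
    have "ind4 sc g (e - g) c w"
      unfolding ind4_def
    proof (intro allI impI)
      fix x y z t
      assume "x \<star> g + y \<star> (e - g) + z \<star> c + t \<star> w = 0"
      then have "(y + z) \<star> c + (x / 2 + y / 2) \<star> f + ((y - x) / (4 * \<mu>)) \<star> n + t \<star> w = 0"
        unfolding eg unfolding g_def by (simp add: algebra_simps diff_divide_distrib)
      then have "y + z = 0" "x / 2 + y / 2 = 0" "(y - x) / (4 * \<mu>) = 0" "t = 0"
        using i unfolding ind4_def by blast+
      then show "x = 0 \<and> y = 0 \<and> z = 0 \<and> t = 0"
        using \<mu> by auto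
    qed
    then have "split_basis g c w"
      unfolding split_basis_def using gg gc gw by simp
    then show ?thesis using split_basis_classification[OF cubic] by blast
  qed
qed

text \<open>Here the algebra would be a product of two quadratic algebras, and such a product has
  rank 4.\<close>

lemma simple_root_one:
  assumes cubic: cubic_algebra and cc: "c \<odot> c = c" and i: "ind4 sc c (e - c) n w"
    and cn: "c \<odot> n = 0" and cw: "c \<odot> w = w" and n2: "n \<odot> n = p \<star> (e - c)"
  shows False
proof -
  define f where "f = e - c"
  note i = i[folded f_def] and n2 = n2[folded f_def]
  have e_eq: "e = c + f" by (simp add: f_def)
  have f: "c \<odot> f = 0" "f \<odot> f = f" "f \<odot> n = n" "f \<odot> w = 0" "n \<odot> f = n" "f \<odot> c = 0"
    using cc cn cw comm[of n c] unfolding f_def by (simp_all add: mul_simps)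
  obtain \<xi> b d \<eta> where w2: "w \<odot> w = \<xi> \<star> c + b \<star> f + d \<star> n + \<eta> \<star> w"
    using ind4_spans[OF i] by blast
  have "c \<odot> (w \<odot> w) = w \<odot> w"
    using peirce_product[of c w 1 w 1] cc cw by simp
  then have "\<xi> \<star> c + 0 \<star> f + 0 \<star> n + \<eta> \<star> w = \<xi> \<star> c + b \<star> f + d \<star> n + \<eta> \<star> w"
    unfolding w2 by (simp add: add_right scale_right cc cn cw f)
  then have "0 = b" "0 = d"
    unfolding ind4_eq[OF i] by blast+
  then have w2: "w \<odot> w = \<xi> \<star> c + \<eta> \<star> w" using w2 by simp
  have "c \<odot> (n \<odot> w) = n \<odot> w" "c \<odot> (w \<odot> n) = 0"
    using peirce_product[of c n 0 w 1] peirce_product[of c w 1 n 0] cc cw cn by simp_all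
  then have nw: "n \<odot> w = 0" "w \<odot> n = 0" using comm[of n w] by simp_all
  define v where "v = w - (\<eta> / 2) \<star> c"
  define \<zeta> where "\<zeta> = \<xi> + \<eta> / 2 * (\<eta> / 2)"
  have v: "c \<odot> v = v" "v \<odot> c = v" "n \<odot> v = 0" "v \<odot> n = 0" "f \<odot> v = 0" "v \<odot> f = 0" 
    unfolding v_def using cc cw cn nw f comm[of w c] comm[of n c] comm[of w f] by (simp_all add: mul_simps)
  have "v \<odot> v = w \<odot> w - (\<eta> / 2) \<star> w - (\<eta> / 2) \<star> w + (\<eta> / 2 * (\<eta> / 2)) \<star> c"
    unfolding v_def using cw cc comm[of w c] by (simp only: mul_simps) (simp add: algebra_simps)
  also have "\<dots> = \<zeta> \<star> c + (\<eta> - \<eta> / 2 - \<eta> / 2) \<star> w"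
    unfolding w2 \<zeta>_def by (simp only: scale_left_distrib scale_left_diff_distrib) simp
  finally have v2: "v \<odot> v = \<zeta> \<star> c" by simp
  have i: "ind4 sc c f n v"
    using ind4_combine[OF i, of 1 1 0 0 "- \<eta> / 2" 0 0] by (simp add: v_def algebra_simps)
  \<comment> \<open>The resultant of \<open>X\<^sup>2 - p\<close> and
    \<open>(X - k)\<^sup>2 - \<zeta>\<close>, the equations of \<open>n\<close> and
    \<open>k \<star> c + v\<close> in the two components. Where it is nonzero the equations have no
    common root and the sum has four independent powers. It cannot vanish for all
    \<open>k\<close>.\<close>
  have det: "k ^ 4 - 2 * (p + \<zeta>) * k\<^sup>2 + (p - \<zeta>)\<^sup>2 = 0" for k
  proof (rule ccontr)
    assume D: "k ^ 4 - 2 * (p + \<zeta>) * k\<^sup>2 + (p - \<zeta>)\<^sup>2 \<noteq> 0"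
    define u where "u = k \<star> c + v + n"
    have u2: "u \<odot> u = (k\<^sup>2 + \<zeta>) \<star> c + p \<star> f + (2 * k) \<star> v"
      unfolding u_def using v v2 n2 cc cn comm[of n c] scale_left_distrib[of k k v]
      by (simp add: mul_simps power2_eq_square algebra_simps)
    have u3: "u \<odot> (u \<odot> u) = (k ^ 3 + 3 * k * \<zeta>) \<star> c + p \<star> n + (3 * k\<^sup>2 + \<zeta>) \<star> v"
    proof -
      have h: "(\<zeta> * k) \<star> c + (\<zeta> * (k * 2)) \<star> c = (\<zeta> * (k * 3)) \<star> c"
        unfolding scale_left_distrib[symmetric] by (rule arg_cong[of _ _ "\<lambda>t. t \<star> c"]) algebra
      have "u \<odot> (u \<odot> u) = (k * (k\<^sup>2 + \<zeta>) + 2 * k * \<zeta>) \<star> c + p \<star> n + (k * (2 * k) + (k\<^sup>2 + \<zeta>)) \<star> v"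
        unfolding u2 unfolding u_def using v v2 n2 cc cn comm[of n c] f
        by (simp add: mul_simps algebra_simps h)
      moreover have "k * (k\<^sup>2 + \<zeta>) + 2 * k * \<zeta> = k ^ 3 + 3 * k * \<zeta>" "k * (2 * k) + (k\<^sup>2 + \<zeta>) = 3 * k\<^sup>2 + \<zeta>"
        by algebra+
      ultimately show ?thesis by simp
    qed
    have "ind4 sc e u (u \<odot> u) (u \<odot> (u \<odot> u))"
      unfolding ind4_def
    proof (intro allI impI)
      fix x y z t
      assume "x \<star> e + y \<star> u + z \<star> (u \<odot> u) + t \<star> (u \<odot> (u \<odot> u)) = 0"
      then have "(x + y * k + z * (k\<^sup>2 + \<zeta>) + t * (k ^ 3 + 3 * k * \<zeta>)) \<star> c + (x + z * p) \<star> f + (y + t * p) \<star> n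
        + (y + z * (2 * k) + t * (3 * k\<^sup>2 + \<zeta>)) \<star> v = 0"
        unfolding u3 unfolding u2 unfolding u_def e_eq by (simp add: algebra_simps)
      then have eq: "x + y * k + z * (k\<^sup>2 + \<zeta>) + t * (k ^ 3 + 3 * k * \<zeta>) = 0" "x + z * p = 0"
        "y + t * p = 0" "y + z * (2 * k) + t * (3 * k\<^sup>2 + \<zeta>) = 0"
        using i unfolding ind4_def by blast+
      have "z * (k ^ 4 - 2 * (p + \<zeta>) * k\<^sup>2 + (p - \<zeta>)\<^sup>2) = 0"
        "t * (k ^ 4 - 2 * (p + \<zeta>) * k\<^sup>2 + (p - \<zeta>)\<^sup>2) = 0"
        using eq by algebra+
      then have "z = 0" "t = 0" using D by simp_all
      then show "x = 0 \<and> y = 0 \<and> z = 0 \<and> t = 0" using eq by simp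
    qed
    then show False using cubic unfolding cubic_algebra_def by blast
  qed
  have "p - \<zeta> = 0" using det[of 0] by simp
  then have pz: "\<zeta> = p" by simp
  have "1 - 4 * p = 0" "4 - 4 * p = 0"
    using det[of 1] det[of 2] unfolding pz by (simp_all add: algebra_simps)
  then show False by simp
qed

end

context jordan4
begin

lemma cyclic_cube:
  assumes cubic_algebra "cyclic y"
  shows "\<exists>p q r. y \<odot> (y \<odot> y) = p \<star> (y \<odot> y) + q \<star> y + r \<star> e"
proof -
  have "y \<odot> (y \<odot> y) \<in> span {e, y, y \<odot> y}"
    using assms ind3_ex_ind4 unfolding cubic_algebra_def cyclic_def by blast
  then show ?thesis
    unfolding span_insert span_empty
    by (auto simp: eq_diff_eq algebra_simps)
qed

lemma cyclic_shift:
  assumes "cyclic y"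
  shows "cyclic (y - t \<star> e)"
  unfolding cyclic_def ind3_def
proof (intro allI impI)
  fix a b c
  assume "a \<star> e + b \<star> (y - t \<star> e) + c \<star> ((y - t \<star> e) \<odot> (y - t \<star> e)) = 0"
  then have "(a - b * t + c * (t * t)) \<star> e + (b - c * t - c * t) \<star> y + c \<star> (y \<odot> y) = 0"
    by (simp add: mul_simps algebra_simps collect_scale)
  then have "a - b * t + c * (t * t) = 0" "b - c * t - c * t = 0" "c = 0"
    using assms unfolding cyclic_def ind3_def by blast+
  then show "a = 0 \<and> b = 0 \<and> c = 0" by simp
qed

text \<open>Shifting a root to 0 removes the constant term. That 0 is a simple root then means
  \<open>q \<noteq> 0\<close>.\<close>

lemma cyclic_root:
  assumes cubic_algebra "cyclic y"
  shows "\<exists>\<theta> p q. (y - \<theta> \<star> e) \<odot> ((y - \<theta> \<star> e) \<odot> (y - \<theta> \<star> e)) =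
    p \<star> ((y - \<theta> \<star> e) \<odot> (y - \<theta> \<star> e)) + q \<star> (y - \<theta> \<star> e)"
proof -
  obtain p q r where y3: "y \<odot> (y \<odot> y) = p \<star> (y \<odot> y) + q \<star> y + r \<star> e"
    using cyclic_cube[OF assms] by blast
  have "\<not> constant (poly [:-r, -q, -p, 1:])"
    by (subst constant_degree) simp
  then obtain \<theta> where \<theta>: "poly [:-r, -q, -p, 1:] \<theta> = 0"
    using fundamental_theorem_of_algebra by blast
  then have r: "r = \<theta> * \<theta> * \<theta> - p * \<theta> * \<theta> - q * \<theta>"
    by (simp add: algebra_simps)
  define z where "z = y - \<theta> \<star> e"
  have y: "y = z + \<theta> \<star> e" by (simp add: z_def)
  have "z \<odot> (z \<odot> z) + (3 * \<theta>) \<star> (z \<odot> z) + (3 * \<theta> * \<theta>) \<star> z + (\<theta> * \<theta> * \<theta>) \<star> e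
    = p \<star> (z \<odot> z) + (2 * p * \<theta>) \<star> z + (p * \<theta> * \<theta>) \<star> e + q \<star> z + (q * \<theta>) \<star> e + r \<star> e"
  proof -
    have h: "(\<theta> * \<theta>) \<star> z + (\<theta> * (\<theta> * 2)) \<star> z = (\<theta> * (\<theta> * 3)) \<star> z"
      using collect_scale(3)[of "\<theta> * \<theta>" z] by (simp add: mult.assoc)
    have "y \<odot> (y \<odot> y) = z \<odot> (z \<odot> z) + (\<theta> + \<theta> + \<theta>) \<star> (z \<odot> z) + (\<theta> * \<theta> + \<theta> * \<theta> + \<theta> * \<theta>) \<star> z + (\<theta> * \<theta> * \<theta>) \<star> e"
      unfolding y by (simp add: mul_simps algebra_simps collect_scale h)
    moreover have "y \<odot> y = z \<odot> z + (\<theta> + \<theta>) \<star> z + (\<theta> * \<theta>) \<star> e"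
      unfolding y by (simp add: mul_simps algebra_simps collect_scale)
    moreover have "\<theta> + \<theta> + \<theta> = 3 * \<theta>" "\<theta> * \<theta> + \<theta> * \<theta> + \<theta> * \<theta> = 3 * \<theta> * \<theta>" "\<theta> + \<theta> = 2 * \<theta>"
      by algebra+
    ultimately have "z \<odot> (z \<odot> z) + (3 * \<theta>) \<star> (z \<odot> z) + (3 * \<theta> * \<theta>) \<star> z + (\<theta> * \<theta> * \<theta>) \<star> e
      = p \<star> (z \<odot> z + (2 * \<theta>) \<star> z + (\<theta> * \<theta>) \<star> e) + q \<star> (z + \<theta> \<star> e) + r \<star> e"
      using y3 y by simp
    then show ?thesis by (simp add: algebra_simps)
  qed
  then have "z \<odot> (z \<odot> z) = (p - 3 * \<theta>) \<star> (z \<odot> z) + (2 * p * \<theta> + q - 3 * \<theta> * \<theta>) \<star> z"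
    unfolding r by (simp add: algebra_simps)
  then show ?thesis unfolding z_def by blast
qed

lemma simple_root_classification:
  assumes cubic: cubic_algebra and y: "cyclic y" and y3: "y \<odot> (y \<odot> y) = p \<star> (y \<odot> y) + q \<star> y" and q: "q \<noteq> 0"
  shows "isomorphic A J4_1 \<or> isomorphic A J4_2 \<or> isomorphic A J4_3 \<or> isomorphic A J4_4 \<or> isomorphic A J4_5"
proof -
  define f where "f = (1 / q) \<star> (y \<odot> y) - (p / q) \<star> y"
  \<comment> \<open>The value at \<open>y\<close> of the polynomial that is 1 at the simple root 0
    and divisible by the cofactor \<open>X\<^sup>2 - p * X - q\<close>.\<close>
  define c where "c = e - f"
  have f: "f = e - c" by (simp add: c_def)
  have fy: "f \<odot> y = y"
  proof -
    have "f \<odot> y = (1 / q) \<star> (y \<odot> (y \<odot> y)) - (p / q) \<star> (y \<odot> y)"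
      unfolding f_def using comm[of "y \<odot> y" y] by (simp add: mul_simps)
    then show ?thesis unfolding y3 using q by (simp add: scale_right_distrib)
  qed
  have fyy: "f \<odot> (y \<odot> y) = y \<odot> y"
  proof -
    have "f \<odot> (y \<odot> y) = (1 / q) \<star> ((y \<odot> y) \<odot> (y \<odot> y)) - (p / q) \<star> (y \<odot> (y \<odot> y))"
      by (subst (1) f_def) (simp add: mul_simps)
    also have "(y \<odot> y) \<odot> (y \<odot> y) = p \<star> (y \<odot> (y \<odot> y)) + q \<star> (y \<odot> y)"
      unfolding square_square by (subst y3) (simp add: mul_simps)
    finally show ?thesis using q by (simp add: scale_right_distrib)
  qed
  have ff: "f \<odot> f = f"
    by (subst (2) f_def) (simp add: mul_simps fy fyy, simp add: f_def)
  have cc: "c \<odot> c = c" and cy: "c \<odot> y = 0"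
    unfolding c_def using ff fy by (simp_all add: mul_simps)
  define n where "n = y - (p / 2) \<star> f"
  have cn: "c \<odot> n = 0"
    using cy ff unfolding n_def c_def by (simp add: mul_simps)
  have yy: "y \<odot> y = q \<star> f + p \<star> y"
    unfolding f_def using q by (simp add: algebra_simps)
  have n2: "n \<odot> n = (q + p / 2 * (p / 2)) \<star> (e - c)"
  proof -
    have "n \<odot> n = q \<star> f + (p - p / 2 - p / 2) \<star> y + (p / 2 * (p / 2)) \<star> f"
      unfolding n_def using fy ff comm[of y f] yy
      by (simp only: mul_simps scale_left_diff_distrib) (simp add: algebra_simps)
    then show ?thesis by (simp add: scale_left_distrib f[symmetric])
  qed
  obtain w0 where "ind4 sc e y (y \<odot> y) w0"
    using y ind3_extend unfolding cyclic_def by blast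
  have i0: "ind4 sc c f n w0"
    unfolding ind4_def
  proof (intro allI impI)
    fix \<alpha> \<beta> \<gamma> \<delta>
    assume *: "\<alpha> \<star> c + \<beta> \<star> f + \<gamma> \<star> n + \<delta> \<star> w0 = 0"
    define t where "t = (\<beta> - \<alpha> - \<gamma> * p / 2) / q"
    have "\<alpha> \<star> c + \<beta> \<star> f + \<gamma> \<star> n + \<delta> \<star> w0 = \<alpha> \<star> e + (\<beta> - \<alpha> - \<gamma> * p / 2) \<star> f + \<gamma> \<star> y + \<delta> \<star> w0"
      unfolding c_def n_def by (simp add: algebra_simps)
    also have "(\<beta> - \<alpha> - \<gamma> * p / 2) \<star> f = t \<star> (y \<odot> y) - (t * p) \<star> y"
      unfolding f_def t_def by (simp add: scale_right_diff_distrib)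
    also have "\<alpha> \<star> e + (t \<star> (y \<odot> y) - (t * p) \<star> y) + \<gamma> \<star> y + \<delta> \<star> w0
      = \<alpha> \<star> e + (\<gamma> - t * p) \<star> y + t \<star> (y \<odot> y) + \<delta> \<star> w0"
      by (simp add: algebra_simps)
    finally have "\<alpha> \<star> e + (\<gamma> - t * p) \<star> y + t \<star> (y \<odot> y) + \<delta> \<star> w0 = 0"
      using * by simp
    then have "\<alpha> = 0" "\<gamma> - t * p = 0" "t = 0" "\<delta> = 0"
      using \<open>ind4 sc e y (y \<odot> y) w0\<close> unfolding ind4_def by blast+
    moreover from this have "\<gamma> = 0" by simp
    ultimately show "\<alpha> = 0 \<and> \<beta> = 0 \<and> \<gamma> = 0 \<and> \<delta> = 0"
      using q by (simp add: t_def)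
  qed
  \<comment> \<open>So the eigenvalues of multiplication by \<open>c\<close> are among 0, 1/2 and
    1.\<close>
  have L3: "2 \<star> (c \<odot> (c \<odot> (c \<odot> z))) + c \<odot> z = 3 \<star> (c \<odot> (c \<odot> z))" for z
  proof -
    have "2 \<star> (c \<odot> (c \<odot> z)) + c \<odot> (c \<odot> z) = 2 \<star> (c \<odot> (c \<odot> (c \<odot> z))) + c \<odot> z"
      using jordan_linear[of c z c] unfolding cc by (simp add: comm[of _ c])
    moreover have "2 \<star> x + x = 3 \<star> x" for x using scale_left_distrib[of 2 1 x] by simp
    ultimately show ?thesis by simp
  qed
  \<comment> \<open>\<open>a\<close>, \<open>h\<close> and \<open>b\<close> are the components of
    \<open>w0\<close> for the eigenvalues 1, 1/2 and 0, given by the Lagrange interpolation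
    polynomials in multiplication by \<open>c\<close>.\<close>
  define a where "a = 2 \<star> (c \<odot> (c \<odot> w0)) - c \<odot> w0"
  define h where "h = 4 \<star> (c \<odot> w0) - 4 \<star> (c \<odot> (c \<odot> w0))"
  define b where "b = w0 - 3 \<star> (c \<odot> w0) + 2 \<star> (c \<odot> (c \<odot> w0))"
  have w0: "w0 = a + h + b"
  proof -
    have "a + h + b = w0 + (2 - 4 + 2) \<star> (c \<odot> (c \<odot> w0)) + (4 - 1 - 3) \<star> (c \<odot> w0)"
      unfolding a_def h_def b_def by (simp only: scale_left_distrib scale_left_diff_distrib) simp
    then show ?thesis by simp
  qed
  have two: "2 \<star> (c \<odot> (c \<odot> (c \<odot> w0))) = 3 \<star> (c \<odot> (c \<odot> w0)) - c \<odot> w0"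
    using L3[of w0] by (simp add: eq_diff_eq)
  have ca: "c \<odot> a = a"
  proof -
    have "c \<odot> a = (3 - 1) \<star> (c \<odot> (c \<odot> w0)) - c \<odot> w0"
      unfolding a_def by (simp only: mul_simps two scale_left_diff_distrib) simp
    then show ?thesis by (simp add: a_def)
  qed
  have ch: "c \<odot> h = (1/2) \<star> h"
  proof -
    have "c \<odot> h = 4 \<star> (c \<odot> (c \<odot> w0)) - 2 \<star> (2 \<star> (c \<odot> (c \<odot> (c \<odot> w0))))"
      unfolding h_def by (simp add: mul_simps)
    also have "\<dots> = (4 - 6) \<star> (c \<odot> (c \<odot> w0)) + 2 \<star> (c \<odot> w0)"
      unfolding two by (simp only: scale_left_diff_distrib scale_right_diff_distrib) simp
    finally show ?thesis by (simp add: h_def scale_right_diff_distrib)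
  qed
  have cb: "c \<odot> b = 0"
  proof -
    have "c \<odot> b = (1 - 1) \<star> (c \<odot> w0)"
      unfolding b_def by (simp add: mul_simps two)
    then show ?thesis by simp
  qed
  \<comment> \<open>At least one homogeneous component completes the basis; its eigenvalue decides
    which case applies.\<close>
  have "\<not> (a \<in> span {c, f, n} \<and> h \<in> span {c, f, n} \<and> b \<in> span {c, f, n})"
  proof
    assume "a \<in> span {c, f, n} \<and> h \<in> span {c, f, n} \<and> b \<in> span {c, f, n}"
    then have "w0 \<in> span {c, f, n}" unfolding w0 by (auto intro: span_add)
    then obtain \<alpha> \<beta> \<gamma> where "w0 = \<alpha> \<star> c + \<beta> \<star> f + \<gamma> \<star> n"
      unfolding span_insert span_empty by (auto simp: eq_diff_eq algebra_simps)
    then have "\<alpha> \<star> c + \<beta> \<star> f + \<gamma> \<star> n + (-1) \<star> w0 = 0" by simp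
    then show False using i0 unfolding ind4_def by (metis one_neq_zero neg_eq_iff_add_eq_0 add.right_neutral)
  qed
  moreover have i: "ind4 sc c (e - c) n z" if "z \<notin> span {c, f, n}" for z
    using ind3_ex_ind4[OF ind4_ind3[OF i0] that] f by simp
  ultimately show ?thesis
    using simple_root_one[OF cubic cc i cn ca n2] simple_root_half[OF cubic cc i cn ch n2]
      split_basis_classification[OF cubic, of c n b] cc cn cb
    unfolding split_basis_def by blast
qed

subsection \<open>Algebras spanned by the unity and nilpotent elements\<close>

lemma nilpotent_normal_form:
  assumes i: "ind4 sc e v w b" and p: "v \<odot> v = b" "v \<odot> b = 0" "b \<odot> b = 0" "v \<odot> w = 0" "b \<odot> w = 0" "w \<odot> w = q \<star> b"
  shows "isomorphic A J4_6 \<or> isomorphic A J4_7"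
proof (cases "q = 0")
  case True
  have j: "jordan4 J4_7" "ind4 (scl J4_7) (bas 1) (bas 2) (bas 3) (bas 4)"
    using jordan4_J4_4567 ind4_bas by (auto simp: scl_J4_4567)
  have "isomorphic A J4_7"
  proof (rule isomorphic_by_basis[OF jordan4_axioms j(1) i j(2)])
    fix g assume g: "Vector_Spaces.linear sc (scl J4_7) g" "g e = bas 1" "g v = bas 2" "g w = bas 3" "g b = bas 4"
    interpret g: Vector_Spaces.linear sc "scl J4_7" g by fact
    show "g (e \<odot> e) = prd J4_7 (bas 1) (bas 1) \<and> g (e \<odot> v) = prd J4_7 (bas 1) (bas 2) \<and>
      g (e \<odot> w) = prd J4_7 (bas 1) (bas 3) \<and> g (e \<odot> b) = prd J4_7 (bas 1) (bas 4) \<and>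
      g (v \<odot> v) = prd J4_7 (bas 2) (bas 2) \<and> g (v \<odot> w) = prd J4_7 (bas 2) (bas 3) \<and>
      g (v \<odot> b) = prd J4_7 (bas 2) (bas 4) \<and> g (w \<odot> w) = prd J4_7 (bas 3) (bas 3) \<and>
      g (w \<odot> b) = prd J4_7 (bas 3) (bas 4) \<and> g (b \<odot> b) = prd J4_7 (bas 4) (bas 4)"
      unfolding comm[of w b] p True one_left g.zero g.scale g(2-5)
      by (simp add: prd_J4_7 scl_J4_4567 coordinate_simps)
  qed
  then show ?thesis ..
next
  case False
  define k where "k = csqrt (1 / q)"
  have k: "k * k * q = 1"
    using False power2_csqrt[of "1 / q"] by (simp add: k_def power2_eq_square)
  then have "k \<noteq> 0" by auto
  then have i': "ind4 sc e v (k \<star> w) b"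
    using ind4_combine[OF i, of 1 k 0 0 0 0 0] by simp
  have j: "jordan4 J4_6" "ind4 (scl J4_6) (bas 1) (bas 2) (bas 3) (bas 4)"
    using jordan4_J4_4567 ind4_bas by (auto simp: scl_J4_4567)
  have kk: "(k \<star> w) \<odot> (k \<star> w) = b"
    by (simp only: scale_left scale_right p scale_scale k mult.assoc[symmetric] scale_one)
  have kz: "v \<odot> (k \<star> w) = 0" "(k \<star> w) \<odot> b = 0"
    using p comm[of w b] by (simp_all add: mul_simps)
  have "isomorphic A J4_6"
  proof (rule isomorphic_by_basis[OF jordan4_axioms j(1) i' j(2)])
    fix g assume g: "Vector_Spaces.linear sc (scl J4_6) g" "g e = bas 1" "g v = bas 2" "g (k \<star> w) = bas 3" "g b = bas 4"
    interpret g: Vector_Spaces.linear sc "scl J4_6" g by fact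
    show "g (e \<odot> e) = prd J4_6 (bas 1) (bas 1) \<and> g (e \<odot> v) = prd J4_6 (bas 1) (bas 2) \<and>
      g (e \<odot> (k \<star> w)) = prd J4_6 (bas 1) (bas 3) \<and> g (e \<odot> b) = prd J4_6 (bas 1) (bas 4) \<and>
      g (v \<odot> v) = prd J4_6 (bas 2) (bas 2) \<and> g (v \<odot> (k \<star> w)) = prd J4_6 (bas 2) (bas 3) \<and>
      g (v \<odot> b) = prd J4_6 (bas 2) (bas 4) \<and> g ((k \<star> w) \<odot> (k \<star> w)) = prd J4_6 (bas 3) (bas 3) \<and>
      g ((k \<star> w) \<odot> b) = prd J4_6 (bas 3) (bas 4) \<and> g (b \<odot> b) = prd J4_6 (bas 4) (bas 4)"
      unfolding kk kz p one_left g.zero g(2-5)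
      by (simp add: prd_J4_6 scl_J4_4567 coordinate_simps)
  qed
  then show ?thesis ..
qed

end

context jordan4
begin

text \<open>Expresses multiplication by the cube through multiplication by \<open>x\<close> and by
  its square, so that a vanishing power of \<open>x\<close> restricts how \<open>x\<close> acts on
  the whole algebra.\<close>

lemma cube_operator: "(x \<odot> (x \<odot> x)) \<odot> z + 2 \<star> (x \<odot> (x \<odot> (x \<odot> z))) = 3 \<star> ((x \<odot> x) \<odot> (x \<odot> z))"
proof -
  have "2 \<star> ((x \<odot> x) \<odot> (x \<odot> z)) + (x \<odot> x) \<odot> (x \<odot> z) = 2 \<star> (x \<odot> (x \<odot> (x \<odot> z))) + (x \<odot> (x \<odot> x)) \<odot> z"
    using jordan_linear[of x z x] comm[of z x] comm[of "x \<odot> z" "x \<odot> x"] comm[of "x \<odot> z" x]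
      comm[of z "(x \<odot> x) \<odot> x"] comm[of "x \<odot> x" x] by simp
  moreover have "2 \<star> u + u = 3 \<star> u" for u using scale_left_distrib[of 2 1 u] by simp
  ultimately show ?thesis by (simp add: add.commute)
qed

text \<open>\<open>nsr\<close> says that 0 is never a simple root. Once one root is shifted to 0 the
  others are 0 and \<open>p\<close>, and if \<open>p \<noteq> 0\<close> a second shift would make
  \<open>p\<close> a simple root at 0.\<close>

lemma triple_root:
  assumes cubic: cubic_algebra
    and nsr: "\<And>y p q. cyclic y \<Longrightarrow> y \<odot> (y \<odot> y) = p \<star> (y \<odot> y) + q \<star> y \<Longrightarrow> q = 0"
    and y: "cyclic y"
  shows "\<exists>\<theta>. (y - \<theta> \<star> e) \<odot> ((y - \<theta> \<star> e) \<odot> (y - \<theta> \<star> e)) = 0"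
proof -
  obtain \<theta> p q where z3: "(y - \<theta> \<star> e) \<odot> ((y - \<theta> \<star> e) \<odot> (y - \<theta> \<star> e)) =
    p \<star> ((y - \<theta> \<star> e) \<odot> (y - \<theta> \<star> e)) + q \<star> (y - \<theta> \<star> e)"
    using cyclic_root[OF cubic y] by blast
  define z where "z = y - \<theta> \<star> e"
  have z: "cyclic z" unfolding z_def by (rule cyclic_shift[OF y])
  have "q = 0" using nsr[OF z] z3 unfolding z_def by blast
  then have z3: "z \<odot> (z \<odot> z) = p \<star> (z \<odot> z)" using z3 unfolding z_def by simp
  define u where "u = z - p \<star> e"
  have uz: "z = u + p \<star> e" by (simp add: u_def)
  have uu: "z \<odot> z = u \<odot> u + (p * 2) \<star> u + (p * p) \<star> e"
    unfolding uz by (simp add: mul_simps algebra_simps collect_scale)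
  have "u \<odot> (z \<odot> z) = 0"
    unfolding u_def using z3 by (simp add: mul_simps)
  then have "u \<odot> (u \<odot> u) = (- (p * 2)) \<star> (u \<odot> u) + (- (p * p)) \<star> u"
    unfolding uu by (simp add: mul_simps algebra_simps eq_neg_iff_add_eq_0)
  then have "- (p * p) = 0"
    using nsr[of u] cyclic_shift[OF z] unfolding u_def by blast
  then have "p = 0" by simp
  then show ?thesis using z3 unfolding z_def by auto
qed

text \<open>In a basis \<open>e\<close>, \<open>v\<close>, \<open>b\<close>, \<open>w\<close> with
  \<open>b\<close> the square of \<open>v\<close>, all unknown structure constants except
  \<open>x2\<close> and \<open>z2\<close> vanish. The former is removed by passing to
  \<open>u\<close>, and \<open>z2 - x2 * x2\<close> becomes the parameter of
  \<open>nilpotent_normal_form\<close>.\<close>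

lemma triple_root_classification:
  assumes cubic: cubic_algebra and ex: "cyclic x"
    and nsr: "\<And>y p q. cyclic y \<Longrightarrow> y \<odot> (y \<odot> y) = p \<star> (y \<odot> y) + q \<star> y \<Longrightarrow> q = 0"
  shows "isomorphic A J4_6 \<or> isomorphic A J4_7"
proof -
  obtain \<theta> where "(x - \<theta> \<star> e) \<odot> ((x - \<theta> \<star> e) \<odot> (x - \<theta> \<star> e)) = 0"
    using triple_root[OF cubic _ ex] nsr by blast
  then obtain v where v: "cyclic v" "v \<odot> (v \<odot> v) = 0"
    using cyclic_shift[OF ex] by blast
  define b where "b = v \<odot> v"
  have vb: "v \<odot> b = 0" and bv: "b \<odot> v = 0" using v comm[of b v] by (simp_all add: b_def)
  have bb: "b \<odot> b = 0"
    unfolding b_def square_square v(2) by simp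
  obtain w0 where i0: "ind4 sc e v b w0"
    using v(1) ind3_extend unfolding cyclic_def b_def by blast
  \<comment> \<open>The last coefficient is written with a factor 2 so that subtracting
    \<open>z4 \<star> e\<close> removes \<open>w\<close> from its own square.\<close>
  obtain z0 z1 z2 z4 where w0: "w0 \<odot> w0 = z0 \<star> e + z1 \<star> v + z2 \<star> b + (z4 * 2) \<star> w0"
  proof -
    obtain z0 z1 z2 z4 where "w0 \<odot> w0 = z0 \<star> e + z1 \<star> v + z2 \<star> b + z4 \<star> w0"
      using ind4_spans[OF i0] by blast
    then show thesis using that[of z0 z1 z2 "z4 / 2"] by simp
  qed
  define w where "w = w0 - z4 \<star> e"
  define t0 where "t0 = z0 + z4 * z4"
  have i: "ind4 sc e v b w"
    using ind4_combine[OF i0, of 1 1 0 0 "- z4" 0 0] by (simp add: w_def algebra_simps)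
  have ww: "w \<odot> w = t0 \<star> e + z1 \<star> v + z2 \<star> b"
    unfolding w_def t0_def using w0 by (simp add: mul_simps algebra_simps collect_scale)
  obtain x0 x1 x2 \<nu> where vw: "v \<odot> w = x0 \<star> e + x1 \<star> v + x2 \<star> b + \<nu> \<star> w"
    using ind4_spans[OF i] by blast
  obtain y0 y1 y2 \<mu> where bw: "b \<odot> w = y0 \<star> e + y1 \<star> v + y2 \<star> b + \<mu> \<star> w"
    using ind4_spans[OF i] by blast
  \<comment> \<open>As \<open>b \<odot> b = 0\<close>, the third power of multiplication by
    \<open>b\<close> kills \<open>w\<close>; \<open>\<mu>\<close> is the eigenvalue of this operator
    modulo the span of \<open>e\<close>, \<open>v\<close> and \<open>b\<close>, so it
    vanishes.\<close>
  have "b \<odot> (b \<odot> (b \<odot> w)) = 0"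
    using cube_operator[of b w] unfolding bb by simp
  moreover have "b \<odot> (b \<odot> (b \<odot> w)) = (\<mu> * \<mu> * y0) \<star> e + (\<mu> * \<mu> * y1) \<star> v + (\<mu> * y0 + \<mu> * \<mu> * y2) \<star> b + (\<mu> * \<mu> * \<mu>) \<star> w"
  proof -
    have 1: "b \<odot> (b \<odot> w) = y0 \<star> b + \<mu> \<star> (b \<odot> w)"
      by (subst bw) (simp add: mul_simps bv bb)
    then have "b \<odot> (b \<odot> (b \<odot> w)) = (\<mu> * y0) \<star> b + (\<mu> * \<mu>) \<star> (b \<odot> w)"
      by (simp add: mul_simps bb scale_right_distrib)
    then show ?thesis unfolding bw by (simp add: algebra_simps)
  qed
  ultimately have "(\<mu> * \<mu> * y0) \<star> e + (\<mu> * \<mu> * y1) \<star> v + (\<mu> * y0 + \<mu> * \<mu> * y2) \<star> b + (\<mu> * \<mu> * \<mu>) \<star> w = 0"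
    by simp
  then have "\<mu> * \<mu> * \<mu> = 0" using i unfolding ind4_def by blast
  then have bw: "b \<odot> w = y0 \<star> e + y1 \<star> v + y2 \<star> b" using bw by simp
  \<comment> \<open>The cube of \<open>v\<close> is 0, so the same operator identity applies; its
    coefficients at \<open>w\<close> and \<open>b\<close> give \<open>\<nu> = 0\<close> and
    \<open>x0 = 0\<close>.\<close>
  have cube: "2 \<star> (v \<odot> (v \<odot> (v \<odot> w))) = 3 \<star> (b \<odot> (v \<odot> w))"
    using cube_operator[of v w] v(2) unfolding b_def by simp
  have 1: "v \<odot> (v \<odot> w) = x0 \<star> v + x1 \<star> b + \<nu> \<star> (v \<odot> w)"
    by (subst vw) (simp add: mul_simps vb b_def[symmetric])
  have "v \<odot> (v \<odot> (v \<odot> w)) = x0 \<star> b + \<nu> \<star> (v \<odot> (v \<odot> w))"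
    by (subst 1) (simp add: mul_simps vb b_def[symmetric])
  then have "v \<odot> (v \<odot> (v \<odot> w)) = (\<nu> * \<nu> * x0) \<star> e + (\<nu> * x0 + \<nu> * \<nu> * x1) \<star> v
      + (x0 + \<nu> * x1 + \<nu> * \<nu> * x2) \<star> b + (\<nu> * \<nu> * \<nu>) \<star> w"
    unfolding 1 unfolding vw by (simp add: algebra_simps)
  then have 2: "2 \<star> (v \<odot> (v \<odot> (v \<odot> w))) = (2 * (\<nu> * \<nu> * x0)) \<star> e + (2 * (\<nu> * x0 + \<nu> * \<nu> * x1)) \<star> v
      + (2 * (x0 + \<nu> * x1 + \<nu> * \<nu> * x2)) \<star> b + (2 * (\<nu> * \<nu> * \<nu>)) \<star> w"
    by (simp only: scale_right_distrib scale_scale)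
  have "b \<odot> (v \<odot> w) = (\<nu> * y0) \<star> e + (\<nu> * y1) \<star> v + (x0 + \<nu> * y2) \<star> b + 0 \<star> w"
    unfolding vw by (simp add: mul_simps bv bb bw algebra_simps)
  then have 3: "3 \<star> (b \<odot> (v \<odot> w)) = (3 * (\<nu> * y0)) \<star> e + (3 * (\<nu> * y1)) \<star> v
      + (3 * (x0 + \<nu> * y2)) \<star> b + (3 * 0) \<star> w"
    by (simp only: scale_right_distrib scale_scale)
  have "2 * (\<nu> * \<nu> * \<nu>) = 3 * 0" and x0: "2 * (x0 + \<nu> * x1 + \<nu> * \<nu> * x2) = 3 * (x0 + \<nu> * y2)"
    using cube unfolding 2 3 ind4_eq[OF i] by blast+
  then have "\<nu> = 0" by simp
  moreover from this have "x0 = 0" using x0 by simp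
  ultimately have vw: "v \<odot> w = x1 \<star> v + x2 \<star> b" using vw by simp
  have "v \<odot> (b \<odot> w) = b \<odot> (v \<odot> w)"
    using jordan_identity[of v w] by (simp add: b_def)
  then have "0 \<star> e + y0 \<star> v + y1 \<star> b + 0 \<star> w = 0"
    unfolding vw bw by (simp add: mul_simps vb bv bb b_def[symmetric])
  then have "y0 = 0" "y1 = 0" using i unfolding ind4_def by blast+
  then have bw: "b \<odot> w = y2 \<star> b" using bw by simp
  have wv: "w \<odot> v = x1 \<star> v + x2 \<star> b" and wb: "w \<odot> b = y2 \<star> b"
    using vw bw comm[of w v] comm[of w b] by simp_all
  \<comment> \<open>The \<open>b\<close>-coefficient of the square of
    \<open>w + k \<star> v\<close>; if it is nonzero, this element is cyclic. It is a monic
    quadratic in \<open>k\<close>, so it cannot vanish at all of 0, 1 and -1.\<close>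
  obtain k where k: "z2 + 2 * (k * x2) + k * k \<noteq> 0"
  proof -
    have "\<not> (z2 + 2 * (0 * x2) + 0 * 0 = 0 \<and> z2 + 2 * (1 * x2) + 1 * 1 = 0 \<and> z2 + 2 * ((-1) * x2) + (-1) * (-1) = 0)"
    proof
      assume "z2 + 2 * (0 * x2) + 0 * 0 = 0 \<and> z2 + 2 * (1 * x2) + 1 * 1 = 0 \<and> z2 + 2 * ((-1) * x2) + (-1) * (-1) = 0"
      then have "(2 :: complex) = 0" by algebra
      then show False by simp
    qed
    then show thesis using that by blast
  qed
  define y where "y = w + k \<star> v"
  define m where "m = z1 + 2 * (k * x1)"
  define r where "r = z2 + 2 * (k * x2) + k * k"
  have yy: "y \<odot> y = t0 \<star> e + m \<star> v + r \<star> b"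
    unfolding y_def m_def r_def
    by (simp add: mul_simps ww vw wv b_def[symmetric] algebra_simps collect_scale)
  have yv: "y \<odot> v = x1 \<star> v + (x2 + k) \<star> b" and yb: "y \<odot> b = y2 \<star> b"
    unfolding y_def by (simp_all add: mul_simps wv wb vb b_def[symmetric] algebra_simps)
  have "cyclic y"
    unfolding cyclic_def ind3_def
  proof (intro allI impI)
    fix \<alpha> \<beta> \<gamma>
    assume "\<alpha> \<star> e + \<beta> \<star> y + \<gamma> \<star> (y \<odot> y) = 0"
    then have "(\<alpha> + \<gamma> * t0) \<star> e + (\<beta> * k + \<gamma> * m) \<star> v + (\<gamma> * r) \<star> b + \<beta> \<star> w = 0"
      unfolding yy unfolding y_def by (simp add: algebra_simps)
    then have "\<alpha> + \<gamma> * t0 = 0" "\<gamma> * r = 0" "\<beta> = 0" using i unfolding ind4_def by blast+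
    then show "\<alpha> = 0 \<and> \<beta> = 0 \<and> \<gamma> = 0" using k by (simp add: r_def)
  qed
  then obtain \<theta> where th: "(y - \<theta> \<star> e) \<odot> ((y - \<theta> \<star> e) \<odot> (y - \<theta> \<star> e)) = 0"
    using triple_root[OF cubic] nsr by blast
  have y3: "y \<odot> (y \<odot> y) = t0 \<star> y + (m * x1) \<star> v + (m * (x2 + k) + r * y2) \<star> b"
    unfolding yy by (simp add: mul_simps yv yb scale_left_distrib scale_right_distrib distrib_left)
  have "y \<odot> (y \<odot> y) - (\<theta> + \<theta> + \<theta>) \<star> (y \<odot> y) + (\<theta> * \<theta> + \<theta> * \<theta> + \<theta> * \<theta>) \<star> y - (\<theta> * \<theta> * \<theta>) \<star> e = 0"
    using th by (simp only: mul_simps scale_left_distrib one_right one_left) (simp add: algebra_simps)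
  moreover have "\<theta> + \<theta> + \<theta> = 3 * \<theta>" "\<theta> * \<theta> + \<theta> * \<theta> + \<theta> * \<theta> = 3 * \<theta> * \<theta>" by algebra+
  ultimately have "y \<odot> (y \<odot> y) - (3 * \<theta>) \<star> (y \<odot> y) + (3 * \<theta> * \<theta>) \<star> y - (\<theta> * \<theta> * \<theta>) \<star> e = 0"
    by (simp add: mult.assoc)
  \<comment> \<open>The coefficients at \<open>e\<close> and \<open>w\<close> of the triple root
    equation combine to \<open>8 * \<theta> ^ 3 = 0\<close>, whence \<open>t0 = 0\<close>.\<close>
  then have "(- (3 * \<theta> * t0) - \<theta> * \<theta> * \<theta>) \<star> e + (t0 * k + m * x1 - 3 * \<theta> * m + 3 * \<theta> * \<theta> * k) \<star> v
      + (m * (x2 + k) + r * y2 - 3 * \<theta> * r) \<star> b + (t0 + 3 * \<theta> * \<theta>) \<star> w = 0"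
    unfolding y3 unfolding yy unfolding y_def
    by (simp only: scale_left_distrib scale_right_distrib scale_left_diff_distrib scale_minus_left scale_scale)
      (simp add: algebra_simps)
  then have "- (3 * \<theta> * t0) - \<theta> * \<theta> * \<theta> = 0" and t0: "t0 + 3 * \<theta> * \<theta> = 0"
    using i unfolding ind4_def by blast+
  then have "8 * (\<theta> * \<theta> * \<theta>) = 0" by algebra
  then have "t0 = 0" using t0 by simp
  then have ww: "w \<odot> w = z1 \<star> v + z2 \<star> b" using ww by simp
  have coeff_b: "p = 0" if "p \<star> b = 0" for p
    using i that unfolding ind4_def by (metis add_0 add.right_neutral scale_zero_left)
  \<comment> \<open>Two instances of the linearised identity and the fourth power of
    \<open>w\<close> reduce to multiples of \<open>b\<close> by the squares of \<open>y2\<close>,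
    \<open>x1\<close> and \<open>z1\<close>, which therefore vanish.\<close>
  have "2 \<star> ((v \<odot> w) \<odot> (v \<odot> w)) + b \<odot> (w \<odot> w) = 2 \<star> (v \<odot> ((v \<odot> w) \<odot> w)) + w \<odot> (b \<odot> w)"
    using jordan_linear[of v w w] unfolding b_def .
  then have "(y2 * y2) \<star> b = 0"
    unfolding ww bw vw by (simp add: mul_simps wb bw vb bv bb vw b_def[symmetric])
  then have "y2 = 0" using coeff_b by fastforce
  have "2 \<star> ((w \<odot> v) \<odot> (w \<odot> v)) + (w \<odot> w) \<odot> b = 2 \<star> (w \<odot> ((w \<odot> v) \<odot> v)) + v \<odot> ((w \<odot> w) \<odot> v)"
    using jordan_linear[of w v v] unfolding b_def .
  then have "(2 * x1 * x1) \<star> b = 0"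
    unfolding ww wv using \<open>y2 = 0\<close> by (simp add: mul_simps wb vb bv bb b_def[symmetric] mult.assoc)
  then have "x1 = 0" using coeff_b by fastforce
  have "w \<odot> (w \<odot> (w \<odot> w)) = 0"
    unfolding ww using \<open>x1 = 0\<close> \<open>y2 = 0\<close> by (simp add: mul_simps wv wb)
  then have "(w \<odot> w) \<odot> (w \<odot> w) = 0"
    by (simp add: square_square)
  then have "(z1 * z1) \<star> b = 0"
    unfolding ww by (simp add: mul_simps vb bv bb b_def[symmetric])
  then have "z1 = 0" using coeff_b by fastforce
  define u where "u = w - x2 \<star> v"
  have "ind4 sc e v b u"
    using ind4_combine[OF i, of 1 1 0 0 0 "- x2" 0] by (simp add: u_def algebra_simps)
  then have "ind4 sc e v u b" by (rule ind4_swap)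
  moreover have "v \<odot> u = 0" "b \<odot> u = 0"
    unfolding u_def using \<open>x1 = 0\<close> \<open>y2 = 0\<close> by (simp_all add: mul_simps vw bw bv b_def[symmetric])
  moreover have "u \<odot> u = (z2 - x2 * x2) \<star> b"
    unfolding u_def using \<open>x1 = 0\<close> \<open>z1 = 0\<close>
    by (simp add: mul_simps ww vw wv b_def[symmetric] algebra_simps)
  ultimately show ?thesis
    using nilpotent_normal_form b_def vb bb by metis
qed

lemma rank3_classification:
  assumes "has_rank A 3"
  shows "isomorphic A J4_1 \<or> isomorphic A J4_2 \<or> isomorphic A J4_3 \<or> isomorphic A J4_4 \<or>
    isomorphic A J4_5 \<or> isomorphic A J4_6 \<or> isomorphic A J4_7"
proof -
  have cubic: cubic_algebra
    using rank3_cubic[OF assms] by (simp add: cubic_algebra_def)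
  obtain x where "cyclic x"
    using generically_ex[OF rank3_cyclic_generically[OF assms]] by blast
  then show ?thesis
    using simple_root_classification[OF cubic] triple_root_classification[OF cubic] by metis
qed

end

section \<open>Linear equivalence\<close>

text \<open>Equality of quadratic maps instead of rational maps, so that zeros and differentials are
  transported. \<open>linearly_imp_strongly_equivalent\<close> recovers it from linear
  equivalence.\<close>

definition strongly_equivalent :: "(complex^4 \<Rightarrow> complex^4) \<Rightarrow> (complex^4 \<Rightarrow> complex^4) \<Rightarrow> bool" where
  "strongly_equivalent F G \<longleftrightarrow>
     (\<exists>L1 L2. Vector_Spaces.linear (*s) (*s) L1 \<and> bij L1 \<and>
              Vector_Spaces.linear (*s) (*s) L2 \<and> bij L2 \<and> (\<forall>x. G x = L1 (F (L2 x))))"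

lemma linear_bij_inv:
  assumes "Vector_Spaces.linear s s' f" "bij f"
  shows "Vector_Spaces.linear s' s (inv f)"
proof -
  interpret f: Vector_Spaces.linear s s' f by fact
  have g: "inv f (f x) = x" "f (inv f y) = y" for x y
    using assms(2) by (simp_all add: bij_is_inj bij_is_surj surj_f_inv_f)
  have "inv f (x + y) = inv f x + inv f y" for x y
    using g f.add by metis
  moreover have "inv f (s' c x) = s c (inv f x)" for c x
    using g f.scale by metis
  ultimately show ?thesis
    unfolding Vector_Spaces.linear_iff
    using f.vs1.vector_space_axioms f.vs2.vector_space_axioms by blast
qed

lemma strongly_equivalentE:
  assumes "strongly_equivalent F G"
  obtains L K M where "Vector_Spaces.linear (*s) (*s) L" "bij L" "Vector_Spaces.linear (*s) (*s) K" "bij K"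
    "Vector_Spaces.linear (*s) (*s) M" "bij M" "\<And>x. M (K x) = x" "\<And>x. K (M x) = x" "\<And>x. G (K x) = L (F x)"
proof -
  obtain L M where 1: "Vector_Spaces.linear (*s) (*s) L" "bij L" "Vector_Spaces.linear (*s) (*s) M" "bij M"
    "\<And>x. G x = L (F (M x))"
    using assms unfolding strongly_equivalent_def by blast
  have "M (inv M x) = x" "inv M (M x) = x" for x
    using 1(4) by (simp_all add: bij_is_inj bij_is_surj surj_f_inv_f)
  then show thesis
    using that[OF 1(1,2) linear_bij_inv[OF 1(3,4)] bij_imp_bij_inv[OF 1(4)] 1(3,4)] 1(5) by simp
qed

lemma strongly_equivalent_sym:
  assumes "strongly_equivalent F G"
  shows "strongly_equivalent G F"
proof -
  obtain L K M where 1: "Vector_Spaces.linear (*s) (*s) L" "bij L" "Vector_Spaces.linear (*s) (*s) K" "bij K"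
    "\<And>x. G (K x) = L (F x)"
    using strongly_equivalentE[OF assms] by metis
  then show ?thesis
    unfolding strongly_equivalent_def
    by (intro exI[of _ "inv L"] exI[of _ K])
      (simp add: linear_bij_inv bij_imp_bij_inv bij_is_inj)
qed

lemma strongly_equivalent_trans:
  assumes "strongly_equivalent F G" "strongly_equivalent G H"
  shows "strongly_equivalent F H"
proof -
  obtain L1 L2 where 1: "Vector_Spaces.linear (*s) (*s) L1" "bij L1" "Vector_Spaces.linear (*s) (*s) L2" "bij L2"
    "\<And>x. G x = L1 (F (L2 x))"
    using assms(1) unfolding strongly_equivalent_def by blast
  obtain K1 K2 where 2: "Vector_Spaces.linear (*s) (*s) K1" "bij K1" "Vector_Spaces.linear (*s) (*s) K2" "bij K2"
    "\<And>x. H x = K1 (G (K2 x))"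
    using assms(2) unfolding strongly_equivalent_def by blast
  show ?thesis
    unfolding strongly_equivalent_def
    using Vector_Spaces.linear_compose[OF 1(1) 2(1)] Vector_Spaces.linear_compose[OF 2(3) 1(3)]
      bij_comp[OF 1(2) 2(2)] bij_comp[OF 2(4) 1(4)]
    by (intro exI[of _ "K1 \<circ> L1"] exI[of _ "L2 \<circ> K2"]) (simp add: 1(5) 2(5))
qed

lemma strongly_imp_linearly_equivalent:
  "strongly_equivalent F G \<Longrightarrow> linearly_equivalent F G"
  unfolding strongly_equivalent_def linearly_equivalent_def same_ratmap_def comp_apply
  by (elim exE conjE, rule_tac x = L1 in exI, rule_tac x = L2 in exI) simp

subsection \<open>Invariants of the base locus\<close>

text \<open>The base loci to be separated: a conic and a point for \<open>Q1\<close>, two lines and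
  a point for \<open>Q2\<close>, a line and a point for \<open>Q3\<close>, a conic for
  \<open>Q4\<close>, the same two lines for \<open>Q5\<close> and \<open>Q6\<close>, a line for
  \<open>Q7\<close>. All conditions are stated on the affine cone; this one says that the base locus
  is linear.\<close>

definition base_additive :: "(complex^4 \<Rightarrow> complex^4) \<Rightarrow> bool" where
  "base_additive F \<longleftrightarrow> (\<forall>u v. F u = 0 \<longrightarrow> F v = 0 \<longrightarrow> F (u + v) = 0)"

text \<open>The base locus is a cone with vertex \<open>p\<close>, such as the intersection point of
  two lines.\<close>

definition base_vertex :: "(complex^4 \<Rightarrow> complex^4) \<Rightarrow> bool" where
  "base_vertex F \<longleftrightarrow> (\<exists>p. p \<noteq> 0 \<and> F p = 0 \<and> (\<forall>v. F v = 0 \<longrightarrow> F (p + v) = 0))"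

text \<open>A union of two linear subspaces contains no such triple, and a union of three no
  quadruple as below, because two of the vectors share a subspace.\<close>

definition base_triple :: "(complex^4 \<Rightarrow> complex^4) \<Rightarrow> bool" where
  "base_triple F \<longleftrightarrow> (\<exists>u v w. F u = 0 \<and> F v = 0 \<and> F w = 0 \<and>
     F (u + v) \<noteq> 0 \<and> F (u + w) \<noteq> 0 \<and> F (v + w) \<noteq> 0)"

definition base_quadruple :: "(complex^4 \<Rightarrow> complex^4) \<Rightarrow> bool" where
  "base_quadruple F \<longleftrightarrow> (\<exists>u v w x. F u = 0 \<and> F v = 0 \<and> F w = 0 \<and> F x = 0 \<and>
     F (u + v) \<noteq> 0 \<and> F (u + w) \<noteq> 0 \<and> F (v + w) \<noteq> 0 \<and> F (u + x) \<noteq> 0 \<and> F (v + x) \<noteq> 0 \<and> F (w + x) \<noteq> 0)"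

text \<open>Separates a conic from a conic together with a point outside its plane.\<close>

definition base_hyperplane :: "(complex^4 \<Rightarrow> complex^4) \<Rightarrow> bool" where
  "base_hyperplane F \<longleftrightarrow> (\<exists>l. Vector_Spaces.linear (*s) (*) l \<and> (\<exists>x. l x \<noteq> 0) \<and> (\<forall>v. F v = 0 \<longrightarrow> l v = 0))"

text \<open>For quadratic \<open>F\<close>, the condition on \<open>v\<close> says that \<open>v\<close> is in the kernel of the differential at \<open>u\<close>;
  hence this set is the zero set of the Jacobian determinant.\<close>

definition critical :: "(complex^4 \<Rightarrow> complex^4) \<Rightarrow> (complex^4) \<Rightarrow> bool" where
  "critical F u \<longleftrightarrow> (\<exists>v. v \<noteq> 0 \<and> F (u + v) = F u + F v)"

definition critical_additive :: "(complex^4 \<Rightarrow> complex^4) \<Rightarrow> bool" where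
  "critical_additive F \<longleftrightarrow> (\<forall>u v. critical F u \<longrightarrow> critical F v \<longrightarrow> critical F (u + v))"

lemma invariants_imp:
  assumes "strongly_equivalent F G"
  shows "base_additive F \<Longrightarrow> base_additive G" "base_vertex F \<Longrightarrow> base_vertex G"
    "base_triple F \<Longrightarrow> base_triple G" "base_quadruple F \<Longrightarrow> base_quadruple G"
    "base_hyperplane F \<Longrightarrow> base_hyperplane G" "critical_additive F \<Longrightarrow> critical_additive G"
proof -
  obtain L K M where L: "Vector_Spaces.linear (*s) (*s) L" "bij L" and K: "Vector_Spaces.linear (*s) (*s) K" "bij K"
    and M: "Vector_Spaces.linear (*s) (*s) M" "bij M" and MK: "\<And>x. M (K x) = x" "\<And>x. K (M x) = x"
    and GK: "\<And>x. G (K x) = L (F x)"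
    using strongly_equivalentE[OF assms] by metis
  interpret L: Vector_Spaces.linear "(*s)" "(*s)" L by fact
  interpret K: Vector_Spaces.linear "(*s)" "(*s)" K by fact
  interpret M: Vector_Spaces.linear "(*s)" "(*s)" M by fact
  have L0: "L x = 0 \<longleftrightarrow> x = 0" for x
    using L(2) L.zero by (metis bij_is_inj inj_eq)
  have G: "G x = L (F (M x))" for x using GK[of "M x"] MK by simp
  have G0: "G x = 0 \<longleftrightarrow> F (M x) = 0" for x by (simp add: G L0)
  have GK0: "G (K x) = 0 \<longleftrightarrow> F x = 0" for x by (simp add: GK L0)
  have K0: "K x = 0 \<longleftrightarrow> x = 0" for x using MK K.zero M.zero by metis
  have M0: "M x = 0 \<longleftrightarrow> x = 0" for x using MK K.zero M.zero by metis
  show "base_additive F \<Longrightarrow> base_additive G"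
    unfolding base_additive_def by (simp add: G0 M.add)
  show "base_vertex F \<Longrightarrow> base_vertex G"
    unfolding base_vertex_def by (elim exE, rule_tac x = "K p" in exI) (simp add: G0 K0 MK M.add)
  show "base_triple F \<Longrightarrow> base_triple G"
    unfolding base_triple_def
    by (elim exE, rule_tac x = "K u" in exI, rule_tac x = "K v" in exI, rule_tac x = "K w" in exI)
      (simp add: GK0 K.add[symmetric])
  show "base_quadruple F \<Longrightarrow> base_quadruple G"
    unfolding base_quadruple_def
    by (elim exE, rule_tac x = "K u" in exI, rule_tac x = "K v" in exI, rule_tac x = "K w" in exI,
        rule_tac x = "K x" in exI) (simp add: GK0 K.add[symmetric])
  show "base_hyperplane F \<Longrightarrow> base_hyperplane G"
    unfolding base_hyperplane_def
  proof (elim exE conjE)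
    fix l x assume l: "Vector_Spaces.linear (*s) (*) l" "l x \<noteq> 0" "\<forall>v. F v = 0 \<longrightarrow> l v = 0"
    have "Vector_Spaces.linear (*s) (*) (l \<circ> M)"
      by (rule Vector_Spaces.linear_compose[OF M(1) l(1)])
    moreover have "(l \<circ> M) (K x) \<noteq> 0" using l(2) by (simp add: MK)
    moreover have "\<forall>v. G v = 0 \<longrightarrow> (l \<circ> M) v = 0" using l(3) by (simp add: G0)
    ultimately show "\<exists>l. Vector_Spaces.linear (*s) (*) l \<and> (\<exists>x. l x \<noteq> 0) \<and> (\<forall>v. G v = 0 \<longrightarrow> l v = 0)"
      by blast
  qed
  have inj: "L x = L y \<longleftrightarrow> x = y" for x y using L(2) by (simp add: bij_is_inj inj_eq)
  have crit: "critical G u \<longleftrightarrow> critical F (M u)" for u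
  proof
    assume "critical G u"
    then obtain v where "v \<noteq> 0" "G (u + v) = G u + G v" unfolding critical_def by blast
    then have "M v \<noteq> 0 \<and> F (M u + M v) = F (M u) + F (M v)"
      by (simp add: G M.add L.add[symmetric] inj M0)
    then show "critical F (M u)" unfolding critical_def by blast
  next
    assume "critical F (M u)"
    then obtain v where "v \<noteq> 0" "F (M u + v) = F (M u) + F v" unfolding critical_def by blast
    then have "K v \<noteq> 0 \<and> G (u + K v) = G u + G (K v)"
      by (simp add: G M.add MK L.add[symmetric] K0)
    then show "critical G u" unfolding critical_def by blast
  qed
  show "critical_additive F \<Longrightarrow> critical_additive G"
    unfolding critical_additive_def by (simp add: crit M.add)
qed

lemma invariants_eq:
  assumes "strongly_equivalent F G"
  shows "base_additive F = base_additive G" "base_vertex F = base_vertex G"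
    "base_triple F = base_triple G" "base_quadruple F = base_quadruple G"
    "base_hyperplane F = base_hyperplane G" "critical_additive F = critical_additive G"
  using invariants_imp[OF assms] invariants_imp[OF strongly_equivalent_sym[OF assms]] by blast+

abbreviation vec4 :: "complex \<Rightarrow> complex \<Rightarrow> complex \<Rightarrow> complex \<Rightarrow> complex^4" where
  "vec4 a b c d \<equiv> vector [a, b, c, d]"

lemma Q_eq_0:
  "Q1 v = 0 \<longleftrightarrow> (v $ 2)\<^sup>2 + (v $ 3)\<^sup>2 + (v $ 4)\<^sup>2 = 0 \<and> (v $ 1 = 0 \<or> v $ 2 = 0 \<and> v $ 3 = 0 \<and> v $ 4 = 0)"
  "Q2 v = 0 \<longleftrightarrow> (v $ 2 = 0 \<or> v $ 3 = 0) \<and> (v $ 1 = 0 \<or> v $ 2 = 0 \<and> v $ 3 = 0 \<and> v $ 4 = 0)"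
  "Q3 v = 0 \<longleftrightarrow> v $ 2 = 0 \<and> (v $ 1 = 0 \<or> v $ 3 = 0 \<and> v $ 4 = 0)"
  "Q4 v = 0 \<longleftrightarrow> v $ 1 = 0 \<and> (v $ 4)\<^sup>2 = v $ 2 * v $ 3"
  "Q5 v = 0 \<longleftrightarrow> v $ 1 = 0 \<and> (v $ 2 = 0 \<or> v $ 3 = 0)"
  "Q6 v = 0 \<longleftrightarrow> v $ 1 = 0 \<and> (v $ 2 = 0 \<or> v $ 3 = 0)"
  "Q7 v = 0 \<longleftrightarrow> v $ 1 = 0 \<and> v $ 2 = 0"
  by (auto simp: Q_defs vec_eq_iff forall_4)

lemma base_additive_Q:
  "base_additive Q7" "\<not> base_additive Q1" "\<not> base_additive Q2" "\<not> base_additive Q3"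
  "\<not> base_additive Q4" "\<not> base_additive Q5" "\<not> base_additive Q6"
proof -
  show "base_additive Q7" by (simp add: base_additive_def Q_eq_0)
  have neg: "\<not> base_additive F" if "F u = 0" "F v = 0" "F (u + v) \<noteq> 0" for F u v
    using that unfolding base_additive_def by blast
  show "\<not> base_additive Q1" by (rule neg[of _ "vec4 1 0 0 0" "vec4 0 1 \<i> 0"]) (simp_all add: Q_eq_0)
  show "\<not> base_additive Q2" by (rule neg[of _ "vec4 1 0 0 0" "vec4 0 1 0 0"]) (simp_all add: Q_eq_0)
  show "\<not> base_additive Q3" by (rule neg[of _ "vec4 1 0 0 0" "vec4 0 0 1 0"]) (simp_all add: Q_eq_0)
  show "\<not> base_additive Q4" by (rule neg[of _ "vec4 0 1 0 0" "vec4 0 0 1 0"]) (simp_all add: Q_eq_0)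
  show "\<not> base_additive Q5" by (rule neg[of _ "vec4 0 1 0 0" "vec4 0 0 1 0"]) (simp_all add: Q_eq_0)
  show "\<not> base_additive Q6" by (rule neg[of _ "vec4 0 1 0 0" "vec4 0 0 1 0"]) (simp_all add: Q_eq_0)
qed

lemma base_vertex_Q:
  "base_vertex Q5" "base_vertex Q6" "\<not> base_vertex Q1" "\<not> base_vertex Q2" "\<not> base_vertex Q3" "\<not> base_vertex Q4"
proof -
  show "base_vertex Q5" "base_vertex Q6"
    unfolding base_vertex_def Q_eq_0
    by (intro exI[of _ "vec4 0 0 0 1"]; simp add: vec_eq_iff forall_4)+
  have neg: "\<not> base_vertex F" if "F u = 0" "F v = 0" "\<And>p. F p = 0 \<Longrightarrow> F (p + u) = 0 \<Longrightarrow> F (p + v) = 0 \<Longrightarrow> p = 0" for F u v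
    using that unfolding base_vertex_def by blast
  show "\<not> base_vertex Q1"
    by (rule neg[of _ "vec4 1 0 0 0" "vec4 0 1 \<i> 0"]) (unfold Q_eq_0, auto simp: vec_eq_iff forall_4)
  show "\<not> base_vertex Q2"
    by (rule neg[of _ "vec4 1 0 0 0" "vec4 0 1 0 0"]) (unfold Q_eq_0, auto simp: vec_eq_iff forall_4)
  show "\<not> base_vertex Q3"
    by (rule neg[of _ "vec4 1 0 0 0" "vec4 0 0 1 0"]) (unfold Q_eq_0, auto simp: vec_eq_iff forall_4)
  show "\<not> base_vertex Q4"
    by (rule neg[of _ "vec4 0 1 0 0" "vec4 0 0 1 0"]) (unfold Q_eq_0, auto simp: vec_eq_iff forall_4 algebra_simps)
qed

lemma base_triple_Q: "base_triple Q1" "base_triple Q2" "base_triple Q4" "\<not> base_triple Q3"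
proof -
  show "base_triple Q1"
    unfolding base_triple_def
    by (intro exI[of _ "vec4 1 0 0 0"] exI[of _ "vec4 0 1 \<i> 0"] exI[of _ "vec4 0 1 (-\<i>) 0"]) (simp add: Q_eq_0)
  show "base_triple Q2"
    unfolding base_triple_def
    by (intro exI[of _ "vec4 1 0 0 0"] exI[of _ "vec4 0 1 0 0"] exI[of _ "vec4 0 0 1 0"]) (simp add: Q_eq_0)
  show "base_triple Q4"
    unfolding base_triple_def
    by (intro exI[of _ "vec4 0 1 0 0"] exI[of _ "vec4 0 0 1 0"] exI[of _ "vec4 0 1 1 1"]) (simp add: Q_eq_0)
  show "\<not> base_triple Q3"
    unfolding base_triple_def by (auto simp: Q_eq_0)
qed

lemma base_quadruple_Q: "base_quadruple Q1" "base_quadruple Q4" "\<not> base_quadruple Q2"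
proof -
  show "base_quadruple Q1"
    unfolding base_quadruple_def
    by (intro exI[of _ "vec4 1 0 0 0"] exI[of _ "vec4 0 1 \<i> 0"] exI[of _ "vec4 0 1 (-\<i>) 0"] exI[of _ "vec4 0 0 1 \<i>"])
      (simp add: Q_eq_0 power2_eq_square algebra_simps)
  show "base_quadruple Q4"
    unfolding base_quadruple_def
    by (intro exI[of _ "vec4 0 1 0 0"] exI[of _ "vec4 0 0 1 0"] exI[of _ "vec4 0 1 1 1"] exI[of _ "vec4 0 1 1 (-1)"])
      (simp add: Q_eq_0)
  \<comment> \<open>The three linear components of the base locus; by the pigeonhole principle two
    of four base vectors lie in the same one.\<close>
  have type: "v $ 1 = 0 \<and> v $ 2 = 0 \<or> v $ 1 = 0 \<and> v $ 3 = 0 \<or> v $ 2 = 0 \<and> v $ 3 = 0 \<and> v $ 4 = 0"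
    if "Q2 v = 0" for v using that by (auto simp: Q_eq_0)
  have same: "Q2 (u + v) = 0" if "u $ 1 = 0 \<and> u $ 2 = 0 \<and> v $ 1 = 0 \<and> v $ 2 = 0 \<or>
    u $ 1 = 0 \<and> u $ 3 = 0 \<and> v $ 1 = 0 \<and> v $ 3 = 0 \<or>
    u $ 2 = 0 \<and> u $ 3 = 0 \<and> u $ 4 = 0 \<and> v $ 2 = 0 \<and> v $ 3 = 0 \<and> v $ 4 = 0" for u v
    using that by (auto simp: Q_eq_0)
  have other: "\<not> (u $ 1 = 0 \<and> u $ 2 = 0 \<and> v $ 1 = 0 \<and> v $ 2 = 0 \<or>
    u $ 1 = 0 \<and> u $ 3 = 0 \<and> v $ 1 = 0 \<and> v $ 3 = 0 \<or>
    u $ 2 = 0 \<and> u $ 3 = 0 \<and> u $ 4 = 0 \<and> v $ 2 = 0 \<and> v $ 3 = 0 \<and> v $ 4 = 0)" if "Q2 (u + v) \<noteq> 0" for u v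
    using that same by blast
  show "\<not> base_quadruple Q2"
  proof
    assume "base_quadruple Q2"
    then obtain u v w x where 0: "Q2 u = 0" "Q2 v = 0" "Q2 w = 0" "Q2 x = 0" and
     n: "Q2 (u + v) \<noteq> 0" "Q2 (u + w) \<noteq> 0" "Q2 (v + w) \<noteq> 0" "Q2 (u + x) \<noteq> 0" "Q2 (v + x) \<noteq> 0" "Q2 (w + x) \<noteq> 0"
      unfolding base_quadruple_def by blast
    show False
      using type[OF 0(1)] type[OF 0(2)] type[OF 0(3)] type[OF 0(4)]
        other[OF n(1)] other[OF n(2)] other[OF n(3)] other[OF n(4)] other[OF n(5)] other[OF n(6)] by argo
  qed
qed

lemma base_hyperplane_Q: "base_hyperplane Q4" "\<not> base_hyperplane Q1"
proof -
  show "base_hyperplane Q4"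
    unfolding base_hyperplane_def
    by (intro exI[of _ "\<lambda>x. x $ 1"]) (auto simp: linear_vec_nth Q_eq_0 intro: exI[of _ "vec4 1 0 0 0"])
  show "\<not> base_hyperplane Q1"
  proof
    assume "base_hyperplane Q1"
    then obtain l x where l: "Vector_Spaces.linear (*s) (*) l" "l x \<noteq> 0" and z: "\<And>v. Q1 v = 0 \<Longrightarrow> l v = 0"
      unfolding base_hyperplane_def by blast
    interpret l: Vector_Spaces.linear "(*s)" "(*)" l by fact
    have 1: "l (vec4 1 0 0 0) = 0" "l (vec4 0 1 \<i> 0) = 0" "l (vec4 0 1 (-\<i>) 0) = 0" "l (vec4 0 0 1 \<i>) = 0" "l (vec4 0 0 1 (-\<i>)) = 0"
      by (rule z; simp add: Q_eq_0)+
    \<comment> \<open>The five base vectors above span the space; this is \<open>x\<close> expressed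
      by them.\<close>
    let ?y = "x $ 1 *s vec4 1 0 0 0 + (x $ 2 / 2) *s (vec4 0 1 \<i> 0 + vec4 0 1 (-\<i>) 0)
      + (x $ 3 / 2) *s (vec4 0 0 1 \<i> + vec4 0 0 1 (-\<i>)) + (x $ 4 / (2 * \<i>)) *s (vec4 0 0 1 \<i> - vec4 0 0 1 (-\<i>))"
    have "x = ?y" by (simp add: vec_eq_iff forall_4)
    moreover have "l ?y = 0" by (simp only: l.add l.scale l.diff 1) simp
    ultimately have "l x = 0" by (rule ssubst[where P = "\<lambda>z. l z = 0"])
    then show False using l(2) by simp
  qed
qed

text \<open>These two maps have the same base locus. The zero set of the Jacobian is the plane
  \<open>x = 0\<close> for \<open>Q6\<close>, but the union of the planes \<open>x = 0\<close> and
  \<open>y = 0\<close> for \<open>Q5\<close>.\<close>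

lemma critical_additive_Q: "critical_additive Q6" "\<not> critical_additive Q5"
proof -
  have "critical Q6 u \<longleftrightarrow> u $ 1 = 0" for u
  proof
    assume "critical Q6 u"
    then obtain v where v: "v \<noteq> 0" "Q6 (u + v) = Q6 u + Q6 v" unfolding critical_def by blast
    then have eq: "2 * u $ 1 * v $ 1 = 0" "u $ 1 * v $ 2 + v $ 1 * u $ 2 = 0" "u $ 1 * v $ 3 + v $ 1 * u $ 3 = 0"
      "2 * (u $ 2 * v $ 3 + v $ 2 * u $ 3) - (u $ 1 * v $ 4 + v $ 1 * u $ 4) = 0"
      by (simp_all add: Q_defs vec_eq_iff forall_4 power2_eq_square algebra_simps add_eq_0_iff)
    show "u $ 1 = 0"
    proof (rule ccontr)
      assume "u $ 1 \<noteq> 0"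
      then show False using eq v(1) by (simp add: vec_eq_iff forall_4)
    qed
  next
    assume "u $ 1 = 0"
    then show "critical Q6 u"
      unfolding critical_def by (intro exI[of _ "vec4 0 0 0 1"]) (simp add: Q_defs vec_eq_iff forall_4)
  qed
  then show "critical_additive Q6" unfolding critical_additive_def by simp
  have "critical Q5 (vec4 1 0 0 0)"
    unfolding critical_def by (intro exI[of _ "vec4 0 0 1 0"]) (simp add: Q_defs vec_eq_iff forall_4)
  moreover have "critical Q5 (vec4 0 1 0 0)"
    unfolding critical_def by (intro exI[of _ "vec4 0 0 0 1"]) (simp add: Q_defs vec_eq_iff forall_4)
  moreover have "\<not> critical Q5 (vec4 1 0 0 0 + vec4 0 1 0 0)"
  proof
    assume "critical Q5 (vec4 1 0 0 0 + vec4 0 1 0 0)"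
    then obtain v where v: "v \<noteq> 0"
      "Q5 (vec4 1 0 0 0 + vec4 0 1 0 0 + v) = Q5 (vec4 1 0 0 0 + vec4 0 1 0 0) + Q5 v" unfolding critical_def by blast
    then have "v $ 1 + v $ 2 = 0" "2 * v $ 1 = 0" "v $ 3 = 0" "v $ 4 = 0"
      by (simp_all add: Q_defs vec_eq_iff forall_4 power2_eq_square algebra_simps add_eq_0_iff)
    then show False using v(1) by (simp add: vec_eq_iff forall_4)
  qed
  ultimately show "\<not> critical_additive Q5" unfolding critical_additive_def by blast
qed

lemma Q_inequivalent:
  assumes "i < 7" "j < 7"
    "strongly_equivalent ([Q1, Q2, Q3, Q4, Q5, Q6, Q7] ! i) ([Q1, Q2, Q3, Q4, Q5, Q6, Q7] ! j)"
  shows "i = j"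
proof -
  let ?Q = "\<lambda>i. [Q1, Q2, Q3, Q4, Q5, Q6, Q7] ! i"
  note inv = invariants_eq[OF assms(3)]
  \<comment> \<open>Indices start at 0, so 6 stands for \<open>Q7\<close>. Each invariant is
    evaluated only on indices that the previous ones leave undecided.\<close>
  have "base_additive (?Q i) \<longleftrightarrow> i = 6" if "i < 7" for i
    using that base_additive_Q by (auto simp: numeral_eq_Suc less_Suc_eq)
  then have 1: "i = 6 \<longleftrightarrow> j = 6" using inv(1) assms(1,2) by blast
  have "base_vertex (?Q i) \<longleftrightarrow> i = 4 \<or> i = 5" if "i < 6" for i
    using that base_vertex_Q by (auto simp: numeral_eq_Suc less_Suc_eq)
  then have 2: "i < 6 \<Longrightarrow> j < 6 \<Longrightarrow> i = 4 \<or> i = 5 \<longleftrightarrow> j = 4 \<or> j = 5" using inv(2) by blast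
  have "base_triple (?Q i) \<longleftrightarrow> i \<noteq> 2" if "i < 4" for i
    using that base_triple_Q by (auto simp: numeral_eq_Suc less_Suc_eq)
  then have 3: "i < 4 \<Longrightarrow> j < 4 \<Longrightarrow> i = 2 \<longleftrightarrow> j = 2" using inv(3) by blast
  have "base_quadruple (?Q i) \<longleftrightarrow> i \<noteq> 1" if "i = 0 \<or> i = 1 \<or> i = 3" for i
    using that base_quadruple_Q by (auto simp: numeral_eq_Suc)
  then have 4: "i = 0 \<or> i = 1 \<or> i = 3 \<Longrightarrow> j = 0 \<or> j = 1 \<or> j = 3 \<Longrightarrow> i = 1 \<longleftrightarrow> j = 1" using inv(4) by blast
  have "base_hyperplane (?Q i) \<longleftrightarrow> i = 3" if "i = 0 \<or> i = 3" for i
    using that base_hyperplane_Q by (auto simp: numeral_eq_Suc)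
  then have 5: "i = 0 \<or> i = 3 \<Longrightarrow> j = 0 \<or> j = 3 \<Longrightarrow> i = 3 \<longleftrightarrow> j = 3" using inv(5) by blast
  have "critical_additive (?Q i) \<longleftrightarrow> i = 5" if "i = 4 \<or> i = 5" for i
    using that critical_additive_Q by (auto simp: numeral_eq_Suc)
  then have 6: "i = 4 \<or> i = 5 \<Longrightarrow> j = 4 \<or> j = 5 \<Longrightarrow> i = 5 \<longleftrightarrow> j = 5" using inv(6) by blast
  show ?thesis
    using assms(1,2) 1 2 3 4 5 6 by presburger
qed

subsection \<open>Proportional quadratic maps\<close>

lemma poly_fun_compose_linear:
  assumes "Vector_Spaces.linear s' s L" "poly_fun s p"
  shows "poly_fun s' (\<lambda>x. p (L x))"
  using assms(2)
proof induction
  case (linear l)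
  then show ?case
    using Vector_Spaces.linear_compose[OF assms(1)] by (auto intro: poly_fun.linear simp: comp_def)
qed (auto intro: poly_fun.intros)

lemma form_compose_linear:
  assumes "Vector_Spaces.linear s' s L" "form s d p"
  shows "form s' d (\<lambda>x. p (L x))"
  using assms(2) poly_fun_compose_linear[OF assms(1)] Vector_Spaces.linear.axioms(3)[OF assms(1)]
  unfolding form_def by (auto simp: module_hom_iff)

definition kill :: "4 \<Rightarrow> complex^4 \<Rightarrow> complex^4" where
  "kill i x = x - x $ i *s bas i"

lemma linear_kill: "Vector_Spaces.linear (*s) (*s) (kill i)"
  using vector_space_vec
  by (auto simp: Vector_Spaces.linear_iff kill_def vec_eq_iff algebra_simps)

lemma kill_nth: "kill i x $ j = (if j = i then 0 else x $ j)"
  by (simp add: kill_def axis_def)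

lemma poly_fun_vec_cancel:
  assumes "poly_fun (*s) p" "poly_fun (*s) q" "poly_fun (*s) r" "p y \<noteq> 0"
    and "\<And>x::complex^'n. p x * q x = p x * r x"
  shows "q x = r x"
  using poly_fun_cancel[OF vector_space_vec assms] .

text \<open>Polynomial functions on a hyperplane also form a domain; composing with the projection
  \<open>kill i\<close> reduces this to the whole space.\<close>

lemma poly_fun_eq_0_on_hyperplane:
  fixes x u :: "complex^4"
  assumes "poly_fun (*s) p" "poly_fun (*s) q" "\<And>x :: complex^4. x $ i = 0 \<Longrightarrow> p x * q x = 0" "u $ i = 0" "p u \<noteq> 0"
    and "x $ i = 0"
  shows "q x = 0"
proof -
  have k: "kill i y = y" if "y $ i = 0" for y using that by (simp add: kill_def)
  have "q (kill i x) = 0"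
  proof (rule poly_fun_vec_cancel[where p = "\<lambda>x. p (kill i x)" and y = u and r = "\<lambda>x. 0"
        and q = "\<lambda>x. q (kill i x)" and x = x])
    show "poly_fun (*s) (\<lambda>x. p (kill i x))" "poly_fun (*s) (\<lambda>x. q (kill i x))"
      by (rule poly_fun_compose_linear[OF linear_kill], fact)+
  qed (use assms k in \<open>auto simp: kill_nth intro: poly_fun.const\<close>)
  then show ?thesis using k assms(6) by simp
qed

text \<open>In the bilinear expansion of \<open>h\<close> along
  \<open>x = kill i x + x $ i *s bas i\<close> the term on the hyperplane vanishes and all others
  contain \<open>x $ i\<close>.\<close>

lemma quadratic_form_divide_coordinate:
  assumes "form (*s) 2 h" "\<And>x::complex^4. x $ i = 0 \<Longrightarrow> h x = 0"
  shows "\<exists>m. Vector_Spaces.linear (*s) (*) m \<and> (\<forall>x. h x = x $ i * m x)"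
proof -
  obtain \<beta> where \<beta>: "\<And>x. Vector_Spaces.linear (*s) (*) (\<beta> x)" "\<And>x y. \<beta> x y = \<beta> y x" "\<And>x. h x = \<beta> x x"
    using form_2_bilinear[OF vector_space_vec assms(1)] by blast
  have right: "\<beta> x (y + z) = \<beta> x y + \<beta> x z" "\<beta> x (c *s y) = c * \<beta> x y" for x y z c
    using \<beta>(1)[of x] by (simp_all add: Vector_Spaces.linear_iff)
  have left: "\<beta> (y + z) x = \<beta> y x + \<beta> z x" "\<beta> (c *s y) x = c * \<beta> y x" for x y z c
    using right \<beta>(2) by metis+
  define m where "m x = 2 * \<beta> (bas i) x - x $ i * \<beta> (bas i) (bas i)" for x
  have "Vector_Spaces.linear (*s) (*) m"
    unfolding m_def using vector_space_vec vector_space_mult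
    by (simp add: Vector_Spaces.linear_iff right algebra_simps)
  moreover have "h x = x $ i * m x" for x
  proof -
    let ?k = "kill i x"
    have x: "x = ?k + x $ i *s bas i" by (simp add: kill_def)
    have k: "\<beta> ?k ?k = 0" using assms(2)[of ?k] \<beta>(3) by (simp add: kill_nth)
    have "\<beta> x x = \<beta> (?k + x $ i *s bas i) (?k + x $ i *s bas i)" using x by simp
    also have "\<dots> = 2 * x $ i * \<beta> (bas i) ?k + x $ i * x $ i * \<beta> (bas i) (bas i)"
      by (simp add: right left k \<beta>(2)[of ?k "bas i"] algebra_simps)
    also have "\<beta> (bas i) ?k = \<beta> (bas i) x - x $ i * \<beta> (bas i) (bas i)"
      using right(1)[of "bas i" ?k "x $ i *s bas i"] unfolding x[symmetric] right(2) by simp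
    finally show ?thesis unfolding \<beta>(3) m_def by (simp add: algebra_simps)
  qed
  ultimately show ?thesis by blast
qed

lemma bas_nth: "(bas i :: complex^'n) $ j = (if i = j then 1 else 0)"
  by (simp add: axis_def)

text \<open>\<open>(x\<^sub>1 x\<^sub>p, x\<^sub>1 x\<^sub>r, x\<^sub>1 a, q)\<close> is, up to the order and signs of the coordinates, the shape of all
  seven quadratic maps.\<close>

lemma proportional_quadratic_forms:
  fixes h1 h2 h3 h4 :: "complex^4 \<Rightarrow> complex"
  assumes h: "form (*s) 2 h1" "form (*s) 2 h2" "form (*s) 2 h3" "form (*s) 2 h4"
    and a: "poly_fun (*s) a" and q: "poly_fun (*s) q" and "p \<noteq> r"
    and h2: "\<And>x. x $ 1 * x $ p * h2 x = x $ 1 * x $ r * h1 x"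
    and h3: "\<And>x. x $ 1 * x $ p * h3 x = x $ 1 * a x * h1 x"
    and h4: "\<And>x. x $ 1 * x $ p * h4 x = q x * h1 x"
    and u: "u $ 1 = 0" "q u \<noteq> 0"
  shows "\<exists>c. \<forall>x. h1 x = c * (x $ 1 * x $ p) \<and> h2 x = c * (x $ 1 * x $ r) \<and> h3 x = c * (x $ 1 * a x) \<and> h4 x = c * q x"
proof -
  have pf: "poly_fun (*s) h1" "poly_fun (*s) h2" "poly_fun (*s) h3" "poly_fun (*s) h4"
    using h unfolding form_def by blast+
  have 2: "x $ p * h2 x = x $ r * h1 x" for x
    by (rule poly_fun_vec_cancel[where p = "\<lambda>x. x $ 1" and y = "bas 1"])
      (auto intro!: poly_fun.mult poly_fun_nth pf simp: h2 mult.assoc[symmetric] bas_nth)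
  \<comment> \<open>As \<open>p \<noteq> r\<close>, \<open>x $ r\<close> does not vanish identically
    on the hyperplane \<open>x $ p = 0\<close>, so \<open>h1\<close> does.\<close>
  have "h1 x = 0" if "x $ p = 0" for x
    by (rule poly_fun_eq_0_on_hyperplane[OF poly_fun_nth[of r] pf(1), of p "bas r"])
      (use \<open>p \<noteq> r\<close> that 2[symmetric] in \<open>auto simp: bas_nth\<close>)
  then obtain m where m: "Vector_Spaces.linear (*s) (*) m" "\<And>x. h1 x = x $ p * m x"
    using quadratic_form_divide_coordinate[OF h(1)] by metis
  have pm: "poly_fun (*s) m" by (rule poly_fun.linear[OF m(1)])
  have h2': "h2 x = x $ r * m x" for x
    by (rule poly_fun_vec_cancel[where p = "\<lambda>x. x $ p" and y = "bas p"])
      (auto intro!: poly_fun.mult poly_fun_nth pf pm simp: 2 m(2) bas_nth)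
  have h3': "h3 x = a x * m x" for x
    by (rule poly_fun_vec_cancel[where p = "\<lambda>x. x $ 1 * x $ p" and y = "bas 1 + bas p"])
      (auto intro!: poly_fun.mult poly_fun_nth pf pm a simp: h3 m(2) bas_nth)
  have h4': "x $ 1 * h4 x = q x * m x" for x
  proof (rule poly_fun_vec_cancel[where p = "\<lambda>x. x $ p" and y = "bas p"])
    show "x $ p * (x $ 1 * h4 x) = x $ p * (q x * m x)" for x
      using h4[of x] unfolding m(2) by (simp only: ac_simps)
  qed (auto intro!: poly_fun.mult poly_fun_nth pf pm q simp: bas_nth)
  \<comment> \<open>\<open>q\<close> is not identically zero on \<open>x $ 1 = 0\<close>, so the
    linear form \<open>m\<close> vanishes there and is a multiple of \<open>x $ 1\<close>.\<close>
  have m0: "m x = 0" if "x $ 1 = 0" for x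
  proof (rule poly_fun_eq_0_on_hyperplane[OF q pm _ u that])
    show "q x * m x = 0" if "x $ 1 = 0" for x using h4'[of x] that by simp
  qed
  have m': "m x = m (bas 1) * x $ 1" for x
  proof -
    interpret m: Vector_Spaces.linear "(*s)" "(*)" m by (rule m(1))
    have "m x = m (kill 1 x + x $ 1 *s bas 1)" by (simp add: kill_def)
    also have "\<dots> = m (bas 1) * x $ 1" using m0[of "kill 1 x"] by (simp add: m.add m.scale kill_nth)
    finally show ?thesis .
  qed
  have h4'': "h4 x = m (bas 1) * q x" for x
  proof (rule poly_fun_vec_cancel[where p = "\<lambda>x. x $ 1" and y = "bas 1"])
    show "x $ 1 * h4 x = x $ 1 * (m (bas 1) * q x)" for x
      using h4'[of x] m'[of x] by (simp only: ac_simps)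
  qed (auto intro!: poly_fun_cmult poly_fun_nth pf q simp: bas_nth)
  show ?thesis
  proof (intro exI[of _ "m (bas 1)"] allI)
    fix x
    show "h1 x = m (bas 1) * (x $ 1 * x $ p) \<and> h2 x = m (bas 1) * (x $ 1 * x $ r) \<and>
      h3 x = m (bas 1) * (x $ 1 * a x) \<and> h4 x = m (bas 1) * q x"
      unfolding m(2) h2' h3' h4'' m'[of x] by (simp only: ac_simps simp_thms)
  qed
qed

lemma form_uminus: "form s d p \<Longrightarrow> form s d (\<lambda>x. - p x)"
  unfolding form_def using poly_fun_minus by auto

text \<open>The entries of \<open>Q\<close> have no common factor, so two tuples of equal degree can
  differ only by a constant. Each case selects the entries serving as \<open>h1\<close> to
  \<open>h4\<close> and moves the signs of \<open>Q\<close> to \<open>H\<close>.\<close>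

lemma proportional_to_Q:
  fixes H :: "complex^4 \<Rightarrow> complex^4"
  assumes H: "\<And>i. form (*s) 2 (\<lambda>x. H x $ i)" and Q: "Q \<in> {Q1, Q2, Q3, Q4, Q5, Q6, Q7}" and same: "same_ratmap Q H"
  shows "\<exists>c. \<forall>x. H x = c *s Q x"
proof -
  have s: "Q x $ i * H x $ j = Q x $ j * H x $ i" for x i j
    using same unfolding same_ratmap_def by blast
  note Hm = form_uminus[OF H]
  note pf = poly_fun_intros(3-) poly_fun_nth poly_fun.const
  note eqs = Q_defs vec_eq_iff forall_4
  have minus: "- a = b \<longleftrightarrow> a = - b" for a b :: complex by auto
  consider "Q = Q1" | "Q = Q2" | "Q = Q3" | "Q = Q4" | "Q = Q5" | "Q = Q6" | "Q = Q7"
    using Q by blast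
  then show ?thesis
  proof cases
    case 1
    have "\<exists>c. \<forall>x. H x $ 2 = c * (x $ 1 * x $ 2) \<and> - H x $ 3 = c * (x $ 1 * x $ 3) \<and>
      - H x $ 4 = c * (x $ 1 * x $ 4) \<and> H x $ 1 = c * ((x $ 2)\<^sup>2 + (x $ 3)\<^sup>2 + (x $ 4)\<^sup>2)"
    proof (rule proportional_quadratic_forms[OF H[of 2] Hm[of 3] Hm[of 4] H[of 1]])
      show "poly_fun (*s) (\<lambda>x. (x $ 2)\<^sup>2 + (x $ 3)\<^sup>2 + (x $ 4)\<^sup>2 :: complex)" by (auto intro!: pf)
      show "((vec4 0 1 0 0) $ 2)\<^sup>2 + ((vec4 0 1 0 0) $ 3)\<^sup>2 + ((vec4 0 1 0 0) $ 4)\<^sup>2 \<noteq> 0" "(vec4 0 1 0 0) $ 1 = 0" by simp_all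
    qed (use s[of _ 2 3] s[of _ 2 4] s[of _ 2 1] in \<open>auto intro: poly_fun_nth simp: 1 Q_defs power2_eq_square\<close>)
    then show ?thesis unfolding 1 by (auto simp: eqs minus power2_eq_square)
  next
    case 2
    have "\<exists>c. \<forall>x. H x $ 2 = c * (x $ 1 * x $ 3) \<and> H x $ 3 = c * (x $ 1 * x $ 2) \<and>
      H x $ 4 = c * (x $ 1 * x $ 4) \<and> H x $ 1 = c * (x $ 2 * x $ 3)"
    proof (rule proportional_quadratic_forms[OF H[of 2] H[of 3] H[of 4] H[of 1]])
      show "poly_fun (*s) (\<lambda>x. x $ 2 * x $ 3 :: complex)" by (auto intro!: pf)
      show "(vec4 0 1 1 0) $ 2 * (vec4 0 1 1 0) $ 3 \<noteq> 0" "(vec4 0 1 1 0) $ 1 = 0" by simp_all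
    qed (use s[of _ 2 3] s[of _ 2 4] s[of _ 2 1] in \<open>auto intro: poly_fun_nth simp: 2 Q_defs power2_eq_square\<close>)
    then show ?thesis unfolding 2 by (auto simp: eqs minus power2_eq_square)
  next
    case 3
    have "\<exists>c. \<forall>x. H x $ 2 = c * (x $ 1 * x $ 2) \<and> H x $ 3 = c * (x $ 1 * x $ 3) \<and>
      H x $ 4 = c * (x $ 1 * x $ 4) \<and> H x $ 1 = c * ((x $ 2)\<^sup>2)"
    proof (rule proportional_quadratic_forms[OF H[of 2] H[of 3] H[of 4] H[of 1]])
      show "poly_fun (*s) (\<lambda>x. (x $ 2)\<^sup>2 :: complex)" by (auto intro!: pf)
      show "((vec4 0 1 0 0) $ 2)\<^sup>2 \<noteq> 0" "(vec4 0 1 0 0) $ 1 = 0" by simp_all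
    qed (use s[of _ 2 3] s[of _ 2 4] s[of _ 2 1] in \<open>auto intro: poly_fun_nth simp: 3 Q_defs power2_eq_square\<close>)
    then show ?thesis unfolding 3 by (auto simp: eqs minus power2_eq_square)
  next
    case 4
    have "\<exists>c. \<forall>x. H x $ 1 = c * (x $ 1 * x $ 2) \<and> H x $ 2 = c * (x $ 1 * x $ 1) \<and>
      H x $ 4 = c * (x $ 1 * x $ 4) \<and> H x $ 3 = c * ((x $ 4)\<^sup>2 - x $ 2 * x $ 3)"
    proof (rule proportional_quadratic_forms[OF H[of 1] H[of 2] H[of 4] H[of 3]])
      show "poly_fun (*s) (\<lambda>x. (x $ 4)\<^sup>2 - x $ 2 * x $ 3 :: complex)" by (auto intro!: pf)
      show "((vec4 0 0 0 1) $ 4)\<^sup>2 - (vec4 0 0 0 1) $ 2 * (vec4 0 0 0 1) $ 3 \<noteq> 0" "(vec4 0 0 0 1) $ 1 = 0" by simp_all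
    qed (use s[of _ 1 2] s[of _ 1 4] s[of _ 1 3] in \<open>auto intro: poly_fun_nth simp: 4 Q_defs power2_eq_square\<close>)
    then show ?thesis unfolding 4 by (auto simp: eqs minus power2_eq_square)
  next
    case 5
    have "\<exists>c. \<forall>x. H x $ 1 = c * (x $ 1 * x $ 2) \<and> H x $ 2 = c * (x $ 1 * x $ 1) \<and>
      H x $ 4 = c * (x $ 1 * x $ 4) \<and> H x $ 3 = c * (x $ 2 * x $ 3)"
    proof (rule proportional_quadratic_forms[OF H[of 1] H[of 2] H[of 4] H[of 3]])
      show "poly_fun (*s) (\<lambda>x. x $ 2 * x $ 3 :: complex)" by (auto intro!: pf)
      show "(vec4 0 1 1 0) $ 2 * (vec4 0 1 1 0) $ 3 \<noteq> 0" "(vec4 0 1 1 0) $ 1 = 0" by simp_all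
    qed (use s[of _ 1 2] s[of _ 1 4] s[of _ 1 3] in \<open>auto intro: poly_fun_nth simp: 5 Q_defs power2_eq_square\<close>)
    then show ?thesis unfolding 5 by (auto simp: eqs minus power2_eq_square)
  next
    case 6
    have "\<exists>c. \<forall>x. H x $ 1 = c * (x $ 1 * x $ 1) \<and> - H x $ 2 = c * (x $ 1 * x $ 2) \<and>
      - H x $ 3 = c * (x $ 1 * x $ 3) \<and> H x $ 4 = c * (2 * x $ 2 * x $ 3 - x $ 1 * x $ 4)"
    proof (rule proportional_quadratic_forms[OF H[of 1] Hm[of 2] Hm[of 3] H[of 4]])
      show "poly_fun (*s) (\<lambda>x. 2 * x $ 2 * x $ 3 - x $ 1 * x $ 4 :: complex)" by (auto intro!: pf)
      show "2 * (vec4 0 1 1 0) $ 2 * (vec4 0 1 1 0) $ 3 - (vec4 0 1 1 0) $ 1 * (vec4 0 1 1 0) $ 4 \<noteq> 0" "(vec4 0 1 1 0) $ 1 = 0" by simp_all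
    qed (use s[of _ 1 2] s[of _ 1 3] s[of _ 1 4] in \<open>auto intro: poly_fun_nth simp: 6 Q_defs power2_eq_square\<close>)
    then show ?thesis unfolding 6 by (auto simp: eqs minus power2_eq_square)
  next
    case 7
    have "\<exists>c. \<forall>x. H x $ 1 = c * (x $ 1 * x $ 1) \<and> - H x $ 2 = c * (x $ 1 * x $ 2) \<and>
      - H x $ 3 = c * (x $ 1 * x $ 3) \<and> H x $ 4 = c * ((x $ 2)\<^sup>2 - x $ 1 * x $ 4)"
    proof (rule proportional_quadratic_forms[OF H[of 1] Hm[of 2] Hm[of 3] H[of 4]])
      show "poly_fun (*s) (\<lambda>x. (x $ 2)\<^sup>2 - x $ 1 * x $ 4 :: complex)" by (auto intro!: pf)
      show "((vec4 0 1 0 0) $ 2)\<^sup>2 - (vec4 0 1 0 0) $ 1 * (vec4 0 1 0 0) $ 4 \<noteq> 0" "(vec4 0 1 0 0) $ 1 = 0" by simp_all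
    qed (use s[of _ 1 2] s[of _ 1 3] s[of _ 1 4] in \<open>auto intro: poly_fun_nth simp: 7 Q_defs power2_eq_square\<close>)
    then show ?thesis unfolding 7 by (auto simp: eqs minus power2_eq_square)
  qed
qed

lemma form_linear_image:
  fixes F :: "'a::ab_group_add \<Rightarrow> complex^'n"
  assumes "\<And>i. form s d (\<lambda>x. F x $ i)" "Vector_Spaces.linear (*s) (*) l"
  shows "form s d (\<lambda>x. l (F x))"
proof -
  interpret l: Vector_Spaces.linear "(*s)" "(*)" l by fact
  have l: "l y = (\<Sum>i\<in>UNIV. l (bas i) * y $ i)" for y
    using arg_cong[OF basis_expansion[of y], of l] by (simp add: l.sum l.scale mult.commute)
  have "poly_fun s (\<lambda>x. \<Sum>i\<in>UNIV. l (bas i) * F x $ i)"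
    using assms(1) unfolding form_def by (intro poly_fun_sum poly_fun_cmult) blast
  moreover have "F (s c x) = c ^ d *s F x" for c x
    using assms(1) unfolding form_def by (simp add: vec_eq_iff)
  ultimately show ?thesis
    unfolding form_def l[symmetric] by (simp add: l.scale)
qed

lemma quadratic_map_compose_linear:
  fixes F :: "complex^4 \<Rightarrow> complex^4"
  assumes "\<And>i. form (*s) 2 (\<lambda>x. F x $ i)" "Vector_Spaces.linear (*s) (*s) L" "Vector_Spaces.linear (*s) (*s) M"
  shows "form (*s) 2 (\<lambda>x. L (F (M x)) $ i)"
proof -
  have "Vector_Spaces.linear (*s) (*) (\<lambda>y. L y $ i)"
    using Vector_Spaces.linear_compose[OF assms(2) linear_vec_nth] by (simp add: comp_def)
  from form_compose_linear[OF assms(3) form_linear_image[OF assms(1) this]] show ?thesis .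
qed

lemma coprime_quadratic_nonzero:
  fixes F :: "complex^4 \<Rightarrow> complex^4"
  assumes "coprime_quadratic_forms F"
  shows "\<exists>x. F x \<noteq> 0"
proof (rule ccontr)
  assume "\<nexists>x. F x \<noteq> 0"
  then have "\<forall>i. \<exists>q. poly_fun (*s) q \<and> (\<forall>x. F x $ i = x $ 1 * q x)"
    by (intro allI exI[of _ "\<lambda>x. 0"]) (auto intro: poly_fun.const)
  moreover have "\<nexists>c. \<forall>x::complex^4. x $ 1 = c"
    by (metis vector_4(1) zero_neq_one)
  ultimately show False
    using assms poly_fun_nth[of 1] unfolding coprime_quadratic_forms_def by blast
qed

text \<open>The proportionality constant is nonzero because \<open>F\<close> is not the zero map,
  and is absorbed into the left linear map.\<close>

lemma linearly_imp_strongly_equivalent: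
  assumes F: "coprime_quadratic_forms F" and Q: "Q \<in> {Q1, Q2, Q3, Q4, Q5, Q6, Q7}" and "linearly_equivalent F Q"
  shows "strongly_equivalent F Q"
proof -
  obtain L M where L: "Vector_Spaces.linear (*s) (*s) L" "bij L" and M: "Vector_Spaces.linear (*s) (*s) M" "bij M"
    and s: "same_ratmap Q (L \<circ> F \<circ> M)"
    using assms(3) unfolding linearly_equivalent_def by blast
  interpret L: Vector_Spaces.linear "(*s)" "(*s)" L by (rule L(1))
  have "form (*s) 2 (\<lambda>x. (L \<circ> F \<circ> M) x $ i)" for i
    using quadratic_map_compose_linear[OF _ L(1) M(1), of F] F
    unfolding coprime_quadratic_forms_def by simp
  from proportional_to_Q[OF this Q s] obtain c where c: "\<And>x. L (F (M x)) = c *s Q x" by auto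
  obtain x where x: "F x \<noteq> 0" using coprime_quadratic_nonzero[OF F] by blast
  have "L (F x) \<noteq> 0" using x L(2) L.zero by (metis bij_is_inj injD)
  moreover have "M (inv M x) = x" using M(2) by (simp add: bij_is_surj surj_f_inv_f)
  ultimately have "c \<noteq> 0" using c[of "inv M x"] by auto
  have "Vector_Spaces.linear (*s) (*s) (\<lambda>x. inverse c *s L x)"
    using vector_space_vec by (simp add: Vector_Spaces.linear_iff L.add L.scale vec.scale_right_distrib mult.commute)
  moreover have "bij (\<lambda>x. inverse c *s L x)"
  proof (rule o_bij[of "\<lambda>x. inv L (c *s x)"])
    show "(\<lambda>x. inv L (c *s x)) \<circ> (\<lambda>x. inverse c *s L x) = id"
      using \<open>c \<noteq> 0\<close> L(2) by (simp add: fun_eq_iff bij_is_inj)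
    show "(\<lambda>x. inverse c *s L x) \<circ> (\<lambda>x. inv L (c *s x)) = id"
      using \<open>c \<noteq> 0\<close> L(2) by (simp add: fun_eq_iff bij_is_surj surj_f_inv_f)
  qed
  moreover have "Q x = inverse c *s L (F (M x))" for x
    using c[of x] \<open>c \<noteq> 0\<close> by simp
  ultimately show ?thesis
    unfolding strongly_equivalent_def using M
    by (intro exI[of _ "\<lambda>x. inverse c *s L x"] exI[of _ M]) simp
qed

subsection \<open>The seven quadratic maps are quadro-quadric\<close>

text \<open>A zero of the common factor would be a zero of \<open>F\<close>, so on such a line the
  factor is a polynomial without roots, hence constant.\<close>

lemma common_factor_constant_on_line:
  fixes F :: "complex^'n \<Rightarrow> complex^'n"
  assumes p: "poly_fun (*s) p" "\<And>i. \<exists>q. poly_fun (*s) q \<and> (\<forall>x. F x $ i = p x * q x)"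
    and ne: "\<And>t. F ((1 - t) *s u + t *s w) \<noteq> 0"
  shows "p u = p w"
proof -
  obtain P where P: "\<And>t. p ((1 - t) *s u + t *s w) = poly P t"
    using poly_fun_line_through[OF vector_space_vec p(1)] by blast
  have "poly P t \<noteq> 0" for t
  proof
    assume "poly P t = 0"
    then have "F ((1 - t) *s u + t *s w) $ i = 0" for i
      using p(2)[of i] P[of t] by auto
    then show False using ne[of t] by (simp add: vec_eq_iff)
  qed
  then have "constant (poly P)" using fundamental_theorem_of_algebra by blast
  then have "poly P 0 = poly P 1" unfolding constant_def by blast
  then show ?thesis using P[of 0] P[of 1] by simp
qed

text \<open>The last hypothesis asks to join a general point to a fixed \<open>z\<close> by a chain
  of lines that avoid the base locus. This is possible because the base loci have codimension
  two.\<close>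

lemma coprime_quadratic_formsI:
  fixes F :: "complex^'n \<Rightarrow> complex^'n"
  assumes "\<And>i. form (*s) 2 (\<lambda>x. F x $ i)" and D: "poly_fun (*s) D" "D y \<noteq> 0"
    and "\<And>p x. (\<And>u w. (\<And>t. F ((1 - t) *s u + t *s w) \<noteq> 0) \<Longrightarrow> p u = p w) \<Longrightarrow> D x \<noteq> 0 \<Longrightarrow> p x = (p z :: complex)"
  shows "coprime_quadratic_forms F"
proof -
  have "\<exists>c. \<forall>x. p x = c" if p: "poly_fun (*s) p" "\<forall>i. \<exists>q. poly_fun (*s) q \<and> (\<forall>x. F x $ i = p x * q x)" for p
  proof -
    have "p u = p w" if "\<And>t. F ((1 - t) *s u + t *s w) \<noteq> 0" for u w
      using common_factor_constant_on_line[OF p(1), where F = F and u = u and w = w] p(2) that by blast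
    then have "p x = p z" if "D x \<noteq> 0" for x
      using assms(4)[of p x] that by blast
    then have "generically (*s) (\<lambda>x. p x = p z)"
      unfolding generically_def using D by blast
    then have "p x = p z" for x
      using poly_fun_eq_if_generically_eq[OF vector_space_vec p(1) poly_fun.const] by blast
    then show ?thesis by blast
  qed
  then show ?thesis
    unfolding coprime_quadratic_forms_def using assms(1) by blast
qed

lemma forms_Q:
  assumes "Q \<in> {Q1, Q2, Q3, Q4, Q5, Q6, Q7}"
  shows "form (*s) 2 (\<lambda>x. Q x $ i)"
proof -
  note pf = poly_fun_intros(3-) poly_fun_nth poly_fun.const
  have "i = 1 \<or> i = 2 \<or> i = 3 \<or> i = 4" using exhaust_4 by blast
  then show ?thesis
    using assms
    by (elim disjE insertE emptyE; simp add: Q_defs form_def power2_eq_square algebra_simps; (intro pf)?)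
qed

lemma coprime_Q:
  assumes "Q \<in> {Q1, Q2, Q3, Q4, Q5, Q6, Q7}"
  shows "coprime_quadratic_forms Q"
proof -
  note pf = poly_fun.mult poly_fun_nth
  consider "Q = Q1" | "Q = Q2" | "Q = Q3" | "Q = Q4" | "Q = Q5" | "Q = Q6" | "Q = Q7"
    using assms by blast
  then show ?thesis
  proof cases
    case 1
    show ?thesis
    proof (rule coprime_quadratic_formsI[OF forms_Q[OF assms], where D = "\<lambda>x::complex^4. x $ 1 * x $ 3" and y = "vec4 1 0 1 0" and z = "vec4 1 1 1 0"])
      fix p and x :: "complex^4" assume l: "\<And>u w. (\<And>t. Q ((1 - t) *s u + t *s w) \<noteq> 0) \<Longrightarrow> p u = (p w :: complex)" and "x $ 1 * x $ 3 \<noteq> 0"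
      then have "x $ 1 \<noteq> 0" "x $ 3 \<noteq> 0" by simp_all
      \<comment> \<open>On each line of the chain, the coordinates that stay fixed already exclude
        both the conic and the isolated point.\<close>
      have "p x = p (vec4 (x $ 1) 0 (x $ 3) 0)"
        by (rule l) (use \<open>x $ 1 \<noteq> 0\<close> \<open>x $ 3 \<noteq> 0\<close> in \<open>simp add: 1 Q_eq_0 algebra_simps\<close>)
      also have "\<dots> = p (vec4 1 0 (x $ 3) 0)"
        by (rule l) (use \<open>x $ 3 \<noteq> 0\<close> in \<open>simp add: 1 Q_eq_0 algebra_simps\<close>)
      also have "\<dots> = p (vec4 1 1 (x $ 3) 0)"
        by (rule l) (use \<open>x $ 3 \<noteq> 0\<close> in \<open>simp add: 1 Q_eq_0 algebra_simps\<close>)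
      also have "\<dots> = p (vec4 1 1 1 0)"
        by (rule l) (simp add: 1 Q_eq_0 algebra_simps)
      finally show "p x = p (vec4 1 1 1 0)" .
    qed (auto intro: pf)
  next
    case 2
    show ?thesis
    proof (rule coprime_quadratic_formsI[OF forms_Q[OF assms], where D = "\<lambda>x::complex^4. x $ 1 * x $ 2" and y = "vec4 1 1 0 0" and z = "vec4 1 1 1 1"])
      fix p and x :: "complex^4" assume l: "\<And>u w. (\<And>t. Q ((1 - t) *s u + t *s w) \<noteq> 0) \<Longrightarrow> p u = (p w :: complex)" and "x $ 1 * x $ 2 \<noteq> 0"
      then have "x $ 1 \<noteq> 0" "x $ 2 \<noteq> 0" by simp_all
      have "p x = p (vec4 (x $ 1) (x $ 2) 1 1)"
        by (rule l) (use \<open>x $ 1 \<noteq> 0\<close> \<open>x $ 2 \<noteq> 0\<close> in \<open>simp add: 2 Q_eq_0 algebra_simps\<close>)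
      also have "\<dots> = p (vec4 (x $ 1) 1 1 1)"
        by (rule l) (use \<open>x $ 1 \<noteq> 0\<close> in \<open>simp add: 2 Q_eq_0 algebra_simps\<close>)
      also have "\<dots> = p (vec4 1 1 1 1)"
        by (rule l) (simp add: 2 Q_eq_0 algebra_simps)
      finally show "p x = p (vec4 1 1 1 1)" .
    qed (auto intro: pf)
  next
    case 3
    show ?thesis
    proof (rule coprime_quadratic_formsI[OF forms_Q[OF assms], where D = "\<lambda>x::complex^4. x $ 2" and y = "vec4 1 1 0 0" and z = "vec4 1 1 1 1"])
      fix p and x :: "complex^4" assume l: "\<And>u w. (\<And>t. Q ((1 - t) *s u + t *s w) \<noteq> 0) \<Longrightarrow> p u = (p w :: complex)" and "x $ 2 \<noteq> 0"
      have "p x = p (vec4 1 (x $ 2) 1 1)"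
        by (rule l) (use \<open>x $ 2 \<noteq> 0\<close> in \<open>simp add: 3 Q_eq_0 algebra_simps\<close>)
      also have "\<dots> = p (vec4 1 1 1 1)"
        by (rule l) (simp add: 3 Q_eq_0 algebra_simps)
      finally show "p x = p (vec4 1 1 1 1)" .
    qed (auto intro: pf)
  next
    case 4
    show ?thesis
    proof (rule coprime_quadratic_formsI[OF forms_Q[OF assms], where D = "\<lambda>x::complex^4. x $ 1" and y = "vec4 1 1 0 0" and z = "vec4 1 0 0 1"])
      fix p and x :: "complex^4" assume l: "\<And>u w. (\<And>t. Q ((1 - t) *s u + t *s w) \<noteq> 0) \<Longrightarrow> p u = (p w :: complex)" and "x $ 1 \<noteq> 0"
      have "p x = p (vec4 (x $ 1) 0 0 1)"
        by (rule l) (use \<open>x $ 1 \<noteq> 0\<close> in \<open>simp add: 4 Q_eq_0 algebra_simps\<close>)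
      also have "\<dots> = p (vec4 1 0 0 1)"
        by (rule l) (simp add: 4 Q_eq_0)
      finally show "p x = p (vec4 1 0 0 1)" .
    qed (auto intro: pf)
  next
    case 5
    show ?thesis
    proof (rule coprime_quadratic_formsI[OF forms_Q[OF assms], where D = "\<lambda>x::complex^4. x $ 1" and y = "vec4 1 1 0 0" and z = "vec4 1 1 1 0"])
      fix p and x :: "complex^4" assume l: "\<And>u w. (\<And>t. Q ((1 - t) *s u + t *s w) \<noteq> 0) \<Longrightarrow> p u = (p w :: complex)" and "x $ 1 \<noteq> 0"
      have "p x = p (vec4 (x $ 1) 1 1 0)"
        by (rule l) (use \<open>x $ 1 \<noteq> 0\<close> in \<open>simp add: 5 Q_eq_0 algebra_simps\<close>)
      also have "\<dots> = p (vec4 1 1 1 0)"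
        by (rule l) (simp add: 5 Q_eq_0)
      finally show "p x = p (vec4 1 1 1 0)" .
    qed (auto intro: pf)
  next
    case 6
    show ?thesis
    proof (rule coprime_quadratic_formsI[OF forms_Q[OF assms], where D = "\<lambda>x::complex^4. x $ 1" and y = "vec4 1 1 0 0" and z = "vec4 1 1 1 0"])
      fix p and x :: "complex^4" assume l: "\<And>u w. (\<And>t. Q ((1 - t) *s u + t *s w) \<noteq> 0) \<Longrightarrow> p u = (p w :: complex)" and "x $ 1 \<noteq> 0"
      have "p x = p (vec4 (x $ 1) 1 1 0)"
        by (rule l) (use \<open>x $ 1 \<noteq> 0\<close> in \<open>simp add: 6 Q_eq_0 algebra_simps\<close>)
      also have "\<dots> = p (vec4 1 1 1 0)"
        by (rule l) (simp add: 6 Q_eq_0)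
      finally show "p x = p (vec4 1 1 1 0)" .
    qed (auto intro: pf)
  next
    case 7
    show ?thesis
    proof (rule coprime_quadratic_formsI[OF forms_Q[OF assms], where D = "\<lambda>x::complex^4. x $ 1" and y = "vec4 1 1 0 0" and z = "vec4 1 1 0 0"])
      fix p and x :: "complex^4" assume l: "\<And>u w. (\<And>t. Q ((1 - t) *s u + t *s w) \<noteq> 0) \<Longrightarrow> p u = (p w :: complex)" and "x $ 1 \<noteq> 0"
      have "p x = p (vec4 (x $ 1) 1 0 0)"
        by (rule l) (use \<open>x $ 1 \<noteq> 0\<close> in \<open>simp add: 7 Q_eq_0 algebra_simps\<close>)
      also have "\<dots> = p (vec4 1 1 0 0)"
        by (rule l) (simp add: 7 Q_eq_0)
      finally show "p x = p (vec4 1 1 0 0)" .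
    qed (auto intro: pf)
  qed
qed

text \<open>Each map is its own inverse, as for adjoints applying the map twice gives the norm times
  the identity. The cubic factors below are the norms in the coordinates of
  \<open>Q\<close>.\<close>

lemma quadro_quadric_Q:
  assumes "Q \<in> {Q1, Q2, Q3, Q4, Q5, Q6, Q7}"
  shows "quadro_quadric_cremona Q"
proof -
  have "same_ratmap (Q \<circ> Q) id"
    unfolding same_ratmap_def
  proof (intro allI)
    fix x i j
    have "\<exists>N. Q (Q x) = N *s x"
    proof -
      consider "Q = Q1" | "Q = Q2" | "Q = Q3" | "Q = Q4" | "Q = Q5" | "Q = Q6" | "Q = Q7"
        using assms by blast
      then show ?thesis
      proof cases
        case 1 then show ?thesis
          by (intro exI[of _ "x $ 1 * ((x $ 2)\<^sup>2 + (x $ 3)\<^sup>2 + (x $ 4)\<^sup>2)"])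
            (simp add: Q_defs vec_eq_iff forall_4 power2_eq_square algebra_simps)
      next
        case 2 then show ?thesis
          by (intro exI[of _ "x $ 1 * x $ 2 * x $ 3"]) (simp add: Q_defs vec_eq_iff forall_4 power2_eq_square algebra_simps)
      next
        case 3 then show ?thesis
          by (intro exI[of _ "x $ 1 * x $ 2 * x $ 2"]) (simp add: Q_defs vec_eq_iff forall_4 power2_eq_square algebra_simps)
      next
        case 4 then show ?thesis
          by (intro exI[of _ "x $ 1 * x $ 1 * x $ 2"]) (simp add: Q_defs vec_eq_iff forall_4 power2_eq_square algebra_simps)
      next
        case 5 then show ?thesis
          by (intro exI[of _ "x $ 1 * x $ 1 * x $ 2"]) (simp add: Q_defs vec_eq_iff forall_4 power2_eq_square algebra_simps)
      next
        case 6 then show ?thesis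
          by (intro exI[of _ "x $ 1 * x $ 1 * x $ 1"]) (simp add: Q_defs vec_eq_iff forall_4 power2_eq_square algebra_simps)
      next
        case 7 then show ?thesis
          by (intro exI[of _ "x $ 1 * x $ 1 * x $ 1"]) (simp add: Q_defs vec_eq_iff forall_4 power2_eq_square algebra_simps)
      qed
    qed
    then obtain N where "Q (Q x) = N *s x" ..
    then show "(Q \<circ> Q) x $ i * id x $ j = (Q \<circ> Q) x $ j * id x $ i" by simp
  qed
  moreover have "Q (Q (vec4 1 1 1 1)) \<noteq> 0"
    using assms by (elim insertE emptyE; simp add: Q_defs vec_eq_iff forall_4)
  ultimately show ?thesis
    unfolding quadro_quadric_cremona_def inverse_ratmaps_def using coprime_Q[OF assms] by blast
qed

section \<open>Uniqueness\<close>

lemma adjoint_is_imp_adjoint_equivalent: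
  assumes "adjoint_is A Q"
  shows "adjoint_equivalent A Q"
proof -
  obtain adj \<psi> L where 1: "is_adjoint A adj" and \<psi>: "Vector_Spaces.linear (*s) (scl A) \<psi>" "bij \<psi>"
    and L: "Vector_Spaces.linear (*s) (*s) L" "bij L" and a: "\<And>v. adj (\<psi> v) = \<psi> (L (Q v))"
    using assms unfolding adjoint_is_def by blast
  have "(inv \<psi> \<circ> adj \<circ> inv (inv \<psi>)) v = L (Q v)" for v
    using \<psi>(2) a by (simp add: inv_inv_eq bij_is_inj)
  then have "strongly_equivalent (inv \<psi> \<circ> adj \<circ> inv (inv \<psi>)) Q"
    unfolding strongly_equivalent_def
  proof (intro exI conjI allI)
    show "Vector_Spaces.linear (*s) (*s) (inv L)" "bij (inv L)"
      by (rule linear_bij_inv[OF L] bij_imp_bij_inv[OF L(2)])+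
    show "Vector_Spaces.linear (*s) (*s) (\<lambda>x::complex^4. x)" "bij (\<lambda>x::complex^4. x)"
      using vec.linear_ident bij_id by (simp_all add: id_def)
    show "Q x = inv L ((inv \<psi> \<circ> adj \<circ> inv (inv \<psi>)) x)" for x
      using \<open>\<And>v. (inv \<psi> \<circ> adj \<circ> inv (inv \<psi>)) v = L (Q v)\<close>[of x] L(2) by (simp add: bij_is_inj)
  qed
  then show ?thesis
    unfolding adjoint_equivalent_def
    using 1 linear_bij_inv[OF \<psi>] bij_imp_bij_inv[OF \<psi>(2)] strongly_imp_linearly_equivalent by blast
qed

lemma adjoint_is_isomorphic:
  assumes "jordan4 A" "jordan4 B" "isomorphic A B" "adjoint_is B Q"
  shows "adjoint_is A Q"
proof -
  interpret A: jordan4 A by fact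
  interpret B: jordan4 B by fact
  obtain f where f: "Vector_Spaces.linear (scl A) (scl B) f" "bij f"
    "\<And>x y. f (prd A x y) = prd B (f x) (f y)"
    using assms(3) unfolding isomorphic_def by blast
  interpret f: Vector_Spaces.linear "scl A" "scl B" f by (rule f(1))
  have gf: "inv f (f x) = x" "f (inv f y) = y" for x y
    using f(2) by (simp_all add: bij_is_inj bij_is_surj surj_f_inv_f)
  have unt: "f (unt A) = unt B"
    using f(3)[of "unt A" "inv f (unt B)"] gf by simp
  obtain adj \<psi> L where adj: "is_adjoint B adj" and \<psi>: "Vector_Spaces.linear (*s) (scl B) \<psi>" "bij \<psi>"
    and L: "Vector_Spaces.linear (*s) (*s) L" "bij L" and a: "\<And>v. adj (\<psi> v) = \<psi> (L (Q v))"
    using assms(4) unfolding adjoint_is_def by blast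
  obtain T S N where 1: "form (scl B) 1 T" "form (scl B) 2 S" "form (scl B) 3 N"
    "generically (scl B) (\<lambda>x. prd B x (prd B x x) - scl B (T x) (prd B x x) + scl B (S x) x - scl B (N x) (unt B) = 0)"
    "\<And>x. adj x = prd B x x - scl B (T x) x + scl B (S x) (unt B)"
    using adj unfolding is_adjoint_def by blast
  note fc = form_compose_linear[OF f(1)]
  have "is_adjoint A (\<lambda>x. inv f (adj (f x)))"
    unfolding is_adjoint_def
  proof (intro exI conjI allI)
    show "form (scl A) 1 (\<lambda>x. T (f x))" "form (scl A) 2 (\<lambda>x. S (f x))" "form (scl A) 3 (\<lambda>x. N (f x))"
      using fc 1(1-3) by blast+
    obtain p y where p: "poly_fun (scl B) p" "p y \<noteq> 0" "\<And>x. p x \<noteq> 0 \<Longrightarrow>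
      prd B x (prd B x x) - scl B (T x) (prd B x x) + scl B (S x) x - scl B (N x) (unt B) = 0"
      using 1(4) unfolding generically_def by blast
    have "prd A x (prd A x x) - scl A (T (f x)) (prd A x x) + scl A (S (f x)) x - scl A (N (f x)) (unt A) = 0"
      if "p (f x) \<noteq> 0" for x
    proof -
      have "f (prd A x (prd A x x) - scl A (T (f x)) (prd A x x) + scl A (S (f x)) x - scl A (N (f x)) (unt A)) = f 0"
        using p(3)[OF that] by (simp add: f.add f.diff f.scale f(3) unt f.zero)
      then show ?thesis using gf(1) by metis
    qed
    then show "generically (scl A) (\<lambda>x. prd A x (prd A x x) - scl A (T (f x)) (prd A x x) + scl A (S (f x)) x
        - scl A (N (f x)) (unt A) = 0)"
      unfolding generically_def using poly_fun_compose_linear[OF f(1) p(1)] p(2) gf(2)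
      by (intro exI[of _ "\<lambda>x. p (f x)"]) (auto intro: exI[of _ "inv f y"])
    show "inv f (adj (f x)) = prd A x x - scl A (T (f x)) x + scl A (S (f x)) (unt A)" for x
    proof -
      have "adj (f x) = f (prd A x x - scl A (T (f x)) x + scl A (S (f x)) (unt A))"
        unfolding 1(5) by (simp add: f.add f.diff f.scale f(3) unt)
      then show ?thesis using gf(1) by simp
    qed
  qed
  moreover have "Vector_Spaces.linear (*s) (scl A) (inv f \<circ> \<psi>)"
    by (rule Vector_Spaces.linear_compose[OF \<psi>(1) linear_bij_inv[OF f(1,2)]])
  moreover have "bij (inv f \<circ> \<psi>)"
    by (rule bij_comp[OF \<psi>(2) bij_imp_bij_inv[OF f(2)]])
  ultimately show ?thesis
    unfolding adjoint_is_def using L a gf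
    by (intro exI[of _ "\<lambda>x. inv f (adj (f x))"] exI[of _ "inv f \<circ> \<psi>"] exI[of _ L]) simp
qed

text \<open>Turns the inequivalence of the seven maps into the statement that no two of the seven
  algebras are isomorphic.\<close>

lemma (in jordan4) adjoint_is_unique:
  assumes "has_rank A 3" "adjoint_is A Q" "adjoint_is A Q'"
  shows "strongly_equivalent Q Q'"
proof -
  obtain adj \<psi> L where 1: "is_adjoint A adj" and \<psi>: "Vector_Spaces.linear (*s) sc \<psi>" "bij \<psi>"
    and L: "Vector_Spaces.linear (*s) (*s) L" "bij L" and a: "\<And>v. adj (\<psi> v) = \<psi> (L (Q v))"
    using assms(2) unfolding adjoint_is_def by blast
  obtain adj' \<psi>' L' where 2: "is_adjoint A adj'" and \<psi>': "Vector_Spaces.linear (*s) sc \<psi>'" "bij \<psi>'"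
    and L': "Vector_Spaces.linear (*s) (*s) L'" "bij L'" and a': "\<And>v. adj' (\<psi>' v) = \<psi>' (L' (Q' v))"
    using assms(3) unfolding adjoint_is_def by blast
  have "adj' = adj" using adjoint_unique[OF assms(1) 2 1] .
  have inv: "\<psi> (inv \<psi> x) = x" "inv \<psi>' (\<psi>' v) = v" "inv L' (L' v) = v" for x v
    using \<psi>(2) \<psi>'(2) L'(2) by (simp_all add: bij_is_inj bij_is_surj surj_f_inv_f)
  have "Q' v = inv L' (inv \<psi>' (\<psi> (L (Q (inv \<psi> (\<psi>' v))))))" for v
    unfolding a[symmetric] inv \<open>adj' = adj\<close>[symmetric] a' ..
  moreover have "Vector_Spaces.linear (*s) (*s) (inv L' \<circ> (inv \<psi>' \<circ> (\<psi> \<circ> L)))"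
    by (intro Vector_Spaces.linear_compose[OF _ linear_bij_inv[OF L']]
        Vector_Spaces.linear_compose[OF _ linear_bij_inv[OF \<psi>']] Vector_Spaces.linear_compose[OF L(1) \<psi>(1)])
  moreover have "bij (inv L' \<circ> (inv \<psi>' \<circ> (\<psi> \<circ> L)))"
    using L \<psi> L' \<psi>' by (intro bij_comp bij_imp_bij_inv) auto
  moreover have "Vector_Spaces.linear (*s) (*s) (inv \<psi> \<circ> \<psi>')" "bij (inv \<psi> \<circ> \<psi>')"
    using Vector_Spaces.linear_compose[OF \<psi>'(1) linear_bij_inv[OF \<psi>]] \<psi> \<psi>' by (auto intro: bij_comp bij_imp_bij_inv)
  ultimately show ?thesis
    unfolding strongly_equivalent_def
    by (intro exI[of _ "inv L' \<circ> (inv \<psi>' \<circ> (\<psi> \<circ> L))"] exI[of _ "inv \<psi> \<circ> \<psi>'"]) simp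
qed

section \<open>From quadro-quadric maps to Jordan algebras\<close>

lemma linear_poly_fun:
  fixes u :: "complex^4 \<Rightarrow> complex^4"
  assumes "Vector_Spaces.linear (*s) (*) l" "\<And>i. poly_fun (*s) (\<lambda>x. u x $ i)"
  shows "poly_fun (*s) (\<lambda>x::complex^4. l (u x))"
proof -
  interpret l: Vector_Spaces.linear "(*s)" "(*)" l by fact
  have l: "l y = (\<Sum>i\<in>UNIV. l (bas i) * y $ i)" for y
    using arg_cong[OF basis_expansion[of y], of l] by (simp add: l.sum l.scale mult.commute)
  show ?thesis
    unfolding l[of "u x" for x] using assms(2) by (intro poly_fun_sum poly_fun_cmult)
qed

lemma bilinear_poly_fun:
  fixes u w :: "complex^4 \<Rightarrow> complex^4"
  assumes "\<And>x. Vector_Spaces.linear (*s) (*) (\<beta> x)" "\<And>x y. \<beta> x y = \<beta> y x"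
    and "\<And>i. poly_fun (*s) (\<lambda>x. u x $ i)" "\<And>i. poly_fun (*s) (\<lambda>x. w x $ i)"
  shows "poly_fun (*s) (\<lambda>x::complex^4. \<beta> (u x) (w x))"
proof -
  have exp: "\<beta> x y = (\<Sum>i\<in>UNIV. y $ i * \<beta> x (bas i))" for x y
  proof -
    interpret l: Vector_Spaces.linear "(*s)" "(*)" "\<beta> x" by (rule assms(1))
    show ?thesis
      using arg_cong[OF basis_expansion[of y], of "\<beta> x"] by (simp add: l.sum l.scale)
  qed
  have "poly_fun (*s) (\<lambda>x. \<beta> (u x) b)" for b
    unfolding assms(2)[of _ b] by (rule linear_poly_fun[OF assms(1,3)])
  then show ?thesis
    unfolding exp[of "u x" "w x" for x] by (intro poly_fun_sum poly_fun.mult assms(4))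
qed

lemma linear_nth:
  assumes "Vector_Spaces.linear (*s) (*s) (L :: complex^'m \<Rightarrow> complex^'n)"
  shows "Vector_Spaces.linear (*s) (*) (\<lambda>y. L y $ i)"
  using Vector_Spaces.linear_compose[OF assms linear_vec_nth[of i]] by (simp add: comp_def)

text \<open>The trace-zero part of a Jordan algebra of rank 3: there, \<open>x \<diamondop> x\<close> is the trace-zero component
  of \<open>x\<^sup>2 = x \<diamondop> x + 2 a(x, x) e\<close>.\<close>

locale cubic_data =
  fixes m :: "complex^4 \<Rightarrow> complex^4 \<Rightarrow> complex^4" (infixl "\<diamondop>" 70)
    and a :: "complex^4 \<Rightarrow> complex^4 \<Rightarrow> complex" and T :: "complex^4 \<Rightarrow> complex" and e :: "complex^4"
  assumes m_linear: "Vector_Spaces.linear (*s) (*s) (\<lambda>y. x \<diamondop> y)" and m_comm: "x \<diamondop> y = y \<diamondop> x"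
    and a_linear: "Vector_Spaces.linear (*s) (*) (\<lambda>y. a x y)" and a_comm: "a x y = a y x"
    and T_linear: "Vector_Spaces.linear (*s) (*) T" and T_e: "T e = 3"
    and closed: "T v = 0 \<Longrightarrow> T w = 0 \<Longrightarrow> T (v \<diamondop> w) = 0"
    and cube: "T v = 0 \<Longrightarrow> v \<diamondop> (v \<diamondop> v) = a v v *s v"
    and a_square: "T v = 0 \<Longrightarrow> a (v \<diamondop> v) (v \<diamondop> v) = (a v v)\<^sup>2"
    and nondegenerate: "\<exists>v. T v = 0 \<and> (\<forall>s t. s *s v + t *s (v \<diamondop> v) = 0 \<longrightarrow> s = 0 \<and> t = 0)"
begin

lemma m_right: "x \<diamondop> (y + z) = x \<diamondop> y + x \<diamondop> z" "x \<diamondop> (c *s y) = c *s (x \<diamondop> y)"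
  using m_linear[of x] by (simp_all add: Vector_Spaces.linear_iff)

lemma m_left: "(y + z) \<diamondop> x = y \<diamondop> x + z \<diamondop> x" "(c *s y) \<diamondop> x = c *s (y \<diamondop> x)"
  using m_right m_comm by metis+

lemma a_right: "a x (y + z) = a x y + a x z" "a x (c *s y) = c * a x y"
  using a_linear[of x] by (simp_all add: Vector_Spaces.linear_iff)

lemma a_left: "a (y + z) x = a y x + a z x" "a (c *s y) x = c * a y x"
  using a_right a_comm by metis+

lemma T_add: "T (x + y) = T x + T y" and T_scale: "T (c *s x) = c * T x"
  using T_linear by (simp_all add: Vector_Spaces.linear_iff)

lemma m_diff: "x \<diamondop> (y - z) = x \<diamondop> y - x \<diamondop> z" "(y - z) \<diamondop> x = y \<diamondop> x - z \<diamondop> x"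
  using m_right(1)[of x y "-z"] m_right(2)[of x "-1" z] m_left(1)[of y "-z" x] m_left(2)[of "-1" z x]
  by simp_all

lemma a_diff: "a x (y - z) = a x y - a x z" "a (y - z) x = a y x - a z x"
  using a_right(1)[of x y "-z"] a_right(2)[of x "-1" z] a_left(1)[of y "-z" x] a_left(2)[of "-1" z x]
  by simp_all

lemma T_diff: "T (x - y) = T x - T y"
  using T_add[of x "-y"] T_scale[of "-1" y] by simp

lemmas lin_simps = m_right m_left a_right a_left m_diff a_diff

text \<open>The part of \<open>cube\<close> for \<open>v + w\<close> that is linear in
  \<open>w\<close>. Comparison with \<open>v - w\<close> isolates the odd parts, and the cubic one
  is \<open>cube\<close> for \<open>w\<close>.\<close>

lemma cube_linear:
  assumes v: "T v = 0" and w: "T w = 0"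
  shows "(v \<diamondop> v) \<diamondop> w + 2 *s (v \<diamondop> (v \<diamondop> w)) = a v v *s w + (2 * a v w) *s v"
proof -
  have p: "T (v + w) = 0" "T (v - w) = 0" using v w by (simp_all add: T_add T_diff)
  define x where "x = (v \<diamondop> v) \<diamondop> w + v \<diamondop> (v \<diamondop> w) + v \<diamondop> (v \<diamondop> w)"
  define y where "y = (w \<diamondop> w) \<diamondop> v + w \<diamondop> (w \<diamondop> v) + w \<diamondop> (w \<diamondop> v)"
  have 1: "(v + w) \<diamondop> ((v + w) \<diamondop> (v + w)) = a v v *s v + x + y + a w w *s w"
    unfolding cube[OF v, symmetric] cube[OF w, symmetric] x_def y_def
    by (simp only: lin_simps m_comm[of w v] m_comm[of w "v \<diamondop> v"] m_comm[of v "w \<diamondop> w"]) (simp add: vec_eq_iff)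
  have 2: "(v - w) \<diamondop> ((v - w) \<diamondop> (v - w)) = a v v *s v - x + y - a w w *s w"
    unfolding cube[OF v, symmetric] cube[OF w, symmetric] x_def y_def
    by (simp only: lin_simps m_comm[of w v] m_comm[of w "v \<diamondop> v"] m_comm[of v "w \<diamondop> w"]) (simp add: vec_eq_iff)
  have 3: "a (v + w) (v + w) *s (v + w) = a v v *s v + (a v v *s w + (2 * a v w) *s v) + (a w w *s v + (2 * a v w) *s w) + a w w *s w"
    using a_comm[of w v] by (simp add: lin_simps vec_eq_iff algebra_simps)
  have 4: "a (v - w) (v - w) *s (v - w) = a v v *s v - (a v v *s w + (2 * a v w) *s v) + (a w w *s v + (2 * a v w) *s w) - a w w *s w"
    using a_comm[of w v] by (simp add: lin_simps vec_eq_iff algebra_simps)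
  have "x = a v v *s w + (2 * a v w) *s v"
  proof (intro vec_eq_iff[THEN iffD2] allI)
    fix i
    have "2 * x $ i = 2 * (a v v *s w + (2 * a v w) *s v) $ i"
      using arg_cong[OF cube[OF p(1), unfolded 1 3], of "\<lambda>z. z $ i"]
        arg_cong[OF cube[OF p(2), unfolded 2 4], of "\<lambda>z. z $ i"] by simp algebra
    then show "x $ i = (a v v *s w + (2 * a v w) *s v) $ i"
      by (metis mult_cancel_left zero_neq_numeral)
  qed
  then show ?thesis
    unfolding x_def by (simp add: vec_eq_iff add.commute)
qed

lemma a_square_linear:
  assumes v: "T v = 0" and w: "T w = 0"
  shows "a (v \<diamondop> v) (v \<diamondop> w) = a v v * a v w"
proof -
  have p: "T (v + t *s w) = 0" for t using v w by (simp add: T_add T_scale)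
  define c0 c1 c2 c3 c4 where "c0 = a (v \<diamondop> v) (v \<diamondop> v)" and "c1 = a (v \<diamondop> v) (v \<diamondop> w)"
    and "c2 = a (v \<diamondop> v) (w \<diamondop> w)" and "c3 = a (v \<diamondop> w) (w \<diamondop> w)" and "c4 = a (w \<diamondop> w) (w \<diamondop> w)"
  define d where "d = a (v \<diamondop> w) (v \<diamondop> w)"
  have "c0 + 4 * t * c1 + t\<^sup>2 * (2 * c2 + 4 * d) + 4 * t ^ 3 * c3 + t ^ 4 * c4 = (a v v + 2 * t * a v w + t\<^sup>2 * a w w)\<^sup>2" for t
  proof -
    have "(v + t *s w) \<diamondop> (v + t *s w) = v \<diamondop> v + (2 * t) *s (v \<diamondop> w) + t\<^sup>2 *s (w \<diamondop> w)"
      using m_comm[of w v] by (simp add: lin_simps vec_eq_iff power2_eq_square algebra_simps)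
    moreover have "a (v + t *s w) (v + t *s w) = a v v + 2 * t * a v w + t\<^sup>2 * a w w"
      using a_comm[of w v] by (simp add: lin_simps power2_eq_square algebra_simps)
    moreover have "a (v \<diamondop> v + (2 * t) *s (v \<diamondop> w) + t\<^sup>2 *s (w \<diamondop> w)) (v \<diamondop> v + (2 * t) *s (v \<diamondop> w) + t\<^sup>2 *s (w \<diamondop> w))
      = c0 + 4 * t * c1 + t\<^sup>2 * (2 * c2 + 4 * d) + 4 * t ^ 3 * c3 + t ^ 4 * c4"
      unfolding c0_def c1_def c2_def c3_def c4_def d_def
      using a_comm[of "v \<diamondop> w" "v \<diamondop> v"] a_comm[of "w \<diamondop> w" "v \<diamondop> v"] a_comm[of "w \<diamondop> w" "v \<diamondop> w"]
      by (simp add: lin_simps power2_eq_square power3_eq_cube power4_eq_xxxx algebra_simps)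
    ultimately show ?thesis using a_square[OF p[of t]] by simp
  qed
  note h = this[of 1] this[of "-1"] this[of 2] this[of "-2"]
  \<comment> \<open>The odd parts of \<open>h\<close> have the shape
    \<open>8 * t * X + 8 * t ^ 3 * Y = 0\<close> with \<open>X = c1 - a v v * a v w\<close>. From
    \<open>t = 1\<close> and \<open>t = 2\<close>,
    \<open>8 * (8 * X + 8 * Y) - (16 * X + 64 * Y) = 48 * X\<close>.\<close>
  have "48 * (c1 - a v v * a v w) = 0"
    using h by simp algebra
  then show ?thesis by (simp add: c1_def)
qed

text \<open>Substituting \<open>v \<diamondop> v\<close> for \<open>v\<close> in the linearised cubic equation gives \<open>E = 0\<close> for a polynomial \<open>E\<close> in the
  multiplication \<open>L\<close> by \<open>v\<close> plus an operator with image in the span of \<open>v\<close> and \<open>v \<diamondop> v\<close>. The former cancels in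
  \<open>L E - E L = 0\<close>, whose coefficients at \<open>v\<close> and \<open>v \<diamondop> v\<close> yield the claim.\<close>

lemma associative_if_independent:
  assumes v: "T v = 0" and w: "T w = 0" and a0: "a v v \<noteq> 0"
    and ind: "\<And>s t. s *s v + t *s (v \<diamondop> v) = 0 \<Longrightarrow> s = 0 \<and> t = 0"
  shows "a (v \<diamondop> v) w = a v (v \<diamondop> w)"
proof -
  define L where "L y = v \<diamondop> y" for y
  define q where "q = v \<diamondop> v"
  define \<alpha> where "\<alpha> = a v v"
  define \<nu> where "\<nu> = 2 * a v q"
  have q: "T q = 0" unfolding q_def by (rule closed[OF v v])
  have Lq: "L q = \<alpha> *s v" "L v = q" unfolding L_def q_def \<alpha>_def by (simp_all add: cube[OF v])
  have TL: "T (L y) = 0" if "T y = 0" for y unfolding L_def by (rule closed[OF v that])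
  have Ladd: "L (x + y) = L x + L y" "L (c *s x) = c *s L x" "L (x - y) = L x - L y" for x y c
    unfolding L_def by (simp_all add: lin_simps)
  have I: "q \<diamondop> y = \<alpha> *s y + (2 * a v y) *s v - 2 *s L (L y)" if "T y = 0" for y
    using cube_linear[OF v that] unfolding L_def q_def \<alpha>_def by (simp add: algebra_simps)
  have qq: "q \<diamondop> q = \<nu> *s v - \<alpha> *s q"
    unfolding I[OF q] by (simp add: Lq Ladd \<nu>_def vec_eq_iff)
  have II: "(q \<diamondop> q) \<diamondop> y + 2 *s (q \<diamondop> (q \<diamondop> y)) = (\<alpha> * \<alpha>) *s y + (2 * a q y) *s q" if "T y = 0" for y
    using cube_linear[OF q that] a_square[OF v] unfolding q_def \<alpha>_def by (simp add: power2_eq_square)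
  define E where "E y = 8 *s L (L (L (L y))) - (6 * \<alpha>) *s L (L y) + \<nu> *s L y
    + (6 * \<alpha> * a v y - 8 * a v (L (L y))) *s v - (2 * a q y) *s q" for y
  have E: "E y = 0" if y: "T y = 0" for y
  proof -
    have Ty: "T (q \<diamondop> y) = 0" "T (L (L y)) = 0" using closed[OF q y] TL y by simp_all
    have qy: "q \<diamondop> y = \<alpha> *s y + (2 * a v y) *s v - 2 *s L (L y)" by (rule I[OF y])
    have LL: "L (L (q \<diamondop> y)) = \<alpha> *s L (L y) + (2 * a v y * \<alpha>) *s v - 2 *s L (L (L (L y)))"
      unfolding qy by (simp add: Ladd Lq)
    have av: "a v (q \<diamondop> y) = 3 * \<alpha> * a v y - 2 * a v (L (L y))"
      unfolding qy by (simp add: lin_simps \<alpha>_def[symmetric])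
    have "(q \<diamondop> q) \<diamondop> y = \<nu> *s L y - \<alpha> *s (q \<diamondop> y)"
      unfolding qq by (simp add: lin_simps L_def)
    then have "\<nu> *s L y - \<alpha> *s (q \<diamondop> y) + 2 *s (\<alpha> *s (q \<diamondop> y) + (2 * a v (q \<diamondop> y)) *s v - 2 *s L (L (q \<diamondop> y)))
        = (\<alpha> * \<alpha>) *s y + (2 * a q y) *s q"
      using II[OF y] unfolding I[OF Ty(1)] by simp
    then show ?thesis
      unfolding LL av unfolding qy E_def by (simp add: vec_eq_iff algebra_simps)
  qed
  have E0: "6 * \<alpha> * a v y - 8 * a v (L (L y)) + 2 * a q (L y) = 0 \<and>
      8 * a v (L (L (L y))) - 6 * \<alpha> * a v (L y) - 2 * \<alpha> * a q y = 0" if y: "T y = 0" for y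
  proof -
    have "L (E y) - E (L y) = (8 * a v (L (L (L y))) - 6 * \<alpha> * a v (L y) - 2 * \<alpha> * a q y) *s v
      + (6 * \<alpha> * a v y - 8 * a v (L (L y)) + 2 * a q (L y)) *s q"
      unfolding E_def by (simp add: Ladd Lq vec_eq_iff algebra_simps)
    moreover have "L (E y) - E (L y) = 0"
      using E[OF y] E[OF TL[OF y]] m_right(2)[of v 0 0] by (simp add: L_def)
    ultimately show ?thesis using ind unfolding q_def by metis
  qed
  \<comment> \<open>With this, the first relation in \<open>E0\<close> gives
    \<open>a v (L (L y)) = \<alpha> * a v y\<close>; applied to \<open>L w\<close> in the second one
    it leaves the claim times \<open>2 * \<alpha>\<close>.\<close>
  have qL: "a q (L y) = \<alpha> * a v y" if "T y = 0" for y
    unfolding q_def L_def \<alpha>_def by (rule a_square_linear[OF v that])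
  have LL: "a v (L (L y)) = \<alpha> * a v y" if "T y = 0" for y
    using E0[OF that] qL[OF that] by simp
  have "2 * \<alpha> * (a v (L w) - a q w) = 0"
    using E0[OF w] LL[OF TL[OF w]] by (simp add: algebra_simps)
  then show ?thesis using a0 by (simp add: L_def q_def \<alpha>_def)
qed

definition proj :: "complex^4 \<Rightarrow> complex^4" where
  "proj x = x - (T x / 3) *s e"

lemma T_proj: "T (proj x) = 0"
  by (simp add: proj_def T_diff T_scale T_e)

lemma proj_id: "T v = 0 \<Longrightarrow> proj v = v"
  by (simp add: proj_def)

lemma proj_linear: "Vector_Spaces.linear (*s) (*s) proj"
  using vector_space_vec
  by (auto simp: Vector_Spaces.linear_iff proj_def T_add T_scale vec_eq_iff add_divide_distrib algebra_simps)

lemma poly_fun_proj: "poly_fun (*s) (\<lambda>x. proj x $ i)"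
  by (rule poly_fun.linear[OF linear_nth[OF proj_linear]])

lemma poly_fun_a:
  "(\<And>i. poly_fun (*s) (\<lambda>x::complex^4. u x $ i)) \<Longrightarrow> (\<And>i. poly_fun (*s) (\<lambda>x. w x $ i)) \<Longrightarrow>
    poly_fun (*s) (\<lambda>x. a (u x) (w x))"
  by (rule bilinear_poly_fun[OF a_linear a_comm])

lemma poly_fun_m:
  "(\<And>i. poly_fun (*s) (\<lambda>x::complex^4. u x $ i)) \<Longrightarrow> (\<And>i. poly_fun (*s) (\<lambda>x. w x $ i)) \<Longrightarrow>
    poly_fun (*s) (\<lambda>x. (u x \<diamondop> w x) $ i)"
  by (rule bilinear_poly_fun[where \<beta> = "\<lambda>x y. (x \<diamondop> y) $ i"]) (simp_all add: linear_nth[OF m_linear] m_comm)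

text \<open>Minors express the independence of \<open>v\<close> and \<open>v \<diamondop> v\<close>
  as the nonvanishing of a polynomial, as the density argument in \<open>associative\<close>
  requires.\<close>

lemma independent_if_minor:
  fixes u w :: "complex^4"
  assumes "u $ i * w $ j - u $ j * w $ i \<noteq> 0" "s *s u + t *s w = 0"
  shows "s = 0 \<and> t = 0"
proof -
  have "s * u $ i + t * w $ i = 0" "s * u $ j + t * w $ j = 0"
    using assms(2) by (simp_all add: vec_eq_iff)
  then have "s * (u $ i * w $ j - u $ j * w $ i) = 0" "t * (u $ i * w $ j - u $ j * w $ i) = 0"
    by algebra+
  then show ?thesis using assms(1) by simp
qed

lemma minor_if_independent:
  fixes u w :: "complex^4"
  assumes "\<And>s t. s *s u + t *s w = 0 \<Longrightarrow> s = 0 \<and> t = 0"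
  shows "\<exists>i j. u $ i * w $ j - u $ j * w $ i \<noteq> 0"
proof (rule ccontr)
  assume *: "\<nexists>i j. u $ i * w $ j - u $ j * w $ i \<noteq> 0"
  have "u \<noteq> 0" using assms[of 1 0] by auto
  then obtain i where i: "u $ i \<noteq> 0" by (auto simp: vec_eq_iff)
  have "(- (w $ i)) *s u + (u $ i) *s w = 0"
    using * by (simp add: vec_eq_iff mult.commute)
  then show False using assms i by blast
qed

text \<open>The claim is polynomial in \<open>v\<close>, and it is known wherever
  \<open>a v v \<noteq> 0\<close> and \<open>v\<close>, \<open>v \<diamondop> v\<close> are
  independent. Both are open conditions that hold somewhere, unless \<open>a v v\<close> vanishes
  throughout; then \<open>a\<close> is zero on trace-zero vectors by polarisation.\<close>

lemma associative:
  assumes v: "T v = 0" and w: "T w = 0"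
  shows "a (v \<diamondop> v) w = a v (v \<diamondop> w)"
proof (cases "\<forall>v. T v = 0 \<longrightarrow> a v v = 0")
  case True
  have "a x y = 0" if "T x = 0" "T y = 0" for x y
  proof -
    have "a (x + y) (x + y) = 0" "a x x = 0" "a y y = 0" using True that by (simp_all add: T_add)
    then show ?thesis using a_comm[of y x] by (simp add: lin_simps)
  qed
  then show ?thesis using v w closed by simp
next
  case False
  then obtain v1 where v1: "T v1 = 0" "a v1 v1 \<noteq> 0" by blast
  obtain v0 i j where v0: "T v0 = 0" "v0 $ i * (v0 \<diamondop> v0) $ j - v0 $ j * (v0 \<diamondop> v0) $ i \<noteq> 0"
    using nondegenerate minor_if_independent by metis
  define p1 where "p1 x = a (proj x) (proj x)" for x
  define p2 where "p2 x = proj x $ i * (proj x \<diamondop> proj x) $ j - proj x $ j * (proj x \<diamondop> proj x) $ i" for x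
  define q where "q x = a (proj x \<diamondop> proj x) w - a (proj x) (proj x \<diamondop> w)" for x
  have const: "poly_fun (*s) (\<lambda>x::complex^4. w $ i)" for i by (rule poly_fun.const)
  have pf: "poly_fun (*s) p1" "poly_fun (*s) p2" "poly_fun (*s) q"
    unfolding p1_def p2_def q_def
    by (intro poly_fun_a poly_fun_m poly_fun_proj poly_fun_diff poly_fun.mult const)+
  have "p1 x * (p2 x * q x) = p1 x * 0" for x
  proof (cases "p1 x = 0 \<or> p2 x = 0")
    case False
    then have "q x = 0"
      unfolding q_def p1_def p2_def
      using associative_if_independent[OF T_proj w] independent_if_minor[of "proj x" i _ j] by auto
    then show ?thesis by simp
  qed auto
  then have "p2 x * q x = p2 x * 0" for x
    using poly_fun_vec_cancel[OF pf(1) poly_fun.mult[OF pf(2,3)] poly_fun.const, of v1 0 x]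
    using v1 proj_id by (simp add: p1_def)
  then have "q v = 0"
    using poly_fun_vec_cancel[OF pf(2,3) poly_fun.const, of v0 0 v]
    using v0 proj_id by (simp add: p2_def)
  then show ?thesis using proj_id[OF v] by (simp add: q_def)
qed

text \<open>The factor 2 comes from the Jordan identity. With \<open>c\<close> in its place, the two
  sides for trace-zero \<open>v\<close> and \<open>w\<close> contain \<open>c * a v w\<close> and
  \<open>2 * a v w\<close> times \<open>v \<diamondop> v\<close>, the latter by
  \<open>cube_linear\<close>.\<close>

definition envelope :: "(complex^4) calg" where
  "envelope = \<lparr>scl = (*s), prd = (\<lambda>x y. (T x / 3 * (T y / 3) + 2 * a (proj x) (proj y)) *s e
    + (T x / 3) *s proj y + (T y / 3) *s proj x + proj x \<diamondop> proj y), unt = e\<rparr>"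

lemma decompose: "\<exists>s v. x = s *s e + v \<and> T v = 0"
  using T_proj[of x] by (intro exI[of _ "T x / 3"] exI[of _ "proj x"]) (simp add: proj_def)

lemma T_proj_sum: "T v = 0 \<Longrightarrow> T (s *s e + v) = 3 * s" "T v = 0 \<Longrightarrow> proj (s *s e + v) = v"
  by (simp_all add: proj_def T_add T_scale T_e)

lemma prd_envelope: "T v = 0 \<Longrightarrow> T w = 0 \<Longrightarrow>
    prd envelope (s *s e + v) (t *s e + w) = (s * t + 2 * a v w) *s e + (s *s w + t *s v + v \<diamondop> w)"
  by (simp add: envelope_def T_proj_sum)

lemma envelope_simps: "scl envelope = (*s)" "unt envelope = e"
  by (simp_all add: envelope_def)

lemma jordan4_envelope: "jordan4 envelope"
proof (rule jordan4I)
  show "vector_space (scl envelope)" "ind4 (scl envelope) (bas 1) (bas 2) (bas 3) (bas 4)"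
    "\<exists>a b c d. y = scl envelope a (bas 1) + scl envelope b (bas 2) + scl envelope c (bas 3) + scl envelope d (bas 4)" for y
    unfolding envelope_simps by (rule vector_space_vec ind4_bas bas_spans)+
  have T: "T (x + y) = 0" "T (c *s x) = 0" "T (x \<diamondop> y) = 0" if "T x = 0" "T y = 0" for x y c
    using that closed by (simp_all add: T_add T_scale)
  show "prd envelope x (y + z) = prd envelope x y + prd envelope x z" for x y z
  proof -
    obtain s u t v r w where x: "x = s *s e + u" "T u = 0" and y: "y = t *s e + v" "T v = 0"
      and z: "z = r *s e + w" "T w = 0" using decompose by metis
    have "y + z = (t + r) *s e + (v + w)" unfolding y z by (simp add: vec_eq_iff algebra_simps)
    then have "prd envelope x (y + z) = (s * (t + r) + 2 * a u (v + w)) *s e + (s *s (v + w) + (t + r) *s u + u \<diamondop> (v + w))"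
      unfolding x(1) by (simp only: prd_envelope[OF x(2) T(1)[OF y(2) z(2)]])
    then show ?thesis
      unfolding x(1) y(1) z(1) prd_envelope[OF x(2) y(2)] prd_envelope[OF x(2) z(2)]
      by (simp add: lin_simps vec_eq_iff algebra_simps)
  qed
  show "prd envelope x (scl envelope c y) = scl envelope c (prd envelope x y)" for c x y
  proof -
    obtain s u t v where x: "x = s *s e + u" "T u = 0" and y: "y = t *s e + v" "T v = 0"
      using decompose by metis
    have "c *s y = (c * t) *s e + c *s v" unfolding y by (simp add: vec_eq_iff algebra_simps)
    then have "prd envelope x (c *s y) = (s * (c * t) + 2 * a u (c *s v)) *s e + (s *s (c *s v) + (c * t) *s u + u \<diamondop> (c *s v))"
      unfolding x(1) by (simp only: prd_envelope[OF x(2) T(2)[OF y(2) y(2)]])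
    then show ?thesis
      unfolding envelope_simps x(1) y(1) prd_envelope[OF x(2) y(2)]
      by (simp add: lin_simps vec_eq_iff algebra_simps)
  qed
  show "prd envelope x y = prd envelope y x" for x y
    using m_comm[of "proj x" "proj y"] a_comm[of "proj x" "proj y"] by (simp add: envelope_def ac_simps)
  show "prd envelope (unt envelope) x = x" for x
  proof -
    obtain s u where x: "x = s *s e + u" "T u = 0" using decompose by metis
    have "T 0 = 0" using T_scale[of 0 0] by simp
    then show ?thesis
      using prd_envelope[of 0 u 1 s] x m_left(2)[of 0 0 u] a_left(2)[of 0 0 u] by (simp add: envelope_simps)
  qed
  show "prd envelope (prd envelope x x) (prd envelope x y) = prd envelope x (prd envelope (prd envelope x x) y)" for x y
  proof -
    obtain s v t w where x: "x = s *s e + v" "T v = 0" and y: "y = t *s e + w" "T w = 0"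
      using decompose by metis
    define q where "q = v \<diamondop> v"
    define \<alpha> where "\<alpha> = a v v"
    note Tv = x(2) and Tw = y(2)
    have Tq: "T q = 0" and Tvw: "T (v \<diamondop> w) = 0" and Tqw: "T (q \<diamondop> w) = 0"
      unfolding q_def using Tv Tw T by simp_all
    have qw: "q \<diamondop> w = \<alpha> *s w + (2 * a v w) *s v - 2 *s (v \<diamondop> (v \<diamondop> w))"
      using cube_linear[OF Tv Tw] unfolding q_def \<alpha>_def by (simp add: algebra_simps)
    \<comment> \<open>The third power of multiplication by \<open>v\<close> occurs with the same
      coefficient here and in \<open>vqw\<close> and cancels. The coefficients at \<open>v\<close>
      then agree by \<open>associative\<close>; the identities for \<open>a\<close> below take care
      of those at \<open>e\<close>.\<close>
    have qvw: "q \<diamondop> (v \<diamondop> w) = \<alpha> *s (v \<diamondop> w) + (2 * a v (v \<diamondop> w)) *s v - 2 *s (v \<diamondop> (v \<diamondop> (v \<diamondop> w)))"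
      using cube_linear[OF Tv Tvw] unfolding q_def \<alpha>_def by (simp add: algebra_simps)
    have vqw: "v \<diamondop> (q \<diamondop> w) = \<alpha> *s (v \<diamondop> w) + (2 * a v w) *s q - 2 *s (v \<diamondop> (v \<diamondop> (v \<diamondop> w)))"
      unfolding qw by (simp add: lin_simps q_def)
    have aqw: "a q w = a v (v \<diamondop> w)" unfolding q_def by (rule associative[OF Tv Tw])
    have aqvw: "a q (v \<diamondop> w) = \<alpha> * a v w"
      unfolding q_def \<alpha>_def by (rule a_square_linear[OF Tv Tw])
    have avvw: "a v (v \<diamondop> (v \<diamondop> w)) = \<alpha> * a v w"
      using associative[OF Tv Tvw] aqvw unfolding q_def by simp
    have avqw: "a v (q \<diamondop> w) = \<alpha> * a v w"
      unfolding qw by (simp add: lin_simps avvw \<alpha>_def[symmetric])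
    have vq: "v \<diamondop> q = \<alpha> *s v" unfolding q_def \<alpha>_def by (rule cube[OF Tv])
    have xx: "prd envelope x x = (s * s + 2 * \<alpha>) *s e + ((2 * s) *s v + q)"
      unfolding x(1) prd_envelope[OF Tv Tv] q_def \<alpha>_def by (simp add: vec_eq_iff algebra_simps)
    have xy: "prd envelope x y = (s * t + 2 * a v w) *s e + (s *s w + t *s v + v \<diamondop> w)"
      unfolding x(1) y(1) prd_envelope[OF Tv Tw] ..
    have Tz: "T ((2 * s) *s v + q) = 0" "T (s *s w + t *s v + v \<diamondop> w) = 0"
      using T[OF Tv Tv] Tv Tw Tq Tvw by (simp_all add: T_add T_scale)
    have avq: "a q v = a v q" by (rule a_comm)
    have 1: "prd envelope (prd envelope x x) (prd envelope x y) =
      ((s * s + 2 * \<alpha>) * (s * t + 2 * a v w) + 2 * a ((2 * s) *s v + q) (s *s w + t *s v + v \<diamondop> w)) *s e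
      + ((s * s + 2 * \<alpha>) *s (s *s w + t *s v + v \<diamondop> w) + (s * t + 2 * a v w) *s ((2 * s) *s v + q)
         + ((2 * s) *s v + q) \<diamondop> (s *s w + t *s v + v \<diamondop> w))"
      unfolding xx xy by (rule prd_envelope[OF Tz])
    have xxy: "prd envelope (prd envelope x x) y = ((s * s + 2 * \<alpha>) * t + 2 * a ((2 * s) *s v + q) w) *s e
      + ((s * s + 2 * \<alpha>) *s w + t *s ((2 * s) *s v + q) + ((2 * s) *s v + q) \<diamondop> w)"
      unfolding xx y(1) by (rule prd_envelope[OF Tz(1) Tw])
    have Tz3: "T ((s * s + 2 * \<alpha>) *s w + t *s ((2 * s) *s v + q) + ((2 * s) *s v + q) \<diamondop> w) = 0"
      using closed[OF Tz(1) Tw] Tw Tv Tq by (simp add: T_add T_scale)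
    have 2: "prd envelope x (prd envelope (prd envelope x x) y) =
      (s * ((s * s + 2 * \<alpha>) * t + 2 * a ((2 * s) *s v + q) w)
        + 2 * a v ((s * s + 2 * \<alpha>) *s w + t *s ((2 * s) *s v + q) + ((2 * s) *s v + q) \<diamondop> w)) *s e
      + (s *s ((s * s + 2 * \<alpha>) *s w + t *s ((2 * s) *s v + q) + ((2 * s) *s v + q) \<diamondop> w)
        + ((s * s + 2 * \<alpha>) * t + 2 * a ((2 * s) *s v + q) w) *s v
        + v \<diamondop> ((s * s + 2 * \<alpha>) *s w + t *s ((2 * s) *s v + q) + ((2 * s) *s v + q) \<diamondop> w))"
      unfolding xxy unfolding x(1) by (rule prd_envelope[OF Tv Tz3])
    have qv: "q \<diamondop> v = \<alpha> *s v" using vq m_comm by metis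
    show ?thesis
      unfolding 1 2
      by (simp only: lin_simps qvw vqw qv vq aqw aqvw avqw avvw avq q_def[symmetric] \<alpha>_def[symmetric])
        (simp add: vec_eq_iff algebra_simps)
  qed
qed

text \<open>For \<open>x = s *s e + v\<close> the cubic is \<open>(X - s) ^ 3 - 3 * a v v * (X - s)
  - 2 * a v (v \<diamondop> v)\<close>, the equation of the trace-zero part shifted by
  \<open>s\<close>.\<close>

lemma envelope_cubic:
  "prd envelope x (prd envelope x x) - scl envelope (T x) (prd envelope x x)
    + scl envelope (3 * (T x / 3)\<^sup>2 - 3 * a (proj x) (proj x)) x
    - scl envelope ((T x / 3) ^ 3 - 3 * (T x / 3) * a (proj x) (proj x) + 2 * a (proj x) (proj x \<diamondop> proj x)) (unt envelope) = 0"
proof -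
  obtain s v where x: "x = s *s e + v" and v: "T v = 0" using decompose by metis
  have xx: "prd envelope x x = (s * s + 2 * a v v) *s e + ((2 * s) *s v + v \<diamondop> v)"
    unfolding x prd_envelope[OF v v] by (simp add: vec_eq_iff algebra_simps)
  have "T ((2 * s) *s v + v \<diamondop> v) = 0" using v closed by (simp add: T_add T_scale)
  from prd_envelope[OF v this, of s "s * s + 2 * a v v"]
  have xxx: "prd envelope x (prd envelope x x) = (s * (s * s + 2 * a v v) + 2 * a v ((2 * s) *s v + v \<diamondop> v)) *s e
    + (s *s ((2 * s) *s v + v \<diamondop> v) + (s * s + 2 * a v v) *s v + v \<diamondop> ((2 * s) *s v + v \<diamondop> v))"
    unfolding xx unfolding x .
  show ?thesis
    unfolding xxx unfolding xx unfolding x T_proj_sum[OF v] envelope_simps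
    by (simp add: lin_simps cube[OF v] vec_eq_iff power2_eq_square power3_eq_cube algebra_simps)
qed

lemma envelope_adjoint:
  "is_adjoint envelope (\<lambda>x. ((T x / 3)\<^sup>2 - a (proj x) (proj x)) *s e - (T x / 3) *s proj x + proj x \<diamondop> proj x)"
proof (rule is_adjointI)
  let ?S = "\<lambda>x. 3 * (T x / 3)\<^sup>2 - 3 * a (proj x) (proj x)"
  let ?N = "\<lambda>x. (T x / 3) ^ 3 - 3 * (T x / 3) * a (proj x) (proj x) + 2 * a (proj x) (proj x \<diamondop> proj x)"
  have pT: "poly_fun (*s) (\<lambda>x. T x / 3)"
    using poly_fun_cmult[OF poly_fun.linear[OF T_linear], of "1/3"] by simp
  have pc: "proj (c *s x) = c *s proj x" for c x
    using proj_linear by (simp add: Vector_Spaces.linear_iff)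
  show "form (scl envelope) 1 T"
    unfolding form_def envelope_simps using poly_fun.linear[OF T_linear] by (simp add: T_scale)
  show "form (scl envelope) 2 ?S"
    unfolding form_def envelope_simps
    by (intro conjI allI poly_fun_diff poly_fun_cmult poly_fun_power pT poly_fun_a poly_fun_proj)
      (simp add: T_scale pc lin_simps power2_eq_square algebra_simps)
  show "form (scl envelope) 3 ?N"
    unfolding form_def envelope_simps
    by (intro conjI allI poly_fun_diff poly_fun.add poly_fun.mult poly_fun.const poly_fun_power pT poly_fun_a poly_fun_m poly_fun_proj)
      (simp add: T_scale pc lin_simps power2_eq_square power3_eq_cube algebra_simps)
  show "prd envelope x (prd envelope x x) - scl envelope (T x) (prd envelope x x) + scl envelope (?S x) x
      - scl envelope (?N x) (unt envelope) = 0" for x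
    by (rule envelope_cubic)
  show "((T x / 3)\<^sup>2 - a (proj x) (proj x)) *s e - (T x / 3) *s proj x + proj x \<diamondop> proj x
      = prd envelope x x - scl envelope (T x) x + scl envelope (?S x) (unt envelope)" for x
  proof -
    obtain s v where x: "x = s *s e + v" and v: "T v = 0" using decompose by metis
    show ?thesis
      unfolding x prd_envelope[OF v v] T_proj_sum[OF v] envelope_simps
      by (simp add: vec_eq_iff power2_eq_square algebra_simps)
  qed
qed

lemma envelope_rank: "has_rank envelope 3"
proof -
  interpret J: jordan4 envelope by (rule jordan4_envelope)
  obtain v where v: "T v = 0" and ind: "\<And>s t. s *s v + t *s (v \<diamondop> v) = 0 \<Longrightarrow> s = 0 \<and> t = 0"
    using nondegenerate by blast
  have vv: "prd envelope v v = (2 * a v v) *s e + v \<diamondop> v"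
    using prd_envelope[OF v v, of 0 0] by simp
  have "J.cyclic v"
    unfolding J.cyclic_def ind3_def envelope_simps vv
  proof (intro allI impI)
    fix x y z
    assume "x *s e + y *s v + z *s ((2 * a v v) *s e + v \<diamondop> v) = 0"
    then have eq: "(x + z * (2 * a v v)) *s e + (y *s v + z *s (v \<diamondop> v)) = 0"
      by (simp add: vec_eq_iff algebra_simps)
    have "T (y *s v + z *s (v \<diamondop> v)) = 0" using v closed by (simp add: T_add T_scale)
    moreover have "T 0 = 0" using T_scale[of 0 0] by simp
    ultimately have "3 * (x + z * (2 * a v v)) = 0"
      using arg_cong[OF eq, of T] by (simp only: T_add[of "(x + z * (2 * a v v)) *s e"] T_scale[of _ e] T_e) (simp add: mult.commute)
    then have c: "x + z * (2 * a v v) = 0" by (metis mult_eq_0_iff zero_neq_numeral)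
    have "y *s v + z *s (v \<diamondop> v) = 0" using eq unfolding c by simp
    then have "y = 0 \<and> z = 0" by (rule ind)
    then show "x = 0 \<and> y = 0 \<and> z = 0" using c by simp
  qed
  then show ?thesis
  proof (rule J.rank3I)
    fix x
    define s n where "s = 3 * (T x / 3)\<^sup>2 - 3 * a (proj x) (proj x)"
      and "n = (T x / 3) ^ 3 - 3 * (T x / 3) * a (proj x) (proj x) + 2 * a (proj x) (proj x \<diamondop> proj x)"
    have "prd envelope x (prd envelope x x) = scl envelope (T x) (prd envelope x x) + scl envelope (- s) x + scl envelope n (unt envelope)"
      using envelope_cubic[of x] unfolding s_def[symmetric] n_def[symmetric] envelope_simps
      by (simp add: algebra_simps)
    then show "\<exists>a b c. prd envelope x (prd envelope x x) = scl envelope a (prd envelope x x) + scl envelope b x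
        + scl envelope c (unt envelope)"
      by blast
  qed
qed

end

subsection \<open>Normalisation at a general point\<close>

definition parallel :: "complex^4 \<Rightarrow> complex^4 \<Rightarrow> bool" where
  "parallel u v \<longleftrightarrow> (\<forall>i j. u $ i * v $ j = u $ j * v $ i)"

lemma parallel_multiple:
  assumes "parallel u v" "v \<noteq> 0"
  shows "\<exists>c. u = c *s v"
proof -
  obtain j where j: "v $ j \<noteq> 0" using assms(2) by (auto simp: vec_eq_iff)
  have "u = (u $ j / v $ j) *s v"
    using assms(1) j unfolding parallel_def by (simp add: vec_eq_iff field_simps)
  then show ?thesis by blast
qed

lemma vanishing_quintic:
  assumes "\<And>t::complex. c0 + c1 * t + c2 * t ^ 2 + c3 * t ^ 3 + c4 * t ^ 4 + c5 * t ^ 5 = 0"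
  shows "c0 = 0 \<and> c1 = 0 \<and> c2 = 0 \<and> c3 = 0 \<and> c4 = 0 \<and> c5 = 0"
proof -
  have "poly [:c0, c1, c2, c3, c4, c5:] t = 0" for t
    using assms[of t] by (simp add: algebra_simps power2_eq_square power3_eq_cube eval_nat_numeral)
  then have "[:c0, c1, c2, c3, c4, c5:] = 0"
    using poly_all_0_iff_0 by blast
  then show ?thesis by simp
qed

text \<open>Comparing coefficients in the minors, the curve is \<open>e + t *s v\<close> times a
  polynomial in \<open>t\<close> with coefficients \<open>A0\<close>, \<open>A1\<close> and so on,
  of degree at most 3 unless \<open>e\<close> and \<open>v\<close> are parallel. For
  \<open>G (F x) = N x *s x\<close> it is the restriction of the cubic form \<open>N\<close> to the
  line.\<close>

lemma quartic_parallel_line: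
  assumes p: "\<And>t. parallel (g0 + t *s g1 + t ^ 2 *s g2 + t ^ 3 *s g3 + t ^ 4 *s g4) (e + t *s v)"
    and "e \<noteq> 0"
  shows "\<exists>A0 A1 A2 A3 A4. g0 = A0 *s e \<and> g1 = A0 *s v + A1 *s e \<and> g2 = A1 *s v + A2 *s e \<and>
    g3 = A2 *s v + A3 *s e \<and> g4 = A3 *s v + A4 *s e \<and> parallel (A4 *s e) v"
proof -
  have w: "g0 $ i * e $ j = g0 $ j * e $ i \<and>
    g1 $ i * e $ j + g0 $ i * v $ j = g1 $ j * e $ i + g0 $ j * v $ i \<and>
    g2 $ i * e $ j + g1 $ i * v $ j = g2 $ j * e $ i + g1 $ j * v $ i \<and>
    g3 $ i * e $ j + g2 $ i * v $ j = g3 $ j * e $ i + g2 $ j * v $ i \<and>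
    g4 $ i * e $ j + g3 $ i * v $ j = g4 $ j * e $ i + g3 $ j * v $ i \<and>
    g4 $ i * v $ j = g4 $ j * v $ i" for i j
  proof -
    have "(g0 $ i * e $ j - g0 $ j * e $ i)
      + (g1 $ i * e $ j + g0 $ i * v $ j - (g1 $ j * e $ i + g0 $ j * v $ i)) * t
      + (g2 $ i * e $ j + g1 $ i * v $ j - (g2 $ j * e $ i + g1 $ j * v $ i)) * t ^ 2
      + (g3 $ i * e $ j + g2 $ i * v $ j - (g3 $ j * e $ i + g2 $ j * v $ i)) * t ^ 3
      + (g4 $ i * e $ j + g3 $ i * v $ j - (g4 $ j * e $ i + g3 $ j * v $ i)) * t ^ 4
      + (g4 $ i * v $ j - g4 $ j * v $ i) * t ^ 5 = 0" for t
      using p[of t] unfolding parallel_def by (simp add: eval_nat_numeral algebra_simps)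
    from vanishing_quintic[OF this] show ?thesis by simp
  qed
  have "parallel g0 e" using w by (simp add: parallel_def)
  then obtain A0 where g0: "g0 = A0 *s e" using parallel_multiple assms(2) by blast
  have "parallel (g1 - A0 *s v) e" using w by (simp add: parallel_def g0 algebra_simps)
  then obtain A1 where "g1 - A0 *s v = A1 *s e" using parallel_multiple assms(2) by blast
  then have g1: "g1 = A0 *s v + A1 *s e" by (simp add: algebra_simps)
  have "parallel (g2 - A1 *s v) e" using w by (simp add: parallel_def g1 algebra_simps)
  then obtain A2 where "g2 - A1 *s v = A2 *s e" using parallel_multiple assms(2) by blast
  then have g2: "g2 = A1 *s v + A2 *s e" by (simp add: algebra_simps)
  have "parallel (g3 - A2 *s v) e" using w by (simp add: parallel_def g2 algebra_simps)
  then obtain A3 where "g3 - A2 *s v = A3 *s e" using parallel_multiple assms(2) by blast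
  then have g3: "g3 = A2 *s v + A3 *s e" by (simp add: algebra_simps)
  have "parallel (g4 - A3 *s v) e" using w by (simp add: parallel_def g3 algebra_simps)
  then obtain A4 where "g4 - A3 *s v = A4 *s e" using parallel_multiple assms(2) by blast
  then have g4: "g4 = A3 *s v + A4 *s e" by (simp add: algebra_simps)
  have "parallel (A4 *s e) v" using w by (simp add: parallel_def g4 algebra_simps)
  then show ?thesis using g0 g1 g2 g3 g4 by blast
qed

section \<open>Comparison of a normalised map with its inverse\<close>

definition bilinear_map :: "(complex^4 \<Rightarrow> complex^4 \<Rightarrow> complex^4) \<Rightarrow> bool" where
  "bilinear_map B \<longleftrightarrow> (\<forall>x. Vector_Spaces.linear (*s) (*s) (B x)) \<and> (\<forall>x y. B x y = B y x)"

lemma bilinear_mapD: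
  assumes "bilinear_map B"
  shows "B x (y + z) = B x y + B x z" "B x (c *s y) = c *s B x y" "B (y + z) x = B y x + B z x"
    "B (c *s y) x = c *s B y x" "B x y = B y x"
    "B x (y - z) = B x y - B x z" "B (y - z) x = B y x - B z x"
proof -
  have 1: "B x (y + z) = B x y + B x z" "B x (c *s y) = c *s B x y" "B x y = B y x" for x y z c
    using assms unfolding bilinear_map_def by (auto simp: Vector_Spaces.linear_iff)
  then show "B x (y + z) = B x y + B x z" "B x (c *s y) = c *s B x y" "B x y = B y x"
    "B (y + z) x = B y x + B z x" "B (c *s y) x = c *s B y x" by metis+
  show "B x (y - z) = B x y - B x z"
    using 1(1)[of x y "-1 *s z"] 1(2)[of x "-1" z] by simp
  then show "B (y - z) x = B y x - B z x" using 1(3) by metis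
qed

lemma quadratic_map_bilinear:
  fixes F :: "complex^4 \<Rightarrow> complex^4"
  assumes "\<And>i. form (*s) 2 (\<lambda>x. F x $ i)"
  shows "\<exists>B. bilinear_map B \<and> (\<forall>x. F x = B x x)"
proof -
  have "\<forall>i. \<exists>\<beta>. (\<forall>x. Vector_Spaces.linear (*s) (*) (\<beta> x)) \<and> (\<forall>x y. \<beta> x y = \<beta> y x) \<and> (\<forall>x. F x $ i = \<beta> x x)"
    using form_2_bilinear[OF vector_space_vec assms] by blast
  then obtain \<beta> where \<beta>: "\<And>i x. Vector_Spaces.linear (*s) (*) (\<beta> i x)" "\<And>i x y. \<beta> i x y = \<beta> i y x"
    "\<And>i x. F x $ i = \<beta> i x x" by metis
  have "bilinear_map (\<lambda>x y. \<chi> i. \<beta> i x y)"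
    unfolding bilinear_map_def using \<beta>(1,2) vector_space_vec
    by (auto simp: Vector_Spaces.linear_iff vec_eq_iff)
  then show ?thesis
    using \<beta>(3) by (intro exI[of _ "\<lambda>x y. \<chi> i. \<beta> i x y"]) (simp add: vec_eq_iff)
qed

text \<open>One half of the comparison of a normalised \<open>F x = B x x\<close> with its inverse \<open>G x = C x x\<close>:
  the condition that \<open>G (F x)\<close> is a multiple of \<open>x\<close>, for \<open>x = e + t v\<close>.\<close>

lemma normalized_half:
  assumes B: "bilinear_map B" and C: "bilinear_map C" and T: "Vector_Spaces.linear (*s) (*) T" and Te: "T e = 3"
    and Be: "\<And>v. B e v = (1/2) *s (T v *s e - v)" and Ce: "\<And>v. C e v = (1/2) *s (T v *s e - v)"
    and par: "\<And>x. parallel (C (B x x) (B x x)) x"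
    and v: "T v = 0" "v \<noteq> 0"
    and \<phi>: "B v v = \<alpha> *s e + \<phi>" "T \<phi> = 0" and \<gamma>: "C v v = \<beta> *s e + \<gamma>" "T \<gamma> = 0"
  shows "\<gamma> = \<phi>" "\<exists>A. 2 *s C v \<phi> = - (\<alpha> + \<beta>) *s v - A *s e \<and> C \<phi> \<phi> = A *s v + \<alpha> *s \<phi> - \<alpha>\<^sup>2 *s e"
proof -
  interpret T: Vector_Spaces.linear "(*s)" "(*)" T by (rule T)
  note b = bilinear_mapD[OF B] and c = bilinear_mapD[OF C]
  have e0: "e \<noteq> 0" using Te T.zero by auto
  have Cee: "C e e = e" unfolding Ce using Te by (simp add: vec_eq_iff)
  have Bee: "B e e = e" unfolding Be using Te by (simp add: vec_eq_iff)
  have Bev: "B e v = - (1/2) *s v" unfolding Be using v by (simp add: vec_eq_iff)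
  have Cev: "C e v = - (1/2) *s v" unfolding Ce using v by (simp add: vec_eq_iff)
  have Ce\<phi>: "C e \<phi> = - (1/2) *s \<phi>" unfolding Ce using \<phi>(2) by (simp add: vec_eq_iff)
  have CeF: "C e (B v v) = \<alpha> *s e - (1/2) *s \<phi>" unfolding \<phi>(1) by (simp add: c(1,2) Cee Ce\<phi> vec_eq_iff)
  \<comment> \<open>The coefficients of \<open>t\<^sup>2\<close>, \<open>t ^ 3\<close> and
    \<open>t ^ 4\<close> in \<open>G (F (e + t *s v))\<close>, which begins with
    \<open>e + t *s v\<close>.\<close>
  define g2 where "g2 = 2 *s C e (B v v) + C v v"
  define g3 where "g3 = - 2 *s C v (B v v)"
  define g4 where "g4 = C (B v v) (B v v)"
  have "parallel (e + t *s v + t ^ 2 *s g2 + t ^ 3 *s g3 + t ^ 4 *s g4) (e + t *s v)" for t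
  proof -
    have Bx: "B (e + t *s v) (e + t *s v) = e - t *s v + t\<^sup>2 *s B v v"
      using b(5)[of v e] by (simp add: b Bee Bev vec_eq_iff power2_eq_square algebra_simps)
    have "C (e - t *s v + t\<^sup>2 *s B v v) (e - t *s v + t\<^sup>2 *s B v v) = e + t *s v + t ^ 2 *s g2 + t ^ 3 *s g3 + t ^ 4 *s g4"
      unfolding g2_def g3_def g4_def using c(5)[of v e] c(5)[of "B v v" e] c(5)[of "B v v" v]
      by (simp add: c(1-4,6,7) Cee Cev vec_eq_iff power2_eq_square power3_eq_cube power4_eq_xxxx algebra_simps)
    then show ?thesis using par[of "e + t *s v"] unfolding Bx by simp
  qed
  from quartic_parallel_line[OF this e0] obtain A0 A1 A2 A3 A4 where A: "e = A0 *s e" "v = A0 *s v + A1 *s e"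
    "g2 = A1 *s v + A2 *s e" "g3 = A2 *s v + A3 *s e" "g4 = A3 *s v + A4 *s e" "parallel (A4 *s e) v" by blast
  \<comment> \<open>The multiplier is \<open>1 + A2 * t\<^sup>2 + A3 * t ^ 3\<close>: applying
    \<open>T\<close>, which kills \<open>v\<close>, determines \<open>A2\<close> and gives
    \<open>A4 = 0\<close>, while \<open>A3\<close> remains as the unknown \<open>A\<close>.\<close>
  have "A0 = 1" using A(1) e0 by (metis vec.scale_cancel_right vec.scale_one)
  then have "A1 = 0" using A(2) e0 by simp
  have g2: "A2 *s e = (2 * \<alpha> + \<beta>) *s e + (\<gamma> - \<phi>)"
    using A(3) \<open>A1 = 0\<close> unfolding g2_def CeF \<gamma>(1) by (simp add: vec_eq_iff algebra_simps)
  have "T (A2 *s e) = T ((2 * \<alpha> + \<beta>) *s e + (\<gamma> - \<phi>))" unfolding g2 ..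
  then have "3 * A2 = 3 * (2 * \<alpha> + \<beta>)"
    by (simp only: T.add T.diff T.scale \<phi>(2) \<gamma>(2) Te) (simp add: algebra_simps)
  then have A2: "A2 = 2 * \<alpha> + \<beta>" by (metis mult_cancel_left zero_neq_numeral)
  then show "\<gamma> = \<phi>" using g2 by simp
  have "A4 = 0"
  proof -
    obtain k where "A4 *s e = k *s v" using parallel_multiple[OF A(6) v(2)] by blast
    then have "T (A4 *s e) = T (k *s v)" by simp
    then show ?thesis by (simp only: T.scale Te v(1)) simp
  qed
  have CvF: "C v (B v v) = - (\<alpha> / 2) *s v + C v \<phi>"
    unfolding \<phi>(1) using c(5)[of v e] by (simp add: c(1-4,6,7) Cev vec_eq_iff)
  have g3: "2 *s C v \<phi> = - (\<alpha> + \<beta>) *s v - A3 *s e"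
  proof (intro vec_eq_iff[THEN iffD2] allI)
    fix i
    show "(2 *s C v \<phi>) $ i = (- (\<alpha> + \<beta>) *s v - A3 *s e) $ i"
      using arg_cong[OF A(4)[unfolded g3_def A2 CvF], of "\<lambda>x. x $ i"] by simp algebra
  qed
  have "g4 = \<alpha>\<^sup>2 *s e - \<alpha> *s \<phi> + C \<phi> \<phi>"
    unfolding g4_def \<phi>(1) using c(5)[of \<phi> e]
    by (simp add: c(1-4,6,7) Cee Ce\<phi> vec_eq_iff power2_eq_square algebra_simps)
  then have "C \<phi> \<phi> = A3 *s v + \<alpha> *s \<phi> - \<alpha>\<^sup>2 *s e"
    using A(5) \<open>A4 = 0\<close> by (simp add: vec_eq_iff algebra_simps)
  with g3 show "\<exists>A. 2 *s C v \<phi> = - (\<alpha> + \<beta>) *s v - A *s e \<and> C \<phi> \<phi> = A *s v + \<alpha> *s \<phi> - \<alpha>\<^sup>2 *s e" by blast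
qed

text \<open>\<open>Be\<close> says that the differential of \<open>F\<close> at \<open>e\<close> is
  \<open>T v *s e - v\<close>, as for the adjoint with trace \<open>T\<close> at the unity
  \<open>e\<close>; in particular \<open>B e e = e\<close>.\<close>

locale normalized_pair =
  fixes B C :: "complex^4 \<Rightarrow> complex^4 \<Rightarrow> complex^4" and T :: "complex^4 \<Rightarrow> complex" and e :: "complex^4"
  assumes B: "bilinear_map B" and C: "bilinear_map C" and T: "Vector_Spaces.linear (*s) (*) T" and Te: "T e = 3"
    and Be: "\<And>v. B e v = (1/2) *s (T v *s e - v)" and Ce: "\<And>v. C e v = (1/2) *s (T v *s e - v)"
    and CB: "\<And>x. parallel (C (B x x) (B x x)) x" and BC: "\<And>x. parallel (B (C x x) (C x x)) x"
begin

sublocale T: Vector_Spaces.linear "(*s)" "(*)" T by (rule T)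

lemmas b = bilinear_mapD[OF B] and c = bilinear_mapD[OF C]

text \<open>The trace-zero component of \<open>B\<close>; the sign of \<open>a\<close> is that of
  \<open>F v = m v v - a v v *s e\<close> on trace-zero vectors.\<close>

definition m where "m x y = B x y - (T (B x y) / 3) *s e"
definition a where "a x y = - T (B x y) / 3"

lemma T_m: "T (m x y) = 0"
  unfolding m_def by (simp add: T.diff T.scale Te)

lemma scale_vec_cancel: "v \<noteq> 0 \<Longrightarrow> p *s v = q *s v \<Longrightarrow> p = q" for v :: "complex^4"
  by simp

lemma same_on_trace_zero:
  assumes v: "T v = 0"
  shows "C v v = B v v"
    and "\<exists>A. 2 *s B v (m v v) = (2 * a v v) *s v - A *s e"
    and "T (B (m v v) (m v v)) = - 3 * (a v v)\<^sup>2"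
proof -
  have z: "B 0 x = 0" "C 0 x = 0" for x using b(4)[of 0 0 x] c(4)[of 0 0 x] by simp_all
  have "C v v = B v v \<and> (\<exists>A. 2 *s B v (m v v) = (2 * a v v) *s v - A *s e) \<and> T (B (m v v) (m v v)) = - 3 * (a v v)\<^sup>2"
  proof (cases "v = 0")
    case True
    have "m 0 0 = 0" unfolding m_def by (simp add: z T.zero)
    then show ?thesis unfolding True a_def by (auto simp: z T.zero intro: exI[of _ 0])
  next
    case False
    define \<alpha> \<beta> \<phi> where "\<alpha> = T (B v v) / 3" and "\<beta> = T (C v v) / 3" and "\<phi> = m v v"
    have \<phi>: "B v v = \<alpha> *s e + \<phi>" "T \<phi> = 0"
      unfolding \<phi>_def by (simp add: \<alpha>_def m_def) (rule T_m)
    have \<gamma>: "C v v = \<beta> *s e + (C v v - \<beta> *s e)" "T (C v v - \<beta> *s e) = 0"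
      by (simp_all add: \<beta>_def T.diff T.scale Te)
    have "C v v - \<beta> *s e = \<phi>"
      using normalized_half(1)[OF B C T Te Be Ce CB v False \<phi> \<gamma>] .
    then have Cv: "C v v = \<beta> *s e + \<phi>" using \<gamma>(1) by simp
    obtain A where A: "2 *s C v \<phi> = - (\<alpha> + \<beta>) *s v - A *s e" "C \<phi> \<phi> = A *s v + \<alpha> *s \<phi> - \<alpha>\<^sup>2 *s e"
      using normalized_half(2)[OF B C T Te Be Ce CB v False \<phi> Cv \<phi>(2)] by blast
    obtain A' where A': "2 *s B v \<phi> = - (\<beta> + \<alpha>) *s v - A' *s e" "B \<phi> \<phi> = A' *s v + \<beta> *s \<phi> - \<beta>\<^sup>2 *s e"
      using normalized_half(2)[OF C B T Te Ce Be BC v False Cv \<phi>(2) \<phi>] by blast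
    \<comment> \<open>If not, applying the comparison to \<open>\<phi>\<close> as well shows
      \<open>\<phi> = \<rho> *s v\<close>. Then
      \<open>2 * \<rho> * \<rho> = - (\<alpha> + \<beta>)\<close> and
      \<open>\<rho> * \<rho> = \<alpha> + \<beta>\<close>, so \<open>\<rho> = 0\<close>, which
      forces \<open>\<alpha> = \<beta> = 0\<close>.\<close>
    have ab: "\<alpha> = \<beta>"
    proof (rule ccontr)
      assume ne: "\<alpha> \<noteq> \<beta>"
      have "(\<alpha> - \<beta>) *s \<phi> = (A' - A) *s v"
      proof (cases "\<phi> = 0")
        case True
        have "A *s v = \<alpha>\<^sup>2 *s e" "A' *s v = \<beta>\<^sup>2 *s e" using A(2) A'(2) unfolding True by (simp_all add: z vec_eq_iff)
        then have "T (A *s v) = T (\<alpha>\<^sup>2 *s e)" "T (A' *s v) = T (\<beta>\<^sup>2 *s e)" by simp_all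
        then show ?thesis using ne by (simp add: T.scale v Te)
      next
        case False
        have 1: "C \<phi> \<phi> = (- \<alpha>\<^sup>2) *s e + (A *s v + \<alpha> *s \<phi>)" "T (A *s v + \<alpha> *s \<phi>) = 0"
          using A(2) by (simp_all add: T.add T.scale v \<phi>(2) vec_eq_iff)
        have 2: "B \<phi> \<phi> = (- \<beta>\<^sup>2) *s e + (A' *s v + \<beta> *s \<phi>)" "T (A' *s v + \<beta> *s \<phi>) = 0"
          using A'(2) by (simp_all add: T.add T.scale v \<phi>(2) vec_eq_iff)
        have "A *s v + \<alpha> *s \<phi> = A' *s v + \<beta> *s \<phi>"
          using normalized_half(1)[OF B C T Te Be Ce CB \<phi>(2) False 2 1] .
        then show ?thesis by (simp add: vec_eq_iff algebra_simps)
      qed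
      then have "(\<alpha> - \<beta>) * \<phi> $ i = (A' - A) * v $ i" for i
        by (metis vector_smult_component)
      then have "\<phi> = ((A' - A) / (\<alpha> - \<beta>)) *s v"
        using ne by (simp add: vec_eq_iff nonzero_eq_divide_eq mult.commute)
      then obtain \<rho> where \<rho>: "\<phi> = \<rho> *s v" by blast
      have "2 *s C v \<phi> = (2 * \<rho> * \<beta>) *s e + (2 * \<rho> * \<rho>) *s v"
        unfolding \<rho> c(2) Cv by (simp add: \<rho> vec_eq_iff algebra_simps)
      then have 1: "(2 * \<rho> * \<beta>) *s e + (2 * \<rho> * \<rho>) *s v = - (\<alpha> + \<beta>) *s v - A *s e" using A(1) by simp
      then have "T ((2 * \<rho> * \<beta>) *s e + (2 * \<rho> * \<rho>) *s v) = T (- (\<alpha> + \<beta>) *s v - A *s e)" by simp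
      then have "2 * \<rho> * \<beta> = - A" by (simp only: T.add T.diff T.scale v Te) (simp add: ac_simps)
      then have "(2 * \<rho> * \<rho>) *s v = - (\<alpha> + \<beta>) *s v" using 1 by (simp add: vec_eq_iff)
      then have e1: "2 * \<rho> * \<rho> = - (\<alpha> + \<beta>)" using False by (rule scale_vec_cancel[rotated])
      have t1: "T (C \<phi> \<phi>) = 3 * (\<rho> * \<rho> * \<beta>)" "T (B \<phi> \<phi>) = 3 * (\<rho> * \<rho> * \<alpha>)"
        unfolding \<rho> b(2,4) c(2,4) Cv \<phi>(1) using \<phi>(2) by (simp_all add: T.add T.scale Te \<rho>[symmetric])
      have t2: "T (C \<phi> \<phi>) = 3 * (- \<alpha>\<^sup>2)" "T (B \<phi> \<phi>) = 3 * (- \<beta>\<^sup>2)"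
        unfolding A(2) A'(2) by (simp_all add: T.add T.diff T.scale Te v \<phi>(2))
      have e2: "\<rho> * \<rho> * \<beta> = - \<alpha>\<^sup>2" "\<rho> * \<rho> * \<alpha> = - \<beta>\<^sup>2"
        using t1 t2 by (metis mult_cancel_left zero_neq_numeral)+
      have "(\<beta> - \<alpha>) * (\<rho> * \<rho> - (\<alpha> + \<beta>)) = 0" using e2 by algebra
      then have "\<rho> * \<rho> = \<alpha> + \<beta>" using ne by simp
      then have "3 * (\<rho> * \<rho>) = 0" using e1 by algebra
      then have "\<rho> = 0" by simp
      then show False using e2 ne by simp
    qed
    have aa: "a v v = - \<alpha>" by (simp add: a_def \<alpha>_def)
    have "C v v = B v v" using Cv \<phi>(1) ab by simp
    moreover have "2 *s B v (m v v) = (2 * a v v) *s v - A' *s e"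
      using A'(1) unfolding ab[symmetric] \<phi>_def[symmetric] aa by (simp add: vec_eq_iff algebra_simps)
    moreover have "T (B (m v v) (m v v)) = - 3 * (a v v)\<^sup>2"
      unfolding \<phi>_def[symmetric] A'(2) aa ab by (simp add: T.add T.diff T.scale Te v \<phi>(2))
    ultimately show ?thesis by blast
  qed
  then show "C v v = B v v" "\<exists>A. 2 *s B v (m v v) = (2 * a v v) *s v - A *s e"
    "T (B (m v v) (m v v)) = - 3 * (a v v)\<^sup>2" by blast+
qed

lemma m_cube:
  assumes v: "T v = 0"
  shows "m v (m v v) = a v v *s v"
proof -
  obtain A where A: "2 *s B v (m v v) = (2 * a v v) *s v - A *s e"
    using same_on_trace_zero(2)[OF v] by blast
  have "(1/2) *s (2 *s B v (m v v)) = (1/2) *s ((2 * a v v) *s v - A *s e)" unfolding A ..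
  then have B: "B v (m v v) = a v v *s v - (A / 2) *s e" by (simp add: vec_eq_iff algebra_simps)
  have "T (B v (m v v)) = - (3 * A / 2)" unfolding B by (simp add: T.diff T.scale Te v)
  then show ?thesis unfolding m_def[of v "m v v"] unfolding B by (simp add: vec_eq_iff)
qed

lemma a_square:
  assumes v: "T v = 0"
  shows "a (m v v) (m v v) = (a v v)\<^sup>2"
  using same_on_trace_zero(3)[OF v] by (simp add: a_def[of "m v v"])

lemma m_bilinear: "bilinear_map m"
proof -
  have "Vector_Spaces.linear (*s) (*s) (m x)" for x
    unfolding m_def using vector_space_vec
    by (auto simp: Vector_Spaces.linear_iff b(1,2) T.add T.scale vec_eq_iff add_divide_distrib algebra_simps)
  moreover have "m x y = m y x" for x y
    unfolding m_def by (simp only: b(5)[of x y])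
  ultimately show ?thesis unfolding bilinear_map_def by blast
qed

lemma a_linear: "Vector_Spaces.linear (*s) (*) (a x)"
  unfolding a_def using vector_space_vec vector_space_mult
  by (simp add: Vector_Spaces.linear_iff b(1,2) T.add T.scale add_divide_distrib)

lemma a_comm: "a x y = a y x"
  unfolding a_def using b(5) by metis

lemmas m_simps = bilinear_mapD[OF m_bilinear]

lemma B_eq: "B (s *s e + v) (s *s e + v) = (s\<^sup>2 - a v v) *s e - s *s v + m v v" if "T v = 0"
proof -
  have "B e e = e" "B e v = - (1/2) *s v" "B v e = - (1/2) *s v"
    using b(5)[of v e] unfolding Be using Te that by (simp_all add: vec_eq_iff)
  then show ?thesis
    by (simp add: b(1-4) a_def m_def vec_eq_iff power2_eq_square algebra_simps)
qed

text \<open>The eigenvalue \<open>\<rho> v\<close> in \<open>m v v = \<rho> v *s v\<close> is linear in \<open>v\<close>.\<close>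

lemma degenerate_factor:
  assumes deg: "\<And>v. T v = 0 \<Longrightarrow> \<exists>s t. s *s v + t *s m v v = 0 \<and> (s \<noteq> 0 \<or> t \<noteq> 0)"
  shows "\<exists>l M. Vector_Spaces.linear (*s) (*) l \<and> l e = 1 \<and> Vector_Spaces.linear (*s) (*s) M \<and>
    (\<forall>x. B x x = l x *s M x)"
proof -
  have z: "m 0 x = 0" for x using m_simps(4)[of 0 0 x] by simp
  have "\<exists>r. m v v = r *s v \<and> (v = 0 \<longrightarrow> r = 0)" if v: "T v = 0" for v
  proof (cases "v = 0")
    case True
    then show ?thesis by (intro exI[of _ 0]) (simp add: z)
  next
    case False
    obtain s t where st: "s *s v + t *s m v v = 0" "s \<noteq> 0 \<or> t \<noteq> 0" using deg[OF v] by blast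
    have "t \<noteq> 0" using st False by auto
    then have "m v v = (- s / t) *s v" using st(1) by (simp add: vec_eq_iff field_simps add_eq_0_iff)
    then show ?thesis using False by blast
  qed
  then obtain \<rho> where \<rho>: "\<And>v. T v = 0 \<Longrightarrow> m v v = \<rho> v *s v" "\<rho> 0 = 0" using T.zero by metis
  have scale: "\<rho> (k *s v) = k * \<rho> v" if v: "T v = 0" for k v
  proof (cases "v = 0 \<or> k = 0")
    case False
    have "m (k *s v) (k *s v) = (k * (k * \<rho> v)) *s v"
      using \<rho>(1)[OF v] by (simp add: m_simps)
    moreover have "m (k *s v) (k *s v) = (\<rho> (k *s v) * k) *s v"
      using \<rho>(1)[of "k *s v"] v by (simp add: T.scale)
    ultimately show ?thesis using False by simp
  qed (auto simp: \<rho>(2))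
  have add: "\<rho> (v + w) = \<rho> v + \<rho> w" if v: "T v = 0" and w: "T w = 0" for v w
  proof (cases "v = 0 \<or> (\<exists>k. w = k *s v)")
    case True
    then show ?thesis
    proof (elim disjE exE)
      fix k assume k: "w = k *s v"
      have "v + w = (1 + k) *s v" unfolding k by (simp add: vec_eq_iff algebra_simps)
      then show ?thesis using scale[OF v, of "1 + k"] scale[OF v, of k] unfolding k by (simp add: algebra_simps)
    qed (simp add: \<rho>(2))
  next
    case False
    have 1: "m (v + w) (v + w) = \<rho> (v + w) *s (v + w)" "m (v - w) (v - w) = \<rho> (v - w) *s (v - w)"
      using v w by (simp_all add: \<rho>(1) T.add T.diff)
    \<comment> \<open>The parallelogram law; for independent \<open>v\<close> and \<open>w\<close>
      its two coefficients add up to additivity of \<open>\<rho>\<close>.\<close>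
    have "m (v + w) (v + w) + m (v - w) (v - w) = 2 *s m v v + 2 *s m w w"
      using m_simps(5)[of w v] by (simp add: m_simps(1-4,6,7) vec_eq_iff)
    then have eq: "(\<rho> (v + w) + \<rho> (v - w) - 2 * \<rho> v) *s v + (\<rho> (v + w) - \<rho> (v - w) - 2 * \<rho> w) *s w = 0"
      unfolding 1 \<rho>(1)[OF v] \<rho>(1)[OF w] by (simp add: vec_eq_iff algebra_simps)
    have c2: "\<rho> (v + w) - \<rho> (v - w) - 2 * \<rho> w = 0"
    proof (rule ccontr)
      assume ne: "\<rho> (v + w) - \<rho> (v - w) - 2 * \<rho> w \<noteq> 0"
      define x y where "x = \<rho> (v + w) + \<rho> (v - w) - 2 * \<rho> v" and "y = \<rho> (v + w) - \<rho> (v - w) - 2 * \<rho> w"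
      have "w = (- x / y) *s v"
        using eq ne unfolding x_def[symmetric] y_def[symmetric] by (simp add: vec_eq_iff field_simps add_eq_0_iff)
      then show False using False by blast
    qed
    then have "\<rho> (v + w) + \<rho> (v - w) - 2 * \<rho> v = 0"
      using eq[unfolded c2 vec.scale_zero_left add_0_right] False unfolding vec.scale_eq_0_iff by blast
    then have "2 * \<rho> (v + w) = 2 * (\<rho> v + \<rho> w)" using c2 by algebra
    then show ?thesis by (metis mult_cancel_left zero_neq_numeral)
  qed
  define p where "p x = x - (T x / 3) *s e" for x
  have Tp: "T (p x) = 0" for x by (simp add: p_def T.diff T.scale Te)
  have p_lin: "p (x + y) = p x + p y" "p (k *s x) = k *s p x" for x y k
    by (simp_all add: p_def T.add T.scale vec_eq_iff add_divide_distrib algebra_simps)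
  have aa: "a v v = \<rho> v * \<rho> v" if v: "T v = 0" for v
  proof (cases "v = 0")
    case True
    interpret l: Vector_Spaces.linear "(*s)" "(*)" "a 0" by (rule a_linear)
    show ?thesis unfolding True by (simp add: l.zero \<rho>(2))
  next
    case False
    have "m v (m v v) = (\<rho> v * \<rho> v) *s v"
      by (simp only: \<rho>(1)[OF v] m_simps(2) vec.scale_scale)
    then have "a v v *s v = (\<rho> v * \<rho> v) *s v"
      using m_cube[OF v] by simp
    then show ?thesis by (rule scale_vec_cancel[OF False])
  qed
  \<comment> \<open>With \<open>m v v = \<rho> v *s v\<close> and
    \<open>a v v = (\<rho> v)\<^sup>2\<close>, \<open>B x x\<close> at \<open>x = s *s e + v\<close>
    is \<open>(s - \<rho> v) *s ((s + \<rho> v) *s e - v)\<close>.\<close>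
  define l where "l x = T x / 3 - \<rho> (p x)" for x
  define M where "M x = (T x / 3 + \<rho> (p x)) *s e - p x" for x
  have "Vector_Spaces.linear (*s) (*) l"
    unfolding Vector_Spaces.linear_iff l_def using vector_space_vec vector_space_mult
    by (simp add: p_lin add[OF Tp Tp] scale[OF Tp] T.add T.scale add_divide_distrib algebra_simps)
  moreover have "l e = 1"
    by (simp add: l_def p_def Te \<rho>(2))
  moreover have "Vector_Spaces.linear (*s) (*s) M"
    unfolding Vector_Spaces.linear_iff M_def using vector_space_vec
    by (simp add: p_lin add[OF Tp Tp] scale[OF Tp] T.add T.scale add_divide_distrib vec_eq_iff algebra_simps)
  moreover have "B x x = l x *s M x" for x
  proof -
    have x: "x = (T x / 3) *s e + p x" by (simp add: p_def)
    have "B x x = ((T x / 3)\<^sup>2 - a (p x) (p x)) *s e - (T x / 3) *s p x + m (p x) (p x)"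
      by (subst (1 2) x) (rule B_eq[OF Tp])
    then show ?thesis
      unfolding \<rho>(1)[OF Tp] aa[OF Tp] l_def M_def by (simp add: vec_eq_iff power2_eq_square algebra_simps)
  qed
  ultimately show ?thesis by blast
qed

lemma adjoint_form:
  assumes nondeg: "\<exists>v. T v = 0 \<and> (\<forall>s t. s *s v + t *s m v v = 0 \<longrightarrow> s = 0 \<and> t = 0)"
  shows "\<exists>A :: (complex^4) calg. jordan4 A \<and> has_rank A 3 \<and> adjoint_is A (\<lambda>x. B x x)"
proof -
  interpret cubic_data m a T e
  proof (rule cubic_data.intro)
    show "Vector_Spaces.linear (*s) (*s) (m x)" for x
      using m_bilinear unfolding bilinear_map_def by blast
  qed (fact m_simps(5) a_linear a_comm T Te nondeg | rule T_m | erule m_cube a_square)+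
  have "((T x / 3)\<^sup>2 - a (proj x) (proj x)) *s e - (T x / 3) *s proj x + m (proj x) (proj x) = B x x" for x
  proof -
    obtain s v where x: "x = s *s e + v" and v: "T v = 0" using decompose by metis
    show ?thesis unfolding x B_eq[OF v] T_proj_sum[OF v] by simp
  qed
  then have "is_adjoint envelope (\<lambda>x. B x x)"
    using envelope_adjoint by simp
  then have "adjoint_is envelope (\<lambda>x. B x x)"
    unfolding adjoint_is_def envelope_simps using vec.linear_ident bij_id
    by (intro exI[of _ "\<lambda>x. B x x"] exI[of _ "\<lambda>x. x"]) (simp add: id_def)
  then show ?thesis using jordan4_envelope envelope_rank by blast
qed

end

lemma linear_injI:
  assumes "Vector_Spaces.linear (*s) (*s) (f :: complex^4 \<Rightarrow> complex^4)" "\<And>v. f v = 0 \<Longrightarrow> v = 0"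
  shows "inj f"
proof (rule injI)
  interpret f: Vector_Spaces.linear "(*s)" "(*s)" f by (rule assms(1))
  fix x y assume "f x = f y"
  then show "x = y" using assms(2)[of "x - y"] by (simp add: f.diff)
qed

text \<open>The normalisation turns the differential at \<open>e\<close> into that of an adjoint at the unity.\<close>

lemma normalize:
  assumes B: "bilinear_map B" and C: "bilinear_map C"
    and CB: "\<And>x. parallel (C (B x x) (B x x)) x" and BC: "\<And>x. parallel (B (C x x) (C x x)) x"
    and e: "C (B e e) (B e e) \<noteq> 0"
  shows "\<exists>L C' T. Vector_Spaces.linear (*s) (*s) L \<and> bij L \<and> normalized_pair (\<lambda>x y. L (B x y)) C' T e"
proof -
  note b = bilinear_mapD[OF B] and c = bilinear_mapD[OF C]
  have z: "B 0 x = 0" "C 0 x = 0" for x using b(4)[of 0 0 x] c(4)[of 0 0 x] by simp_all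
  have e0: "e \<noteq> 0" using e by (auto simp: z)
  define f where "f = B e e"
  have f0: "f \<noteq> 0" using e by (auto simp: f_def z)
  \<comment> \<open>The differential of \<open>F\<close> at \<open>e\<close>.\<close>
  define D where "D v = 2 *s B e v" for v
  have D: "Vector_Spaces.linear (*s) (*s) D"
    unfolding D_def using vector_space_vec by (simp add: Vector_Spaces.linear_iff b(1,2) vec.scale_right_distrib vec.scale_left_commute)
  obtain A0 where A0: "C f f = A0 *s e"
    using parallel_multiple[OF CB[of e] e0] unfolding f_def by blast
  have A0': "A0 \<noteq> 0" using e A0 unfolding f_def by auto
  obtain j where j: "e $ j \<noteq> 0" using e0 by (auto simp: vec_eq_iff)
  \<comment> \<open>By \<open>quartic_parallel_line\<close> the differential of
    \<open>G \<circ> F\<close> at \<open>e\<close> is \<open>A0 *s v\<close> plus a multiple of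
    \<open>e\<close>. \<open>T\<close> is this multiple divided by \<open>A0\<close>, read off at a
    nonzero coordinate of \<open>e\<close>, which makes its linearity evident.\<close>
  define T where "T v = ((2 *s C f (D v) - A0 *s v) $ j) / (A0 * e $ j)" for v
  interpret D: Vector_Spaces.linear "(*s)" "(*s)" D by (rule D)
  have T: "Vector_Spaces.linear (*s) (*) T"
    unfolding T_def using vector_space_vec vector_space_mult
    by (simp add: Vector_Spaces.linear_iff D.add D.scale c(1,2) add_divide_distrib diff_divide_distrib algebra_simps)
  have g1: "2 *s C f (D v) = A0 *s v + (A0 * T v) *s e" for v
  proof -
    define g2 where "g2 = 2 *s C f (B v v) + C (D v) (D v)"
    define g3 where "g3 = 2 *s C (D v) (B v v)"
    define g4 where "g4 = C (B v v) (B v v)"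
    have "parallel (C f f + t *s (2 *s C f (D v)) + t ^ 2 *s g2 + t ^ 3 *s g3 + t ^ 4 *s g4) (e + t *s v)" for t
    proof -
      have Bx: "B (e + t *s v) (e + t *s v) = f + t *s D v + t\<^sup>2 *s B v v"
        using b(5)[of v e] by (simp add: b(1-4) f_def D_def vec_eq_iff power2_eq_square algebra_simps)
      have "C (f + t *s D v + t\<^sup>2 *s B v v) (f + t *s D v + t\<^sup>2 *s B v v)
        = C f f + t *s (2 *s C f (D v)) + t ^ 2 *s g2 + t ^ 3 *s g3 + t ^ 4 *s g4"
        unfolding g2_def g3_def g4_def using c(5)[of "D v" f] c(5)[of "B v v" f] c(5)[of "B v v" "D v"]
        by (simp add: c(1-4) vec_eq_iff power2_eq_square power3_eq_cube power4_eq_xxxx algebra_simps)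
      then show ?thesis using CB[of "e + t *s v"] unfolding Bx by simp
    qed
    from quartic_parallel_line[OF this e0] obtain A A1 where A: "C f f = A *s e" "2 *s C f (D v) = A *s v + A1 *s e" by blast
    have "A = A0" using A(1) A0 e0 by (metis vec.scale_cancel_right)
    then have "T v = A1 / A0" unfolding T_def A(2) using j A0' by simp
    then show ?thesis using A(2) \<open>A = A0\<close> A0' by simp
  qed
  interpret T: Vector_Spaces.linear "(*s)" "(*)" T by (rule T)
  have De: "D e = 2 *s f" by (simp add: D_def f_def)
  \<comment> \<open>Euler's relation: \<open>G \<circ> F\<close> has degree 4, so its differential
    maps \<open>e\<close> to \<open>4 * A0\<close> times \<open>e\<close>, which equals
    \<open>A0 + A0 * T e\<close> times \<open>e\<close>.\<close>
  have Te: "T e = 3"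
  proof -
    have "2 *s C f (D e) = (4 * A0) *s e" unfolding De by (simp add: c(2) A0)
    then have "(4 * A0) *s e = (A0 + A0 * T e) *s e" unfolding g1 by (simp add: vec_eq_iff algebra_simps)
    then have "4 * A0 = A0 + A0 * T e" using e0 by (metis vec.scale_cancel_right)
    then have "A0 * (T e - 3) = 0" by algebra
    then show ?thesis using A0' by simp
  qed
  have injD: "inj D"
  proof (rule linear_injI[OF D])
    fix v assume "D v = 0"
    then have "A0 *s v + (A0 * T v) *s e = 0" using g1[of v] c(2)[of f 0 0] by simp
    then have "A0 *s (v + T v *s e) = 0" by (simp add: vec_eq_iff algebra_simps)
    then have "v + T v *s e = 0" using A0' unfolding vec.scale_eq_0_iff by blast
    then have v: "v = (- T v) *s e" by (simp add: vec_eq_iff add_eq_0_iff)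
    then have "D v = (- T v) *s (2 *s f)" by (metis D.scale De)
    then have "T v = 0" using \<open>D v = 0\<close> f0 by simp
    then show "v = 0" using v by simp
  qed
  \<comment> \<open>The differential wanted at \<open>e\<close>; composing \<open>F\<close> with
    \<open>R \<circ> inv D\<close> achieves it.\<close>
  define R where "R v = T v *s e - v" for v
  have R: "Vector_Spaces.linear (*s) (*s) R"
    unfolding R_def using vector_space_vec
    by (simp add: Vector_Spaces.linear_iff T.add T.scale vec_eq_iff algebra_simps)
  interpret R: Vector_Spaces.linear "(*s)" "(*s)" R by (rule R)
  have injR: "inj R"
  proof (rule linear_injI[OF R])
    fix v assume "R v = 0"
    then have v: "v = T v *s e" by (simp add: R_def)
    then have "T v = T v * 3" by (metis T.scale Te)
    then have "T v = 0" by simp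
    then show "v = 0" using v by simp
  qed
  have bij: "bij D" "bij R"
    using vec.linear_injective_imp_surjective[OF D injD] vec.linear_injective_imp_surjective[OF R injR] injD injR
    by (simp_all add: bij_def)
  define L where "L = R \<circ> inv D"
  define K where "K = D \<circ> inv R"
  have L: "Vector_Spaces.linear (*s) (*s) L" "bij L"
    unfolding L_def using Vector_Spaces.linear_compose[OF linear_bij_inv[OF D bij(1)] R] bij by (auto intro: bij_comp bij_imp_bij_inv)
  have K: "Vector_Spaces.linear (*s) (*s) K"
    unfolding K_def using Vector_Spaces.linear_compose[OF linear_bij_inv[OF R bij(2)] D] .
  have LD: "L (D v) = R v" and KR: "K (R v) = D v" and KL: "K (L x) = x" and LK: "L (K x) = x" for v x
    using bij by (simp_all add: L_def K_def bij_is_inj bij_is_surj surj_f_inv_f)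
  interpret L: Vector_Spaces.linear "(*s)" "(*s)" L by (rule L(1))
  interpret K: Vector_Spaces.linear "(*s)" "(*s)" K by (rule K)
  \<comment> \<open>\<open>K\<close> is the inverse of \<open>L\<close>, so this is the inverse of
    the new map, rescaled to fix \<open>e\<close>.\<close>
  define C' where "C' x y = inverse A0 *s C (K x) (K y)" for x y
  have Le: "L (B e v) = (1/2) *s (T v *s e - v)" for v
  proof -
    have "B e v = (1/2) *s D v" by (simp add: D_def)
    then show ?thesis using LD[of v] by (simp add: L.scale R_def)
  qed
  have Ke: "K e = f"
  proof -
    have "R e = 2 *s e" by (simp add: R_def Te vec_eq_iff)
    then have "2 *s K e = 2 *s f" using KR[of e] De by (simp add: K.scale)
    then show ?thesis by simp
  qed
  have C'R: "2 *s C' e (R v) = v + T v *s e" for v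
  proof -
    have "2 *s C' e (R v) = inverse A0 *s (2 *s C f (D v))" by (simp add: C'_def Ke KR mult.commute)
    also have "\<dots> = v + T v *s e" unfolding g1 using A0' by (simp add: vec_eq_iff field_simps)
    finally show ?thesis .
  qed
  have C'ee: "C' e e = e" unfolding C'_def Ke A0 using A0' by simp
  have C': "bilinear_map C'"
    unfolding bilinear_map_def C'_def Vector_Spaces.linear_iff using c(5) vector_space_vec
    by (auto simp: c(1,2) K.add K.scale vec.scale_right_distrib mult.commute)
  note c' = bilinear_mapD[OF C']
  have "normalized_pair (\<lambda>x y. L (B x y)) C' T e"
  proof (rule normalized_pair.intro)
    show "bilinear_map (\<lambda>x y. L (B x y))"
    proof -
      have "L (B x y) = L (B y x)" for x y using b(5)[of x y] by simp
      then show ?thesis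
        unfolding bilinear_map_def Vector_Spaces.linear_iff using vector_space_vec by (simp add: b(1,2) L.add L.scale)
    qed
    show "bilinear_map C'" "Vector_Spaces.linear (*s) (*) T" "T e = 3" by (fact C' T Te)+
    show "L (B e v) = (1/2) *s (T v *s e - v)" for v by (rule Le)
    show "C' e v = (1/2) *s (T v *s e - v)" for v
    proof -
      have "2 *s (T v *s e - C' e v) = v + T v *s e"
        using C'R[of v] unfolding R_def c'(6) c'(2) C'ee .
      then show ?thesis by (simp add: vec_eq_iff field_simps) 
    qed
    show "parallel (C' (L (B x x)) (L (B x x))) x" for x
      unfolding C'_def KL using CB[of x] by (simp add: parallel_def)
    show "parallel (L (B (C' x x) (C' x x))) x" for x
    proof -
      have "C' x x = inverse A0 *s C (K x) (K x)" by (simp add: C'_def)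
      then have eq: "L (B (C' x x) (C' x x)) = (inverse A0 * inverse A0) *s L (B (C (K x) (K x)) (C (K x) (K x)))"
        by (simp add: b(2,4) L.scale)
      show ?thesis
      proof (cases "K x = 0")
        case True
        then show ?thesis unfolding eq True by (simp add: z parallel_def L.zero)
      next
        case False
        from parallel_multiple[OF BC[of "K x"] False] obtain k where "B (C (K x) (K x)) (C (K x) (K x)) = k *s K x" ..
        then show ?thesis unfolding eq by (simp add: L.scale LK parallel_def)
      qed
    qed
  qed
  then show ?thesis using L by blast
qed

lemma quadro_quadric_adjoint:
  assumes "quadro_quadric_cremona F"
  shows "\<exists>F' (A :: (complex^4) calg). strongly_equivalent F F' \<and> jordan4 A \<and> has_rank A 3 \<and> adjoint_is A F'"
proof -
  obtain G where F: "coprime_quadratic_forms F" and G: "coprime_quadratic_forms G" and inv: "inverse_ratmaps F G"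
    using assms unfolding quadro_quadric_cremona_def by blast
  obtain B where B: "bilinear_map B" "\<And>x. F x = B x x"
    using quadratic_map_bilinear[of F] F unfolding coprime_quadratic_forms_def by blast
  obtain C where C: "bilinear_map C" "\<And>x. G x = C x x"
    using quadratic_map_bilinear[of G] G unfolding coprime_quadratic_forms_def by blast
  have CB: "parallel (C (B x x) (B x x)) x" "parallel (B (C x x) (C x x)) x" for x
    using inv unfolding inverse_ratmaps_def same_ratmap_def parallel_def by (simp_all add: B(2)[symmetric] C(2)[symmetric])
  obtain e where e: "C (B e e) (B e e) \<noteq> 0"
    using inv unfolding inverse_ratmaps_def by (auto simp: B(2) C(2))
  obtain L C' T where L: "Vector_Spaces.linear (*s) (*s) L" "bij L" and N: "normalized_pair (\<lambda>x y. L (B x y)) C' T e"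
    using normalize[OF B(1) C(1) CB e] by blast
  interpret N: normalized_pair "\<lambda>x y. L (B x y)" C' T e by (rule N)
  \<comment> \<open>Otherwise \<open>degenerate_factor\<close> exhibits a linear form dividing all
    entries of \<open>F\<close>.\<close>
  have "\<exists>v. T v = 0 \<and> (\<forall>s t. s *s v + t *s N.m v v = 0 \<longrightarrow> s = 0 \<and> t = 0)"
  proof (rule ccontr)
    assume "\<nexists>v. T v = 0 \<and> (\<forall>s t. s *s v + t *s N.m v v = 0 \<longrightarrow> s = 0 \<and> t = 0)"
    then have "\<exists>s t. s *s v + t *s N.m v v = 0 \<and> (s \<noteq> 0 \<or> t \<noteq> 0)" if "T v = 0" for v using that by blast
    from N.degenerate_factor[OF this] obtain l M where l: "Vector_Spaces.linear (*s) (*) l" "l e = 1"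
      and M: "Vector_Spaces.linear (*s) (*s) M" and BM: "\<And>x. L (B x x) = l x *s M x" by blast
    interpret l: Vector_Spaces.linear "(*s)" "(*)" l by (rule l(1))
    have "poly_fun (*s) l" by (rule poly_fun.linear[OF l(1)])
    moreover have "\<nexists>c. \<forall>x. l x = c" using l(2) l.zero by (metis zero_neq_one)
    moreover have "\<exists>q. poly_fun (*s) q \<and> (\<forall>x. F x $ i = l x * q x)" for i
    proof (intro exI conjI allI)
      note Li = linear_bij_inv[OF L]
      interpret Li: Vector_Spaces.linear "(*s)" "(*s)" "inv L" by (rule Li)
      show "poly_fun (*s) (\<lambda>x. inv L (M x) $ i)"
        using poly_fun.linear[OF linear_nth[OF Vector_Spaces.linear_compose[OF M Li]]] by (simp add: comp_def)
      show "F x $ i = l x * inv L (M x) $ i" for x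
      proof -
        have "F x = inv L (l x *s M x)" unfolding BM[symmetric] B(2) using L(2) by (simp add: bij_is_inj)
        then show ?thesis by (simp add: Li.scale)
      qed
    qed
    ultimately show False using F unfolding coprime_quadratic_forms_def by blast
  qed
  from N.adjoint_form[OF this] obtain A :: "(complex^4) calg" where
    A: "jordan4 A" "has_rank A 3" "adjoint_is A (\<lambda>x. L (B x x))" by blast
  moreover have "strongly_equivalent F (\<lambda>x. L (B x x))"
    unfolding strongly_equivalent_def
  proof (intro exI conjI allI)
    show "Vector_Spaces.linear (*s) (*s) L" "bij L" by (fact L)+
    show "Vector_Spaces.linear (*s) (*s) (\<lambda>x::complex^4. x)" "bij (\<lambda>x::complex^4. x)"
      using vec.linear_ident bij_id by (simp_all add: id_def)
    show "L (B x x) = L (F x)" for x by (simp add: B(2))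
  qed
  ultimately show ?thesis by blast
qed

section \<open>The classification\<close>

lemma adjoint_is_J4:
  "adjoint_is J4_1 Q1" "adjoint_is J4_2 Q2" "adjoint_is J4_3 Q3" "adjoint_is J4_4 Q4" "adjoint_is J4_5 Q5"
  "adjoint_is J4_6 Q6" "adjoint_is J4_7 Q7"
  by (fact adjoint_J4_1 adjoint_J4_2 adjoint_J4_3 adjoint_J4_4 adjoint_J4_5 adjoint_J4_6 adjoint_J4_7)+

definition iso_J4 :: "'a::ab_group_add calg \<Rightarrow> nat \<Rightarrow> bool" where
  "iso_J4 A k \<longleftrightarrow> [isomorphic A J4_1, isomorphic A J4_2, isomorphic A J4_3, isomorphic A J4_4,
           isomorphic A J4_5, isomorphic A J4_6, isomorphic A J4_7] ! k"

lemma less_7: "k < 7 \<Longrightarrow> k = 0 \<or> k = 1 \<or> k = 2 \<or> k = 3 \<or> k = 4 \<or> k = 5 \<or> k = (6::nat)"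
  by auto

lemma iso_J4_adjoint:
  assumes "jordan4 A" "k < 7" "iso_J4 A k"
  shows "adjoint_is A ([Q1, Q2, Q3, Q4, Q5, Q6, Q7] ! k)"
proof -
  have "jordan4 J4_1" "jordan4 J4_2" "jordan4 J4_3" "jordan4 J4_4" "jordan4 J4_5" "jordan4 J4_6" "jordan4 J4_7"
    using jordan4_J4_123 jordan4_J4_4567 by simp_all
  note t = this[THEN adjoint_is_isomorphic[OF assms(1)]]
  show ?thesis
    using less_7[OF assms(2)] assms(3)
      t(1)[OF _ adjoint_is_J4(1)] t(2)[OF _ adjoint_is_J4(2)] t(3)[OF _ adjoint_is_J4(3)]
      t(4)[OF _ adjoint_is_J4(4)] t(5)[OF _ adjoint_is_J4(5)] t(6)[OF _ adjoint_is_J4(6)]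
      t(7)[OF _ adjoint_is_J4(7)]
    unfolding iso_J4_def by (elim disjE) simp_all
qed

lemma rank3_iso_J4:
  assumes "jordan4 A" "has_rank A 3"
  shows "\<exists>k < 7. iso_J4 A k"
proof -
  interpret jordan4 A by fact
  have *: "\<exists>k < 7. iso_J4 A k" if "iso_J4 A k" "k \<in> {..<7}" for k using that by blast
  show ?thesis
    using rank3_classification[OF assms(2)] *[of 0] *[of 1] *[of 2] *[of 3] *[of 4] *[of 5] *[of 6]
    by (elim disjE) (simp_all add: iso_J4_def)
qed

lemma unique_J4:
  assumes "jordan4 A" "has_rank A 3"
  shows "\<exists>!k. k < 7 \<and> iso_J4 A k"
proof -
  interpret jordan4 A by fact
  obtain k where "k < 7" "iso_J4 A k" using rank3_iso_J4[OF assms] by blast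
  moreover have "i = j" if "i < 7" "iso_J4 A i" "j < 7" "iso_J4 A j" for i j
    using Q_inequivalent[OF that(1,3)] adjoint_is_unique[OF assms(2)] iso_J4_adjoint[OF assms(1)] that by blast
  ultimately show ?thesis by blast
qed

lemma nth_Q: "k < 7 \<Longrightarrow> [Q1, Q2, Q3, Q4, Q5, Q6, Q7] ! k \<in> {Q1, Q2, Q3, Q4, Q5, Q6, Q7}"
  using nth_mem[of k "[Q1, Q2, Q3, Q4, Q5, Q6, Q7]"] by simp

lemma unique_Q:
  assumes "quadro_quadric_cremona F"
  shows "\<exists>!k. k < 7 \<and> linearly_equivalent F ([Q1, Q2, Q3, Q4, Q5, Q6, Q7] ! k)"
proof -
  have F: "coprime_quadratic_forms F" using assms unfolding quadro_quadric_cremona_def by blast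
  obtain F' and A :: "(complex^4) calg" where A: "strongly_equivalent F F'" "jordan4 A" "has_rank A 3" "adjoint_is A F'"
    using quadro_quadric_adjoint[OF assms] by blast
  interpret jordan4 A by (rule A(2))
  obtain k where k: "k < 7" "iso_J4 A k" using rank3_iso_J4[OF A(2,3)] by blast
  have "strongly_equivalent F ([Q1, Q2, Q3, Q4, Q5, Q6, Q7] ! k)"
    using strongly_equivalent_trans[OF A(1) adjoint_is_unique[OF A(3,4) iso_J4_adjoint[OF A(2) k]]] .
  then have "linearly_equivalent F ([Q1, Q2, Q3, Q4, Q5, Q6, Q7] ! k)" by (rule strongly_imp_linearly_equivalent)
  moreover have "i = j" if "i < 7" "linearly_equivalent F ([Q1, Q2, Q3, Q4, Q5, Q6, Q7] ! i)"
    "j < 7" "linearly_equivalent F ([Q1, Q2, Q3, Q4, Q5, Q6, Q7] ! j)" for i j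
    using Q_inequivalent[OF that(1,3)] strongly_equivalent_trans strongly_equivalent_sym
      linearly_imp_strongly_equivalent[OF F nth_Q[OF that(1)] that(2)]
      linearly_imp_strongly_equivalent[OF F nth_Q[OF that(3)] that(4)] by blast
  ultimately show ?thesis using k(1) by blast
qed

lemma jordan4_iff: "jordan4 A \<longleftrightarrow> jordan_algebra A \<and> alg_dim A = 4"
  by (simp add: jordan4_def jordan_def jordan4_axioms_def)

theorem mainTheorem6:
  shows
    "(\<forall>J \<in> {J4_1, J4_2, J4_3}. jordan_algebra J \<and> has_rank J 3 \<and> alg_dim J = 4) \<and>
     (\<forall>J \<in> {J4_4, J4_5, J4_6, J4_7}. jordan_algebra J \<and> has_rank J 3 \<and> alg_dim J = 4) \<and>
     (\<forall>A :: 'a::ab_group_add calg. jordan_algebra A \<and> has_rank A 3 \<and> alg_dim A = 4 \<longrightarrow>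
        (\<exists>!k. k < 7 \<and>
          [isomorphic A J4_1, isomorphic A J4_2, isomorphic A J4_3, isomorphic A J4_4,
           isomorphic A J4_5, isomorphic A J4_6, isomorphic A J4_7] ! k)) \<and>
     (\<forall>Q \<in> {Q1, Q2, Q3, Q4, Q5, Q6, Q7}. quadro_quadric_cremona Q) \<and>
     (\<forall>F :: complex^4 \<Rightarrow> complex^4. quadro_quadric_cremona F \<longrightarrow>
        (\<exists>!k. k < 7 \<and> linearly_equivalent F ([Q1, Q2, Q3, Q4, Q5, Q6, Q7] ! k))) \<and>
     adjoint_equivalent J4_1 Q1 \<and> adjoint_equivalent J4_2 Q2 \<and> adjoint_equivalent J4_3 Q3 \<and>
     adjoint_equivalent J4_4 Q4 \<and> adjoint_equivalent J4_5 Q5 \<and> adjoint_equivalent J4_6 Q6 \<and>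
     adjoint_equivalent J4_7 Q7"
proof (intro conjI ballI allI impI)
  show "jordan_algebra J" "alg_dim J = 4" "has_rank J 3" if "J \<in> {J4_1, J4_2, J4_3}" for J
    using jordan4_J4_123[OF that] has_rank_J4_123[OF that] unfolding jordan4_iff by simp_all
  show "jordan_algebra J" "alg_dim J = 4" "has_rank J 3" if "J \<in> {J4_4, J4_5, J4_6, J4_7}" for J
    using jordan4_J4_4567[OF that] has_rank_J4_4567 that unfolding jordan4_iff by auto
  show "\<exists>!k. k < 7 \<and>
          [isomorphic A J4_1, isomorphic A J4_2, isomorphic A J4_3, isomorphic A J4_4,
           isomorphic A J4_5, isomorphic A J4_6, isomorphic A J4_7] ! k"
    if "jordan_algebra A \<and> has_rank A 3 \<and> alg_dim A = 4" for A :: "'a calg"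
    using unique_J4[of A] that unfolding jordan4_iff iso_J4_def by simp
  show "quadro_quadric_cremona Q" if "Q \<in> {Q1, Q2, Q3, Q4, Q5, Q6, Q7}" for Q
    by (rule quadro_quadric_Q[OF that])
  show "\<exists>!k. k < 7 \<and> linearly_equivalent F ([Q1, Q2, Q3, Q4, Q5, Q6, Q7] ! k)" if "quadro_quadric_cremona F" for F
    by (rule unique_Q[OF that])
qed (rule adjoint_is_imp_adjoint_equivalent, rule adjoint_is_J4)+

end
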